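(* Let $\mathcal T$ be a physical theory. Equipped with the map $\rightarrow\,:\widetilde V_{\mathcal T}\otimes\widetilde{\mathcal F}_{\mathcal T}\to\widetilde{\mathcal F}_{\mathcal T}$ defined by $$\bar\Gamma_1\rightarrow(\bar\Gamma_2,\bar\gamma_2)=\sum_{v\in\mathcal V(\gamma_2),\ v=\mathrm{res}\,\bar\Gamma_1}(\bar\Gamma_1\triangleright_v\bar\Gamma_2,\ \bar\Gamma_1\triangleright_v\bar\gamma_2),$$ the space $\widetilde{\mathcal F}_{\mathcal T}$ is a pre-Lie module on the pre-Lie algebra $(\widetilde V_{\mathcal T},\triangleright)$. In other words, for any $\bar\Gamma_1,\bar\Gamma_2\in\widetilde V_{\mathcal T}$ and $(\bar\Gamma_3,\bar\gamma_3)\in\widetilde{\mathcal F}_{\mathcal T}$, $$\bar\Gamma_1\rightarrow\big[\bar\Gamma_2\rightarrow(\bar\Gamma_3,\bar\gamma_3)\big]-(\bar\Gamma_1\triangleright\bar\Gamma_2)\rightarrow(\bar\Gamma_3,\bar\gamma_3)=\bar\Gamma_2\rightarrow\big[\bar\Gamma_1\rightarrow(\bar\Gamma_3,\bar\gamma_3)\big]-(\bar\Gamma_2\triangleright\bar\Gamma_1)\rightarrow(\bar\Gamma_3,\bar\gamma_3).$$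
   Context: **Feynman graphs.** A graph $\Gamma$ is given by a finite set $\mathcal V(\Gamma)$ of vertices, a finite set $\mathcal E(\Gamma)$ of half-edges, a map $\partial:\mathcal E(\Gamma)\to\mathcal V(\Gamma)$ and an involution $\sigma_\Gamma:\mathcal E(\Gamma)\to\mathcal E(\Gamma)$. Half-edges are partitioned into types and $\sigma_\Gamma$ respects types. Fixed points of $\sigma_\Gamma$ are the external edges; pairs $\{e,\sigma_\Gamma(e)\}$ with $e\ne\sigma_\Gamma(e)$ are the internal edges; $st(v)=\partial^{-1}(v)$. Graphs are considered up to isomorphism. $\pi_0(\Gamma)$ is the set of connected components. A $1PI$ graph is a connected graph which remains connected when any one internal edge is cut (replaced by two external edges); a graph is locally $1PI$ if all its connected components are $1PI$. The residue $\mathrm{res}\,\Gamma$ is obtained by shrinking each connected component to a point (retaining its external edges). A covering subgraph $\gamma$ of $\Gamma$ is a graph obtained from $\Gamma$ by cutting some internal edges (same vertices and half-edges). $\Gamma/\gamma$ is obtained by shrinking each connected component of $\gamma$ inside $\Gamma$ to a point. **Theory.** A theory $\mathcal T$ prescribes a set $\mathcal E(\mathcal T)$ of half-edge types and a set $\mathcal V(\mathcal T)$ of vertex types. The types of the half-edges in $st(v)$ need not determine the type of $v$; vertex types sharing the same collection of half-edge types are distinguished by an integer index. **Specified graphs.** A specified graph of $\mathcal T$ is a couple $\bar\Gamma=(\Gamma,\underline i)$ where $\Gamma$ is a locally $1PI$ superficially divergent graph (the residue of each component is a vertex of $\mathcal T$) with half-edges and vertices of the types prescribed by $\mathcal T$,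 and $\underline i:\pi_0(\Gamma)\to\mathbb N$ is such that $\underline i(\gamma)$ is one of the indices allowed by the possible types of the vertex obtained by contracting the component $\gamma$. A specified graph $\bar\gamma=(\gamma,\underline j)$ is a specified covering subgraph of $\bar\Gamma=(\Gamma,\underline i)$, written $\bar\gamma\subset\bar\Gamma$, if $\gamma$ is a covering subgraph of $\Gamma$ and $\underline j(\gamma_0)=\underline i(\gamma_0)$ for every component $\gamma_0$ of $\gamma$ that is also a component of $\Gamma$. The contracted graph $\bar\Gamma/\bar\gamma$ is $\Gamma/\gamma$ with the new vertices given the types specified by $\underline j$, and with specification $\underline i$. $\widetilde V_{\mathcal T}$ is the vector space (over a field $k$) generated by the connected ($1PI$) specified graphs; $\widetilde{\mathcal F}_{\mathcal T}$ is the vector space spanned by pairs $(\bar\Gamma,\bar\gamma)$ with $\bar\Gamma$ a connected $1PI$ specified graph, $\bar\gamma\subset\bar\Gamma$ and $\bar\Gamma/\bar\gamma\in\widetilde V_{\mathcal T}$. **Insertion.** For connected specified graphs $\bar\Gamma_1=(\Gamma_1,\underline i)$, $\bar\Gamma_2=(\Gamma_2,\underline j)$ and $v\in\mathcal V(\Gamma_2)$, $\bar\Gamma_1\triangleright_v\bar\Gamma_2=(\Gamma_1\cup_v\Gamma_2,\underline j)$ if $v=\mathrm{res}\,\bar\Gamma_1$ (the type of $v$ is that of the vertex $\mathrm{res}\,\bar\Gamma_1$), and $0$ otherwise. Here $\Gamma_1\cup_v\Gamma_2$ is the sum of all possible graphs obtained by replacing $v$ by $\Gamma_1$ in $\Gamma_2$,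 i.e. the sum over all type-preserving bijections between the external edges of $\Gamma_1$ and $st(v)$. One sets $\bar\Gamma_1\triangleright\bar\Gamma_2=\sum_{v\in\mathcal V(\Gamma_2)}\bar\Gamma_1\triangleright_v\bar\Gamma_2$. The same notation $\bar\Gamma_1\triangleright_v\bar\gamma_2$ is used for $\bar\gamma_2$ non-connected (insertion at $v$, all specifications of $\bar\gamma_2$ being kept). **Convention for pairs.** In a pair $(\bar\Gamma,\bar\gamma)$ the components of $\gamma$ consisting of a single vertex without internal edge are suppressed from the notation: $\mathcal V(\gamma)$ denotes the set of vertices lying in components of $\gamma$ having at least one internal edge. In $(\bar\Gamma_1\triangleright_v\bar\Gamma_2,\bar\Gamma_1\triangleright_v\bar\gamma_2)$ the insertion is performed simultaneously (with the same bijection) in $\bar\Gamma_2$ and in its subgraph $\bar\gamma_2$, and one sums over the bijections. All maps are extended (bi)linearly. **Pre-Lie module.** For a left pre-Lie algebra $(\mathcal A,\circ)$, a left $\mathcal A$-module is a vector space $\mathcal M$ with a bilinear map $\succ:\mathcal A\otimes\mathcal M\to\mathcal M$ such that $a\succ(b\succ m)-(a\circ b)\succ m=b\succ(a\succ m)-(b\circ a)\succ m$ for all $a,b\in\mathcal A$, $m\in\mathcal M$. *)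

theory Defs
  imports Complex_Main "HOL-Library.FuncSet" "HOL-Library.Multiset" "HOL-Library.Poly_Mapping"
begin

section \<open>Feynman graphs\<close>

text \<open>
  \<open>halves\<close> are the half-edges, \<open>bdry\<close> is the incidence map from half-edges to vertices and \<open>flip\<close> the
  involution. The type of a vertex is the multiset of the types of the half-edges meeting it
  together with an index, so only the index \<open>vindex\<close> has to be stored.
  Only the values of the functions on \<open>verts\<close> and \<open>halves\<close> are meaningful.
\<close>

record ('v, 'h, 't) fgraph =
  verts :: "'v set"
  halves :: "'h set"
  bdry :: "'h \<Rightarrow> 'v"
  flip :: "'h \<Rightarrow> 'h"
  htype :: "'h \<Rightarrow> 't"
  vindex :: "'v \<Rightarrow> nat"

definition wf_graph :: "('v, 'h, 't) fgraph \<Rightarrow> bool" where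
  "wf_graph G \<longleftrightarrow> finite (verts G) \<and> finite (halves G) \<and>
     (\<forall>e \<in> halves G. bdry G e \<in> verts G \<and> flip G e \<in> halves G \<and> flip G (flip G e) = e \<and>
        htype G (flip G e) = htype G e)"

definition external :: "('v, 'h, 't) fgraph \<Rightarrow> 'h set" where
  "external G = {e \<in> halves G. flip G e = e}"

definition star :: "('v, 'h, 't) fgraph \<Rightarrow> 'v \<Rightarrow> 'h set" where
  "star G v = {e \<in> halves G. bdry G e = v}"

definition half_types_at :: "('v, 'h, 't) fgraph \<Rightarrow> 'v \<Rightarrow> 't multiset" where
  "half_types_at G v = image_mset (htype G) (mset_set (star G v))"

definition vertex_type :: "('v, 'h, 't) fgraph \<Rightarrow> 'v \<Rightarrow> 't multiset \<times> nat" where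
  "vertex_type G v = (half_types_at G v, vindex G v)"

definition conn :: "('v, 'h, 't) fgraph \<Rightarrow> ('v \<times> 'v) set" where
  "conn G = {(u, w). u \<in> verts G \<and> w \<in> verts G \<and>
     (u, w) \<in> ((\<lambda>e. (bdry G e, bdry G (flip G e))) ` halves G)\<^sup>*}"

text \<open>A connected component is represented by its set of vertices.\<close>

definition components :: "('v, 'h, 't) fgraph \<Rightarrow> 'v set set" where
  "components G = verts G // conn G"

definition component_graph :: "('v, 'h, 't) fgraph \<Rightarrow> 'v set \<Rightarrow> ('v, 'h, 't) fgraph" where
  "component_graph G C = G\<lparr>verts := C, halves := {e \<in> halves G. bdry G e \<in> C}\<rparr>"

definition connected_graph :: "('v, 'h, 't) fgraph \<Rightarrow> bool" where
  "connected_graph G \<longleftrightarrow> card (components G) = 1"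

definition cut_edge :: "('v, 'h, 't) fgraph \<Rightarrow> 'h \<Rightarrow> ('v, 'h, 't) fgraph" where
  "cut_edge G e = G\<lparr>flip := (flip G)(e := e, flip G e := flip G e)\<rparr>"

definition one_PI :: "('v, 'h, 't) fgraph \<Rightarrow> bool" where
  "one_PI G \<longleftrightarrow> connected_graph G \<and>
     (\<forall>e \<in> halves G. flip G e \<noteq> e \<longrightarrow> connected_graph (cut_edge G e))"

definition locally_one_PI :: "('v, 'h, 't) fgraph \<Rightarrow> bool" where
  "locally_one_PI G \<longleftrightarrow> (\<forall>C \<in> components G. one_PI (component_graph G C))"

definition covering_subgraph :: "('v, 'h, 't) fgraph \<Rightarrow> ('v, 'h, 't) fgraph \<Rightarrow> bool" where
  "covering_subgraph S G \<longleftrightarrow> wf_graph S \<and> verts S = verts G \<and> halves S = halves G \<and>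
     (\<forall>e \<in> halves G. bdry S e = bdry G e \<and> htype S e = htype G e \<and>
        (flip S e = flip G e \<or> flip S e = e)) \<and>
     (\<forall>v \<in> verts G. vindex S v = vindex G v)"

text \<open>
  The contraction of the components of a covering subgraph \<open>S\<close> of \<open>G\<close>. A half-edge survives iff it
  is not part of an internal edge of \<open>S\<close>; the vertices are the components of \<open>S\<close>, with indices
  given by \<open>j\<close>.
\<close>

definition contract ::
  "('v, 'h, 't) fgraph \<Rightarrow> ('v, 'h, 't) fgraph \<Rightarrow> ('v set \<Rightarrow> nat) \<Rightarrow> ('v set, 'h, 't) fgraph" where
  "contract G S j = \<lparr>verts = components S, halves = {e \<in> halves G. flip S e = e},
     bdry = (\<lambda>e. conn S `` {bdry G e}), flip = flip G, htype = htype G, vindex = j\<rparr>"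


section \<open>Theories and specified graphs\<close>

record 't qft =
  half_edge_types :: "'t set"
  vertex_types :: "('t multiset \<times> nat) set"

definition physical_theory :: "'t qft \<Rightarrow> bool" where
  "physical_theory T \<longleftrightarrow> (\<forall>(M, n) \<in> vertex_types T. set_mset M \<subseteq> half_edge_types T)"

definition graph_of_theory :: "'t qft \<Rightarrow> ('v, 'h, 't) fgraph \<Rightarrow> bool" where
  "graph_of_theory T G \<longleftrightarrow> wf_graph G \<and> (\<forall>e \<in> halves G. htype G e \<in> half_edge_types T) \<and>
     (\<forall>v \<in> verts G. vertex_type G v \<in> vertex_types T)"

type_synonym ('v, 'h, 't) spec_graph = "('v, 'h, 't) fgraph \<times> ('v set \<Rightarrow> nat)"

text \<open>The residue contracts every component; its vertices are indexed by the specification.\<close>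

definition residue :: "('v, 'h, 't) spec_graph \<Rightarrow> ('v set, 'h, 't) fgraph" where
  "residue X = contract (fst X) (fst X) (snd X)"

definition superficially_divergent :: "'t qft \<Rightarrow> ('v, 'h, 't) fgraph \<Rightarrow> bool" where
  "superficially_divergent T G \<longleftrightarrow>
     (\<forall>C \<in> components G. \<exists>n. vertex_type (residue (G, \<lambda>_. n)) C \<in> vertex_types T)"

definition specified_graph :: "'t qft \<Rightarrow> ('v, 'h, 't) spec_graph \<Rightarrow> bool" where
  "specified_graph T X \<longleftrightarrow> graph_of_theory T (fst X) \<and> locally_one_PI (fst X) \<and>
     superficially_divergent T (fst X) \<and>
     (\<forall>C \<in> components (fst X). vertex_type (residue X) C \<in> vertex_types T)"

definition connected_specified :: "'t qft \<Rightarrow> ('v, 'h, 't) spec_graph \<Rightarrow> bool" where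
  "connected_specified T X \<longleftrightarrow> specified_graph T X \<and> connected_graph (fst X)"

text \<open>
  A common vertex set \<open>C\<close> is a component of both graphs, as a graph, only if no edge inside \<open>C\<close>
  has been cut.
\<close>

definition specified_covering_subgraph ::
  "'t qft \<Rightarrow> ('v, 'h, 't) spec_graph \<Rightarrow> ('v, 'h, 't) spec_graph \<Rightarrow> bool" where
  "specified_covering_subgraph T S X \<longleftrightarrow>
     specified_graph T S \<and> specified_graph T X \<and> covering_subgraph (fst S) (fst X) \<and>
     (\<forall>C \<in> components (fst S) \<inter> components (fst X).
        (\<forall>e \<in> halves (fst X). bdry (fst X) e \<in> C \<longrightarrow> flip (fst S) e = flip (fst X) e) \<longrightarrow>
        snd S C = snd X C)"

text \<open>
  A component of the contracted graph is a set of components of \<open>S\<close>, whose union is the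
  corresponding component of \<open>X\<close>.
\<close>

definition contract_spec ::
  "('v, 'h, 't) spec_graph \<Rightarrow> ('v, 'h, 't) spec_graph \<Rightarrow> ('v set, 'h, 't) spec_graph" where
  "contract_spec X S = (contract (fst X) (fst S) (snd S), \<lambda>D. snd X (\<Union>D))"

definition spec_pair ::
  "'t qft \<Rightarrow> ('v, 'h, 't) spec_graph \<times> ('v, 'h, 't) spec_graph \<Rightarrow> bool" where
  "spec_pair T P \<longleftrightarrow> (case P of (X, S) \<Rightarrow>
     connected_specified T X \<and> specified_covering_subgraph T S X \<and>
     connected_specified T (contract_spec X S))"

text \<open>
  Vertices lying in components with at least one internal edge. The components without internal
  edge still belong to the subgraph of a pair, but nothing is inserted at their vertices.
\<close>

definition essential_verts :: "('v, 'h, 't) fgraph \<Rightarrow> 'v set" where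
  "essential_verts G = {v \<in> verts G. \<exists>C \<in> components G. v \<in> C \<and>
     (\<exists>e \<in> halves G. bdry G e \<in> C \<and> flip G e \<noteq> e)}"


section \<open>Isomorphism classes\<close>

definition graph_iso ::
  "('v \<Rightarrow> 'w) \<Rightarrow> ('h \<Rightarrow> 'g) \<Rightarrow> ('v, 'h, 't) fgraph \<Rightarrow> ('w, 'g, 't) fgraph \<Rightarrow> bool" where
  "graph_iso f g G H \<longleftrightarrow> bij_betw f (verts G) (verts H) \<and> bij_betw g (halves G) (halves H) \<and>
     (\<forall>e \<in> halves G. bdry H (g e) = f (bdry G e) \<and> flip H (g e) = g (flip G e) \<and>
        htype H (g e) = htype G e) \<and>
     (\<forall>v \<in> verts G. vindex H (f v) = vindex G v)"

definition spec_iso ::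
  "('v \<Rightarrow> 'w) \<Rightarrow> ('h \<Rightarrow> 'g) \<Rightarrow> ('v, 'h, 't) spec_graph \<Rightarrow> ('w, 'g, 't) spec_graph \<Rightarrow> bool" where
  "spec_iso f g X Y \<longleftrightarrow> graph_iso f g (fst X) (fst Y) \<and>
     (\<forall>C \<in> components (fst X). snd Y (f ` C) = snd X C)"

text \<open>
  Every finite graph is isomorphic to one labelled by natural numbers, so an isomorphism class
  is represented by the set of its members labelled by natural numbers.
\<close>

type_synonym 't spec_class = "(nat, nat, 't) spec_graph set"
type_synonym 't pair_class = "((nat, nat, 't) spec_graph \<times> (nat, nat, 't) spec_graph) set"

definition spec_class :: "('v, 'h, 't) spec_graph \<Rightarrow> 't spec_class" where
  "spec_class X = {Y. \<exists>f g. spec_iso f g X Y}"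

definition pair_class ::
  "('v, 'h, 't) spec_graph \<times> ('v, 'h, 't) spec_graph \<Rightarrow> 't pair_class" where
  "pair_class P = {Q. \<exists>f g. spec_iso f g (fst P) (fst Q) \<and> spec_iso f g (snd P) (snd Q)}"


section \<open>The spaces spanned by specified graphs and by pairs\<close>

text \<open>Vectors are finitely supported functions on isomorphism classes.\<close>

definition scale_pm :: "'k::field \<Rightarrow> ('b \<Rightarrow>\<^sub>0 'k) \<Rightarrow> ('b \<Rightarrow>\<^sub>0 'k)" where
  "scale_pm c x = Poly_Mapping.map ((*) c) x"

definition V_space :: "'t qft \<Rightarrow> ('t spec_class \<Rightarrow>\<^sub>0 'k::field) set" where
  "V_space T = {x. Poly_Mapping.keys x \<subseteq>
     {spec_class X | X :: (nat, nat, 't) spec_graph. connected_specified T X}}"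

definition F_space :: "'t qft \<Rightarrow> ('t pair_class \<Rightarrow>\<^sub>0 'k::field) set" where
  "F_space T = {x. Poly_Mapping.keys x \<subseteq>
     {pair_class P | P :: (nat, nat, 't) spec_graph \<times> (nat, nat, 't) spec_graph. spec_pair T P}}"

definition bilinear_extension ::
  "('a \<Rightarrow> 'b \<Rightarrow> ('c \<Rightarrow>\<^sub>0 'k::field)) \<Rightarrow> ('a \<Rightarrow>\<^sub>0 'k) \<Rightarrow> ('b \<Rightarrow>\<^sub>0 'k) \<Rightarrow> ('c \<Rightarrow>\<^sub>0 'k)" where
  "bilinear_extension F x y =
     (\<Sum>a \<in> Poly_Mapping.keys x. \<Sum>b \<in> Poly_Mapping.keys y. scale_pm (Poly_Mapping.lookup x a * Poly_Mapping.lookup y b) (F a b))"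


section \<open>Insertion\<close>

definition gluings :: "('v, 'h, 't) fgraph \<Rightarrow> ('w, 'g, 't) fgraph \<Rightarrow> 'w \<Rightarrow> ('g \<Rightarrow> 'h) set" where
  "gluings G1 G2 v = {b \<in> star G2 v \<rightarrow>\<^sub>E external G1. bij_betw b (star G2 v) (external G1) \<and>
     (\<forall>e \<in> star G2 v. htype G1 (b e) = htype G2 e)}"

text \<open>
  The external edges of the inserted graph are identified with the half-edges in \<open>star G2 v\<close>
  along \<open>b\<close>; the identified half-edges are represented on the side of \<open>G2\<close>.
\<close>

definition insert_graph ::
  "('v, 'h, 't) fgraph \<Rightarrow> ('w, 'g, 't) fgraph \<Rightarrow> 'w \<Rightarrow> ('g \<Rightarrow> 'h) \<Rightarrow> ('v + 'w, 'h + 'g, 't) fgraph" where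
  "insert_graph G1 G2 v b = \<lparr>
     verts = verts G1 <+> (verts G2 - {v}),
     halves = (halves G1 - external G1) <+> halves G2,
     bdry = case_sum (\<lambda>e. Inl (bdry G1 e))
       (\<lambda>e. if bdry G2 e = v then Inl (bdry G1 (b e)) else Inr (bdry G2 e)),
     flip = map_sum (flip G1) (flip G2),
     htype = case_sum (htype G1) (htype G2),
     vindex = case_sum (vindex G1) (vindex G2)\<rparr>"

text \<open>
  Shrinking the inserted graph back to \<open>v\<close> maps the components of the result to those of \<open>X2\<close>,
  whose specification is kept.
\<close>

definition insert_spec ::
  "('v, 'h, 't) spec_graph \<Rightarrow> ('w, 'g, 't) spec_graph \<Rightarrow> 'w \<Rightarrow> ('g \<Rightarrow> 'h) \<Rightarrow>
     ('v + 'w, 'h + 'g, 't) spec_graph" where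
  "insert_spec X1 X2 v b = (insert_graph (fst X1) (fst X2) v b,
     \<lambda>C. snd X2 (case_sum (\<lambda>_. v) id ` C))"

text \<open>For a connected graph the only vertex of the residue is the component \<open>verts (fst X)\<close>.\<close>

definition residue_type :: "('v, 'h, 't) spec_graph \<Rightarrow> 't multiset \<times> nat" where
  "residue_type X = vertex_type (residue X) (verts (fst X))"

definition insertion_sum ::
  "('v, 'h, 't) spec_graph \<Rightarrow> ('w, 'g, 't) spec_graph \<Rightarrow> ('t spec_class \<Rightarrow>\<^sub>0 'k::field)" where
  "insertion_sum X1 X2 =
     (\<Sum>v | v \<in> verts (fst X2) \<and> vertex_type (fst X2) v = residue_type X1.
        \<Sum>b \<in> gluings (fst X1) (fst X2) v.
          Poly_Mapping.single (spec_class (insert_spec X1 X2 v b)) 1)"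

definition action_sum ::
  "('v, 'h, 't) spec_graph \<Rightarrow> ('w, 'g, 't) spec_graph \<times> ('w, 'g, 't) spec_graph \<Rightarrow>
     ('t pair_class \<Rightarrow>\<^sub>0 'k::field)" where
  "action_sum X1 P = (case P of (X2, S2) \<Rightarrow>
     (\<Sum>v | v \<in> essential_verts (fst S2) \<and> vertex_type (fst X2) v = residue_type X1.
        \<Sum>b \<in> gluings (fst X1) (fst X2) v.
          Poly_Mapping.single (pair_class (insert_spec X1 X2 v b, insert_spec X1 S2 v b)) 1))"

text \<open>
  On isomorphism classes, these sums are evaluated on arbitrary representatives; the choice is
  irrelevant by \<open>insertion_class\<close> and \<open>action_class\<close> below.
\<close>

definition insertion ::
  "('t spec_class \<Rightarrow>\<^sub>0 'k::field) \<Rightarrow> ('t spec_class \<Rightarrow>\<^sub>0 'k) \<Rightarrow> ('t spec_class \<Rightarrow>\<^sub>0 'k)" where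
  "insertion = bilinear_extension (\<lambda>c1 c2. insertion_sum (SOME X1. X1 \<in> c1) (SOME X2. X2 \<in> c2))"

definition action ::
  "('t spec_class \<Rightarrow>\<^sub>0 'k::field) \<Rightarrow> ('t pair_class \<Rightarrow>\<^sub>0 'k) \<Rightarrow> ('t pair_class \<Rightarrow>\<^sub>0 'k)" where
  "action = bilinear_extension (\<lambda>c d. action_sum (SOME X. X \<in> c) (SOME P. P \<in> d))"


section \<open>Independence of the representatives\<close>

lemma graph_iso_wf:
  assumes "graph_iso f g G H" "wf_graph G" shows "wf_graph H"
proof -
  have H: "halves H = g ` halves G" "verts H = f ` verts G"
    using assms(1) by (auto simp: graph_iso_def bij_betw_def)
  show ?thesis
    using assms by (auto simp: wf_graph_def H graph_iso_def)
qed

lemma graph_iso_sym: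
  assumes "graph_iso f g G H" "wf_graph G"
  shows "graph_iso (inv_into (verts G) f) (inv_into (halves G) g) H G"
proof -
  have H: "halves H = g ` halves G" "verts H = f ` verts G"
    and inj: "inj_on g (halves G)" "inj_on f (verts G)"
    using assms(1) by (auto simp: graph_iso_def bij_betw_def)
  show ?thesis
    unfolding graph_iso_def
    using assms inj
    by (auto simp: graph_iso_def bij_betw_inv_into H wf_graph_def)
qed

lemma graph_iso_trans:
  assumes "graph_iso f g G H" "graph_iso f' g' H K" "wf_graph G"
  shows "graph_iso (f' \<circ> f) (g' \<circ> g) G K"
proof -
  have H: "halves H = g ` halves G" "verts H = f ` verts G"
    using assms(1) by (auto simp: graph_iso_def bij_betw_def)
  show ?thesis
    using assms unfolding graph_iso_def
    by (auto simp: H wf_graph_def intro: bij_betw_trans)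
qed

lemma graph_iso_conn_imp:
  assumes iso: "graph_iso f g G H" and wf: "wf_graph G" and c: "(u, w) \<in> conn G"
  shows "(f u, f w) \<in> conn H"
proof -
  have H: "halves H = g ` halves G" "verts H = f ` verts G"
    using iso by (auto simp: graph_iso_def bij_betw_def)
  have "(u, w) \<in> ((\<lambda>e. (bdry G e, bdry G (flip G e))) ` halves G)\<^sup>*"
    using c by (simp add: conn_def)
  then have "(f u, f w) \<in> ((\<lambda>e. (bdry H e, bdry H (flip H e))) ` halves H)\<^sup>*"
  proof induction
    case (step y z)
    then obtain e where e: "e \<in> halves G" "y = bdry G e" "z = bdry G (flip G e)" by auto
    have "(f y, f z) \<in> (\<lambda>e. (bdry H e, bdry H (flip H e))) ` halves H"
      using e iso wf unfolding H(1)
      by (intro image_eqI[of _ _ "g e"]) (auto simp: graph_iso_def wf_graph_def)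
    with step.IH show ?case by (rule rtrancl_into_rtrancl)
  qed simp
  then show ?thesis using c by (auto simp: conn_def H)
qed

lemma graph_iso_conn:
  assumes iso: "graph_iso f g G H" and wf: "wf_graph G" and v: "u \<in> verts G" "w \<in> verts G"
  shows "(f u, f w) \<in> conn H \<longleftrightarrow> (u, w) \<in> conn G"
proof
  assume "(f u, f w) \<in> conn H"
  from graph_iso_conn_imp[OF graph_iso_sym[OF iso wf] graph_iso_wf[OF iso wf] this]
  show "(u, w) \<in> conn G" using iso v by (auto simp: graph_iso_def bij_betw_def)
qed (rule graph_iso_conn_imp[OF iso wf])

lemma conn_verts: "(u, w) \<in> conn G \<Longrightarrow> u \<in> verts G \<and> w \<in> verts G"
  by (simp add: conn_def)

lemma equiv_conn:
  assumes wf: "wf_graph G" shows "equiv (verts G) (conn G)"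
proof (rule equivI)
  have "sym ((\<lambda>e. (bdry G e, bdry G (flip G e))) ` halves G)"
  proof (rule symI)
    fix x y assume "(x, y) \<in> (\<lambda>e. (bdry G e, bdry G (flip G e))) ` halves G"
    then obtain e where "e \<in> halves G" "x = bdry G e" "y = bdry G (flip G e)" by auto
    then show "(y, x) \<in> (\<lambda>e. (bdry G e, bdry G (flip G e))) ` halves G"
      using wf by (intro image_eqI[of _ _ "flip G e"]) (auto simp: wf_graph_def)
  qed
  from symD[OF sym_rtrancl[OF this]] show "sym (conn G)" by (auto simp: conn_def intro: symI)
  show "trans (conn G)" by (auto simp: conn_def trans_def)
qed (auto simp: conn_def refl_on_def)

lemma components_def': "components G = (\<lambda>v. conn G `` {v}) ` verts G"
  by (auto simp: components_def quotient_def)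

lemma graph_iso_component:
  assumes iso: "graph_iso f g G H" and wf: "wf_graph G" and v: "v \<in> verts G"
  shows "conn H `` {f v} = f ` (conn G `` {v})"
proof -
  have H: "verts H = f ` verts G"
    using iso by (auto simp: graph_iso_def bij_betw_def)
  show ?thesis using graph_iso_conn[OF iso wf v] conn_verts[of _ _ H] conn_verts[of _ _ G]
    by (fastforce simp: H)
qed

lemma graph_iso_components:
  assumes iso: "graph_iso f g G H" and wf: "wf_graph G"
  shows "components H = (`) f ` components G"
proof -
  have H: "verts H = f ` verts G"
    using iso by (auto simp: graph_iso_def bij_betw_def)
  show ?thesis
    unfolding components_def' H image_image
    using graph_iso_component[OF iso wf] by (auto intro!: image_cong)
qed

lemma component_subset: "C \<in> components G \<Longrightarrow> C \<subseteq> verts G"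
  by (auto simp: components_def' conn_def)

lemma spec_iso_sym:
  assumes "spec_iso f g X Y" "wf_graph (fst X)"
  shows "spec_iso (inv_into (verts (fst X)) f) (inv_into (halves (fst X)) g) Y X"
proof -
  have iso: "graph_iso f g (fst X) (fst Y)" using assms by (simp add: spec_iso_def)
  then have inj: "inj_on f (verts (fst X))" by (auto simp: graph_iso_def bij_betw_def)
  have "snd X (inv_into (verts (fst X)) f ` C) = snd Y C" if "C \<in> components (fst Y)" for C
  proof -
    have "C \<in> (`) f ` components (fst X)"
      using that unfolding graph_iso_components[OF iso assms(2)] .
    then obtain D where D: "D \<in> components (fst X)" "C = f ` D" by blast
    have "inv_into (verts (fst X)) f ` C = D"
      using D component_subset[OF D(1)] inj by (simp add: inv_into_image_cancel)
    then show ?thesis using D assms(1) by (simp add: spec_iso_def)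
  qed
  with graph_iso_sym[OF iso assms(2)] show ?thesis by (simp add: spec_iso_def)
qed

lemma spec_iso_trans:
  assumes "spec_iso f g X Y" "spec_iso f' g' Y Z" "wf_graph (fst X)"
  shows "spec_iso (f' \<circ> f) (g' \<circ> g) X Z"
proof -
  have iso: "graph_iso f g (fst X) (fst Y)" "graph_iso f' g' (fst Y) (fst Z)"
    using assms by (simp_all add: spec_iso_def)
  show ?thesis
    using assms graph_iso_trans[OF iso assms(3)] graph_iso_components[OF iso(1) assms(3)]
    by (simp add: spec_iso_def image_comp[symmetric] del: o_apply)
qed

lemma spec_class_eqI:
  assumes "spec_iso f g X Y" "wf_graph (fst X)"
  shows "spec_class X = spec_class Y"
proof -
  have "wf_graph (fst Y)" using assms graph_iso_wf by (auto simp: spec_iso_def)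
  then show ?thesis
    using spec_iso_trans[OF assms(1) _ assms(2)] spec_iso_trans[OF spec_iso_sym[OF assms]]
    unfolding spec_class_def by blast
qed

lemma pair_class_eqI:
  assumes "spec_iso f g X Y" "spec_iso f g S R" "wf_graph (fst X)" "wf_graph (fst S)"
    "verts (fst S) = verts (fst X)" "halves (fst S) = halves (fst X)"
  shows "pair_class (X, S) = pair_class (Y, R)"
proof -
  have wf: "wf_graph (fst Y)" "wf_graph (fst R)"
    using assms graph_iso_wf by (auto simp: spec_iso_def)
  let ?f = "inv_into (verts (fst X)) f" and ?g = "inv_into (halves (fst X)) g"
  have inv: "spec_iso ?f ?g Y X" "spec_iso ?f ?g R S"
    using spec_iso_sym[OF assms(1,3)] spec_iso_sym[OF assms(2,4)] assms(5,6) by simp_all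
  show ?thesis
    unfolding pair_class_def fst_conv snd_conv
  proof (intro Collect_eqI iffI; elim exE conjE)
    fix Q f' g' assume "spec_iso f' g' X (fst Q)" "spec_iso f' g' S (snd Q)"
    then show "\<exists>f g. spec_iso f g Y (fst Q) \<and> spec_iso f g R (snd Q)"
      using spec_iso_trans[OF inv(1) _ wf(1)] spec_iso_trans[OF inv(2) _ wf(2)] by blast
  next
    fix Q f' g' assume "spec_iso f' g' Y (fst Q)" "spec_iso f' g' R (snd Q)"
    then show "\<exists>f g. spec_iso f g X (fst Q) \<and> spec_iso f g S (snd Q)"
      using spec_iso_trans[OF assms(1) _ assms(3)] spec_iso_trans[OF assms(2) _ assms(4)] by blast
  qed
qed

lemma graph_iso_star:
  assumes iso: "graph_iso f g G H" and wf: "wf_graph G" and v: "v \<in> verts G"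
  shows "star H (f v) = g ` star G v"
proof -
  have "halves H = g ` halves G" "inj_on f (verts G)"
    using iso by (auto simp: graph_iso_def bij_betw_def)
  then show ?thesis using assms
    by (auto simp: star_def graph_iso_def wf_graph_def inj_on_def)
qed

lemma graph_iso_external:
  assumes iso: "graph_iso f g G H" and wf: "wf_graph G"
  shows "external H = g ` external G"
proof -
  have "halves H = g ` halves G" "inj_on g (halves G)"
    using iso by (auto simp: graph_iso_def bij_betw_def)
  then show ?thesis using assms
    by (auto simp: external_def graph_iso_def wf_graph_def inj_on_def)
qed

lemma image_mset_iso:
  assumes "inj_on g A" "\<forall>e \<in> A. h (g e) = k e"
  shows "image_mset h (mset_set (g ` A)) = image_mset k (mset_set A)"
proof (cases "finite A")
  case True
  then show ?thesis using assms
    by (auto simp: image_mset_mset_set[symmetric] multiset.map_comp intro: image_mset_cong)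
next
  case False
  then show ?thesis using assms(1) by (simp add: finite_image_iff)
qed

lemma graph_iso_vertex_type:
  assumes iso: "graph_iso f g G H" and wf: "wf_graph G" and v: "v \<in> verts G"
  shows "vertex_type H (f v) = vertex_type G v"
proof -
  have "inj_on g (star G v)"
    using iso by (auto simp: graph_iso_def bij_betw_def star_def intro: inj_on_subset)
  then have "half_types_at H (f v) = half_types_at G v"
    unfolding half_types_at_def graph_iso_star[OF assms] using iso
    by (intro image_mset_iso) (auto simp: graph_iso_def star_def)
  then show ?thesis using iso v by (simp add: vertex_type_def graph_iso_def)
qed

lemma connected_graph_components:
  assumes "connected_graph G" "wf_graph G" shows "components G = {verts G}"
proof -
  obtain C where C: "components G = {C}"
    using assms(1) unfolding connected_graph_def by (auto simp: card_1_singleton_iff)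
  moreover have "\<Union>(components G) = verts G"
    using Union_quotient[OF equiv_conn[OF assms(2)]] by (simp add: components_def)
  ultimately show ?thesis by simp
qed

lemma connected_graph_conn:
  assumes "connected_graph G" "wf_graph G" "u \<in> verts G" "w \<in> verts G"
  shows "(u, w) \<in> conn G"
proof -
  have "conn G `` {u} \<in> components G" using assms(3) unfolding components_def' by (rule imageI)
  then have "conn G `` {u} = verts G" unfolding connected_graph_components[OF assms(1,2)] by simp
  then show ?thesis using assms(4) by auto
qed

lemma residue_type_alt:
  assumes "connected_graph (fst X)" "wf_graph (fst X)"
  shows "residue_type X =
    (image_mset (htype (fst X)) (mset_set (external (fst X))), snd X (verts (fst X)))"
proof -
  have "conn (fst X) `` {v} = verts (fst X)" if "v \<in> verts (fst X)" for v
    using connected_graph_conn[OF assms that] conn_verts[of v _ "fst X"] by auto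
  then have "star (residue X) (verts (fst X)) = external (fst X)"
    using assms(2) by (auto simp: residue_def contract_def star_def external_def wf_graph_def)
  then show ?thesis
    by (simp add: residue_type_def vertex_type_def half_types_at_def residue_def contract_def)
qed

lemma graph_iso_connected:
  assumes iso: "graph_iso f g G H" and wf: "wf_graph G" and c: "connected_graph G"
  shows "connected_graph H"
  using connected_graph_components[OF c wf] graph_iso_components[OF iso wf]
  by (simp add: connected_graph_def)

lemma spec_iso_residue_type:
  assumes iso: "spec_iso f g X Y" and wf: "wf_graph (fst X)" and c: "connected_graph (fst X)"
  shows "residue_type Y = residue_type X"
proof -
  have g: "graph_iso f g (fst X) (fst Y)" using iso by (simp add: spec_iso_def)
  have V: "verts (fst Y) = f ` verts (fst X)"
    using g by (auto simp: graph_iso_def bij_betw_def)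
  have "inj_on g (external (fst X))"
    using g by (auto simp: graph_iso_def bij_betw_def external_def intro: inj_on_subset)
  then have "image_mset (htype (fst Y)) (mset_set (external (fst Y))) =
      image_mset (htype (fst X)) (mset_set (external (fst X)))"
    unfolding graph_iso_external[OF g wf] using g
    by (intro image_mset_iso) (auto simp: graph_iso_def external_def)
  moreover have "snd Y (verts (fst Y)) = snd X (verts (fst X))"
    using iso connected_graph_components[OF c wf] by (simp add: spec_iso_def V)
  ultimately show ?thesis
    by (simp add: residue_type_alt[OF c wf]
        residue_type_alt[OF graph_iso_connected[OF g wf c] graph_iso_wf[OF g wf]])
qed

lemma graph_iso_essential_verts:
  assumes iso: "graph_iso f g G H" and wf: "wf_graph G"
  shows "essential_verts H = f ` essential_verts G"
proof -
  have H: "halves H = g ` halves G" "verts H = f ` verts G"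
    and inj: "inj_on g (halves G)" "inj_on f (verts G)"
    using iso by (auto simp: graph_iso_def bij_betw_def)
  have mem: "f v \<in> f ` C \<longleftrightarrow> v \<in> C" if "v \<in> verts G" "C \<in> components G" for v C
    using that inj(2) component_subset[OF that(2)] by (auto simp: inj_on_def)
  have fl: "flip H (g e) \<noteq> g e \<longleftrightarrow> flip G e \<noteq> e" "bdry H (g e) = f (bdry G e)" "bdry G e \<in> verts G"
    if "e \<in> halves G" for e
    using that inj(1) iso wf by (auto simp: graph_iso_def wf_graph_def inj_on_def)
  show ?thesis
  proof (intro equalityI subsetI)
    fix w assume "w \<in> essential_verts H"
    then obtain v C e where "w = f v" "v \<in> verts G" "C \<in> components G" "f v \<in> f ` C"
      "e \<in> halves G" "f (bdry G e) \<in> f ` C" "flip G e \<noteq> e"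
      unfolding essential_verts_def H graph_iso_components[OF iso wf] by (auto simp: fl)
    then have "v \<in> essential_verts G" "w = f v" by (auto simp: essential_verts_def mem fl)
    then show "w \<in> f ` essential_verts G" by blast
  next
    fix w assume "w \<in> f ` essential_verts G"
    then obtain v C e where w: "w = f v" "v \<in> verts G" "C \<in> components G" "v \<in> C"
      "e \<in> halves G" "bdry G e \<in> C" "flip G e \<noteq> e"
      by (auto simp: essential_verts_def)
    then have "f ` C \<in> components H" "w \<in> f ` C" "g e \<in> halves H" "bdry H (g e) \<in> f ` C"
      "flip H (g e) \<noteq> g e" "w \<in> verts H"
      unfolding H graph_iso_components[OF iso wf] by (auto simp: fl)
    then show "w \<in> essential_verts H" by (auto simp: essential_verts_def)
  qed
qed

lemma insert_graph_wf:
  assumes "wf_graph G1" "wf_graph G2" "b \<in> gluings G1 G2 v"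
  shows "wf_graph (insert_graph G1 G2 v b)"
proof -
  have "bdry G1 (b e) \<in> verts G1" if "e \<in> halves G2" "bdry G2 e = v" for e
  proof -
    have "b e \<in> external G1" using assms(3) that by (auto simp: gluings_def star_def)
    then show ?thesis using assms(1) by (simp add: wf_graph_def external_def)
  qed
  then show ?thesis
    using assms(1,2)
    by (auto simp: wf_graph_def insert_graph_def external_def)
qed

lemma insert_conn_over:
  assumes wf: "wf_graph G1" "wf_graph G2" and b: "b \<in> gluings G1 G2 v"
    and c: "connected_graph G1"
    and pq: "(p, q) \<in> ((\<lambda>e. (bdry G2 e, bdry G2 (flip G2 e))) ` halves G2)\<^sup>*"
    and x: "x \<in> verts (insert_graph G1 G2 v b)" "case_sum (\<lambda>_. v) id x = p"
    and y: "y \<in> verts (insert_graph G1 G2 v b)" "case_sum (\<lambda>_. v) id y = q"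
  shows "(x, y) \<in> conn (insert_graph G1 G2 v b)"
proof -
  let ?I = "insert_graph G1 G2 v b"
  let ?A = "(\<lambda>e. (bdry ?I e, bdry ?I (flip ?I e))) ` halves ?I"
  have inner: "(Inl u, Inl w) \<in> ?A\<^sup>*" if "u \<in> verts G1" "w \<in> verts G1" for u w
  proof -
    have "(u, w) \<in> ((\<lambda>e. (bdry G1 e, bdry G1 (flip G1 e))) ` halves G1)\<^sup>*"
      using connected_graph_conn[OF c wf(1) that] by (simp add: conn_def)
    then show ?thesis
    proof induction
      case (step y z)
      then obtain e where e: "e \<in> halves G1" "y = bdry G1 e" "z = bdry G1 (flip G1 e)" by auto
      show ?case
      proof (cases "flip G1 e = e")
        case True
        then show ?thesis using step.IH e by simp
      next
        case False
        then have "(Inl y, Inl z) \<in> ?A"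
          using e by (intro image_eqI[of _ _ "Inl e"]) (auto simp: insert_graph_def external_def)
        with step.IH show ?thesis by (rule rtrancl_into_rtrancl)
      qed
    qed simp
  qed
  have fibre: "(x, y) \<in> ?A\<^sup>*" if "x \<in> verts ?I" "y \<in> verts ?I"
    "case_sum (\<lambda>_. v) id x = case_sum (\<lambda>_. v) id y" for x y
    using that inner by (auto simp: insert_graph_def split: sum.splits)
  have bd: "bdry ?I (Inr e) \<in> verts ?I" "case_sum (\<lambda>_. v) id (bdry ?I (Inr e)) = bdry G2 e"
    if "e \<in> halves G2" for e
  proof -
    have "Inr e \<in> halves ?I" using that by (auto simp: insert_graph_def)
    then show "bdry ?I (Inr e) \<in> verts ?I"
      using insert_graph_wf[OF wf b] by (simp add: wf_graph_def)
  qed (simp add: insert_graph_def)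
  have "\<forall>y. y \<in> verts ?I \<longrightarrow> case_sum (\<lambda>_. v) id y = q \<longrightarrow> (x, y) \<in> ?A\<^sup>*"
    using pq
  proof induction
    case base
    then show ?case using fibre x by blast
  next
    case (step q r)
    then obtain e where e: "e \<in> halves G2" "q = bdry G2 e" "r = bdry G2 (flip G2 e)" by auto
    have fe: "flip G2 e \<in> halves G2" using e wf(2) by (auto simp: wf_graph_def)
    have "(x, bdry ?I (Inr e)) \<in> ?A\<^sup>*" using step.IH bd[OF e(1)] e by blast
    also have "(bdry ?I (Inr e), bdry ?I (Inr (flip G2 e))) \<in> ?A"
      using e by (intro image_eqI[of _ _ "Inr e"]) (auto simp: insert_graph_def)
    finally have "(x, bdry ?I (Inr (flip G2 e))) \<in> ?A\<^sup>*" .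
    then show ?case using fibre[OF bd(1)[OF fe]] bd(2)[OF fe] e by (auto intro: rtrancl_trans)
  qed
  then show ?thesis using x y by (simp add: conn_def)
qed

lemma insert_conn_project:
  assumes wf: "wf_graph G1" "wf_graph G2" and b: "b \<in> gluings G1 G2 v" and v: "v \<in> verts G2"
    and xy: "(x, y) \<in> conn (insert_graph G1 G2 v b)"
  shows "(case_sum (\<lambda>_. v) id x, case_sum (\<lambda>_. v) id y) \<in> conn G2"
proof -
  let ?I = "insert_graph G1 G2 v b"
  let ?A = "(\<lambda>e. (bdry ?I e, bdry ?I (flip ?I e))) ` halves ?I"
  let ?B = "(\<lambda>e. (bdry G2 e, bdry G2 (flip G2 e))) ` halves G2"
  let ?p = "case_sum (\<lambda>_. v) id"
  have "(x, y) \<in> ?A\<^sup>*" using xy by (simp add: conn_def)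
  then have "(?p x, ?p y) \<in> ?B\<^sup>*"
  proof induction
    case (step y z)
    then obtain e where e: "e \<in> halves ?I" "y = bdry ?I e" "z = bdry ?I (flip ?I e)" by auto
    have "(?p y, ?p z) \<in> ?B\<^sup>*"
    proof (cases e)
      case (Inr d)
      then have "(?p y, ?p z) \<in> ?B"
        using e by (intro image_eqI[of _ _ d]) (auto simp: insert_graph_def)
      then show ?thesis by auto
    qed (use e in \<open>auto simp: insert_graph_def\<close>)
    with step.IH show ?case by (rule rtrancl_trans)
  qed simp
  moreover have "?p z \<in> verts G2" if "z \<in> verts ?I" for z
    using that v by (auto simp: insert_graph_def)
  ultimately show ?thesis using xy by (simp add: conn_def)
qed

lemma insert_components:
  assumes wf: "wf_graph G1" "wf_graph G2" and b: "b \<in> gluings G1 G2 v" and v: "v \<in> verts G2"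
    and c: "connected_graph G1" and C: "C \<in> components (insert_graph G1 G2 v b)"
  shows "case_sum (\<lambda>_. v) id ` C \<in> components G2"
proof -
  let ?I = "insert_graph G1 G2 v b"
  let ?p = "case_sum (\<lambda>_. v) id"
  obtain x where x: "x \<in> verts ?I" "C = conn ?I `` {x}" using C by (auto simp: components_def')
  have px: "?p x \<in> verts G2" using x v by (auto simp: insert_graph_def)
  have ne: "verts G1 \<noteq> {}"
    using c connected_graph_components[OF c wf(1)] by (auto simp: components_def')
  have "?p ` C = conn G2 `` {?p x}"
  proof (intro equalityI subsetI)
    fix q assume q: "q \<in> conn G2 `` {?p x}"
    have "\<exists>y \<in> verts ?I. ?p y = q"
    proof (cases "q = v")
      case True
      from ne obtain u where "u \<in> verts G1" by auto
      then show ?thesis using True by (intro bexI[of _ "Inl u"]) (auto simp: insert_graph_def)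
    next
      case False
      then show ?thesis using q by (intro bexI[of _ "Inr q"]) (auto simp: insert_graph_def conn_def)
    qed
    then obtain y where y: "y \<in> verts ?I" "?p y = q" by auto
    have "(x, y) \<in> conn ?I"
      by (rule insert_conn_over[OF wf b c _ x(1) refl y]) (use q in \<open>simp add: conn_def\<close>)
    then show "q \<in> ?p ` C" using x y by auto
  qed (use insert_conn_project[OF wf b v] x in auto)
  then show ?thesis using px by (auto simp: components_def')
qed

definition transport_gluing ::
  "('h \<Rightarrow> 'h') \<Rightarrow> ('g \<Rightarrow> 'g') \<Rightarrow> 'g set \<Rightarrow> ('g \<Rightarrow> 'h) \<Rightarrow> 'g' \<Rightarrow> 'h'" where
  "transport_gluing g1 g2 A b = restrict (\<lambda>e. g1 (b (inv_into A g2 e))) (g2 ` A)"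

lemma transport_gluing_apply:
  "inj_on g2 A \<Longrightarrow> e \<in> A \<Longrightarrow> transport_gluing g1 g2 A b (g2 e) = g1 (b e)"
  by (simp add: transport_gluing_def)

lemma transport_gluing_mem:
  assumes iso: "graph_iso f1 g1 G1 H1" "graph_iso f2 g2 G2 H2" and wf: "wf_graph G1" "wf_graph G2"
    and v: "v \<in> verts G2" and b: "b \<in> gluings G1 G2 v"
  shows "transport_gluing g1 g2 (star G2 v) b \<in> gluings H1 H2 (f2 v)"
proof -
  have inj: "inj_on g2 (star G2 v)" "inj_on g1 (external G1)"
    using iso by (auto simp: graph_iso_def bij_betw_def star_def external_def intro: inj_on_subset)
  let ?b = "transport_gluing g1 g2 (star G2 v) b"
  have bb: "bij_betw b (star G2 v) (external G1)"
    "\<And>e. e \<in> star G2 v \<Longrightarrow> htype G1 (b e) = htype G2 e" using b by (auto simp: gluings_def)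
  have *: "?b (g2 e) = g1 (b e)" if "e \<in> star G2 v" for e
    using transport_gluing_apply[OF inj(1) that] .
  have bij: "bij_betw ?b (g2 ` star G2 v) (g1 ` external G1)"
  proof (rule bij_betw_imageI)
    show "inj_on ?b (g2 ` star G2 v)"
    proof (rule inj_onI, clarify)
      fix d e assume de: "d \<in> star G2 v" "e \<in> star G2 v" "?b (g2 d) = ?b (g2 e)"
      then have "b d \<in> external G1" "b e \<in> external G1" using bb(1) by (auto simp: bij_betw_def)
      moreover have "g1 (b d) = g1 (b e)" using de by (simp add: *)
      ultimately have "b d = b e" using inj(2) by (simp add: inj_on_def)
      then show "g2 d = g2 e" using de bb(1) by (auto simp: inj_on_def bij_betw_def)
    qed
    show "?b ` (g2 ` star G2 v) = g1 ` external G1"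
    proof -
      have "?b ` (g2 ` star G2 v) = g1 ` (b ` star G2 v)"
        by (simp add: image_image * cong: image_cong)
      then show ?thesis using bb(1) by (simp add: bij_betw_def)
    qed
  qed
  have ty: "htype H1 (?b (g2 e)) = htype H2 (g2 e)" if e: "e \<in> star G2 v" for e
  proof -
    have "b e \<in> halves G1" "e \<in> halves G2"
      using e bb(1) by (auto simp: bij_betw_def external_def star_def)
    then show ?thesis using iso *[OF e] bb(2)[OF e] by (simp add: graph_iso_def)
  qed
  have "?b \<in> g2 ` star G2 v \<rightarrow>\<^sub>E g1 ` external G1"
    using bij_betw_apply[OF bij] by (auto simp: PiE_def transport_gluing_def extensional_def)
  then show ?thesis
    using bij ty
    by (auto simp: gluings_def graph_iso_star[OF iso(2) wf(2) v] graph_iso_external[OF iso(1) wf(1)])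
qed

lemma bij_betw_map_sum:
  assumes "bij_betw f A B" "bij_betw g C D"
  shows "bij_betw (map_sum f g) (A <+> C) (B <+> D)"
proof -
  have "inj_on (map_sum f g) (A <+> C)"
    using assms by (fastforce simp: bij_betw_def inj_on_def)
  moreover have "map_sum f g ` (A <+> C) = B <+> D"
    using assms by (auto simp: bij_betw_def Plus_def image_Un image_image)
  ultimately show ?thesis by (simp add: bij_betw_def)
qed

lemma insert_graph_iso:
  assumes iso: "graph_iso f1 g1 G1 H1" "graph_iso f2 g2 G2 H2" and wf: "wf_graph G1" "wf_graph G2"
    and v: "v \<in> verts G2" and b: "b \<in> gluings G1 G2 v"
  shows "graph_iso (map_sum f1 f2) (map_sum g1 g2) (insert_graph G1 G2 v b)
    (insert_graph H1 H2 (f2 v) (transport_gluing g1 g2 (star G2 v) b))"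
proof -
  have H: "halves H1 = g1 ` halves G1" "verts H1 = f1 ` verts G1"
    "halves H2 = g2 ` halves G2" "verts H2 = f2 ` verts G2"
    and inj: "inj_on g1 (halves G1)" "inj_on f1 (verts G1)"
    "inj_on g2 (halves G2)" "inj_on f2 (verts G2)"
    using iso by (auto simp: graph_iso_def bij_betw_def)
  have inj': "inj_on g2 (star G2 v)" using inj by (auto simp: star_def intro: inj_on_subset)
  have i1: "halves H1 - external H1 = g1 ` (halves G1 - external G1)"
    unfolding H graph_iso_external[OF iso(1) wf(1)]
    using inj(1) by (auto simp: external_def inj_on_def)
  have i2: "verts H2 - {f2 v} = f2 ` (verts G2 - {v})"
    unfolding H using inj(4) v by (auto simp: inj_on_def)
  let ?I = "insert_graph G1 G2 v b"
  let ?b = "transport_gluing g1 g2 (star G2 v) b"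
  let ?J = "insert_graph H1 H2 (f2 v) ?b"
  have "bij_betw (map_sum f1 f2) (verts ?I) (verts ?J)"
    unfolding insert_graph_def fgraph.simps i2 H(2)
    using inj(2,4) by (intro bij_betw_map_sum inj_on_imp_bij_betw) (auto intro: inj_on_subset)
  moreover have "bij_betw (map_sum g1 g2) (halves ?I) (halves ?J)"
    unfolding insert_graph_def fgraph.simps i1 H(3)
    using inj(1,3) by (intro bij_betw_map_sum inj_on_imp_bij_betw) (auto intro: inj_on_subset)
  moreover have "bdry ?J (map_sum g1 g2 e) = map_sum f1 f2 (bdry ?I e)" if "e \<in> halves ?I" for e
  proof (cases e)
    case (Inl d)
    then show ?thesis using that iso by (auto simp: insert_graph_def graph_iso_def)
  next
    case (Inr d)
    then have d: "d \<in> halves G2" using that by (auto simp: insert_graph_def)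
    then have bd: "bdry H2 (g2 d) = f2 (bdry G2 d)" "bdry G2 d \<in> verts G2"
      using iso wf by (auto simp: graph_iso_def wf_graph_def)
    show ?thesis
    proof (cases "bdry G2 d = v")
      case True
      then have ds: "d \<in> star G2 v" using d by (simp add: star_def)
      then have "b d \<in> halves G1" using b by (auto simp: gluings_def external_def)
      then show ?thesis
        using True Inr bd transport_gluing_apply[OF inj' ds, of g1 b] iso
        by (simp add: insert_graph_def graph_iso_def)
    next
      case False
      then have "f2 (bdry G2 d) \<noteq> f2 v" using bd v inj(4) by (auto simp: inj_on_def)
      then show ?thesis using False Inr bd by (simp add: insert_graph_def)
    qed
  qed
  moreover have "flip ?J (map_sum g1 g2 e) = map_sum g1 g2 (flip ?I e) \<and>
      htype ?J (map_sum g1 g2 e) = htype ?I e" if "e \<in> halves ?I" for e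
    using that iso by (auto simp: insert_graph_def graph_iso_def)
  moreover have "vindex ?J (map_sum f1 f2 w) = vindex ?I w" if "w \<in> verts ?I" for w
    using that iso by (auto simp: insert_graph_def graph_iso_def)
  ultimately show ?thesis by (simp add: graph_iso_def)
qed

lemma insert_spec_iso:
  assumes iso: "graph_iso f1 g1 (fst X1) (fst Y1)" "spec_iso f2 g2 X2 Y2"
    and wf: "wf_graph (fst X1)" "wf_graph (fst X2)" and c: "connected_graph (fst X1)"
    and v: "v \<in> verts (fst X2)" and b: "b \<in> gluings (fst X1) (fst X2) v"
  shows "spec_iso (map_sum f1 f2) (map_sum g1 g2) (insert_spec X1 X2 v b)
    (insert_spec Y1 Y2 (f2 v) (transport_gluing g1 g2 (star (fst X2) v) b))"
proof -
  have iso2: "graph_iso f2 g2 (fst X2) (fst Y2)" using iso(2) by (simp add: spec_iso_def)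
  have "snd Y2 (case_sum (\<lambda>_. f2 v) id ` map_sum f1 f2 ` C) = snd X2 (case_sum (\<lambda>_. v) id ` C)"
    if "C \<in> components (insert_graph (fst X1) (fst X2) v b)" for C
  proof -
    have "case_sum (\<lambda>_. f2 v) id (map_sum f1 f2 x) = f2 (case_sum (\<lambda>_. v) id x)" for x
      by (cases x) auto
    then have "case_sum (\<lambda>_. f2 v) id ` map_sum f1 f2 ` C = f2 ` case_sum (\<lambda>_. v) id ` C"
      by (simp add: image_image)
    then show ?thesis
      using insert_components[OF wf b v c that] iso(2) by (simp add: spec_iso_def)
  qed
  then show ?thesis
    using insert_graph_iso[OF iso(1) iso2 wf v b] by (simp add: spec_iso_def insert_spec_def)
qed

lemma transport_gluing_bij:
  assumes iso: "graph_iso f1 g1 G1 H1" "graph_iso f2 g2 G2 H2" and wf: "wf_graph G1" "wf_graph G2"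
    and v: "v \<in> verts G2"
  shows "bij_betw (transport_gluing g1 g2 (star G2 v)) (gluings G1 G2 v) (gluings H1 H2 (f2 v))"
proof (rule bij_betw_byWitness[where f' =
      "transport_gluing (inv_into (halves G1) g1) (inv_into (halves G2) g2) (star H2 (f2 v))"])
  have inj: "inj_on g1 (halves G1)" "inj_on g2 (halves G2)" "inj_on f2 (verts G2)"
    and sur: "halves H1 = g1 ` halves G1" "halves H2 = g2 ` halves G2" "verts H2 = f2 ` verts G2"
    using iso by (auto simp: graph_iso_def bij_betw_def)
  have st: "star H2 (f2 v) = g2 ` star G2 v" by (rule graph_iso_star[OF iso(2) wf(2) v])
  have sub: "star G2 v \<subseteq> halves G2" by (auto simp: star_def)
  then have injs: "inj_on g2 (star G2 v)" using inj by (auto intro: inj_on_subset)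
  have st': "inv_into (halves G2) g2 ` star H2 (f2 v) = star G2 v"
    unfolding st using sub inj(2) by (simp add: inv_into_image_cancel)
  have injr: "inj_on (inv_into (halves G2) g2) (star H2 (f2 v))"
    unfolding st sur using sub by (intro inj_on_subset[OF inj_on_inv_into[OF subset_refl]]) auto
  let ?t = "transport_gluing g1 g2 (star G2 v)"
  let ?s = "transport_gluing (inv_into (halves G1) g1) (inv_into (halves G2) g2) (star H2 (f2 v))"
  have app: "?t b (g2 e) = g1 (b e)" if "e \<in> star G2 v" for e b
    by (rule transport_gluing_apply[OF injs that])
  have app': "?s b e = inv_into (halves G1) g1 (b (g2 e))" if "e \<in> star G2 v" for e b
  proof -
    have "g2 e \<in> star H2 (f2 v)" using that st by auto
    from transport_gluing_apply[OF injr this, of "inv_into (halves G1) g1" b]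
    show ?thesis using that sub inj(2) by (simp add: subset_iff)
  qed
  show "\<forall>b \<in> gluings G1 G2 v. ?s (?t b) = b"
  proof
    fix b assume b: "b \<in> gluings G1 G2 v"
    show "?s (?t b) = b"
    proof
      fix e
      show "?s (?t b) e = b e"
      proof (cases "e \<in> star G2 v")
        case True
        then have "b e \<in> halves G1" using b by (auto simp: gluings_def external_def)
        then show ?thesis using True app app' inj(1) by simp
      next
        case False
        then have "?s (?t b) e = undefined" using st' by (simp add: transport_gluing_def)
        moreover have "b e = undefined" using b False by (auto simp: gluings_def PiE_def extensional_def)
        ultimately show ?thesis by simp
      qed
    qed
  qed
  show "\<forall>b \<in> gluings H1 H2 (f2 v). ?t (?s b) = b"
  proof
    fix b assume b: "b \<in> gluings H1 H2 (f2 v)"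
    show "?t (?s b) = b"
    proof
      fix e
      show "?t (?s b) e = b e"
      proof (cases "e \<in> star H2 (f2 v)")
        case True
        then obtain d where d: "e = g2 d" "d \<in> star G2 v" using st by auto
        have "b e \<in> g1 ` halves G1" using True b sur by (auto simp: gluings_def external_def)
        then show ?thesis using d app app' by (simp add: f_inv_into_f)
      next
        case False
        then have "?t (?s b) e = undefined" using st by (simp add: transport_gluing_def)
        moreover have "b e = undefined" using b False by (auto simp: gluings_def PiE_def extensional_def)
        ultimately show ?thesis by simp
      qed
    qed
  qed
  show "?t ` gluings G1 G2 v \<subseteq> gluings H1 H2 (f2 v)"
    using transport_gluing_mem[OF iso wf v] by auto
  have v': "f2 v \<in> verts H2" using v sur by auto
  have "inv_into (verts G2) f2 (f2 v) = v" using v inj by simp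
  then show "?s ` gluings H1 H2 (f2 v) \<subseteq> gluings G1 G2 v"
    using transport_gluing_mem[OF graph_iso_sym[OF iso(1) wf(1)] graph_iso_sym[OF iso(2) wf(2)]
        graph_iso_wf[OF iso(1) wf(1)] graph_iso_wf[OF iso(2) wf(2)] v'] by auto
qed

lemma sum_gluings_iso:
  fixes F :: "_ \<Rightarrow> _ \<Rightarrow> 'a::comm_monoid_add"
  assumes iso: "graph_iso f1 g1 G1 H1" "graph_iso f2 g2 G2 H2" and wf: "wf_graph G1" "wf_graph G2"
    and A: "A \<subseteq> verts G2" "B = f2 ` A"
    and F: "\<And>v b. v \<in> A \<Longrightarrow> b \<in> gluings G1 G2 v \<Longrightarrow>
      F v b = F' (f2 v) (transport_gluing g1 g2 (star G2 v) b)"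
  shows "(\<Sum>v\<in>A. \<Sum>b\<in>gluings G1 G2 v. F v b) = (\<Sum>v\<in>B. \<Sum>b\<in>gluings H1 H2 v. F' v b)"
proof -
  have inj: "inj_on f2 A" using iso A by (auto simp: graph_iso_def bij_betw_def intro: inj_on_subset)
  have "(\<Sum>b\<in>gluings G1 G2 v. F v b) = (\<Sum>b\<in>gluings H1 H2 (f2 v). F' (f2 v) b)" if "v \<in> A" for v
    using F[OF that] A that
    by (simp add: sum.reindex_bij_betw[OF transport_gluing_bij[OF iso wf], symmetric] subset_iff)
  then show ?thesis unfolding A(2) by (simp add: sum.reindex[OF inj])
qed

lemma insertion_sum_iso:
  assumes iso: "spec_iso f1 g1 X1 Y1" "spec_iso f2 g2 X2 Y2"
    and wf: "wf_graph (fst X1)" "wf_graph (fst X2)" and c: "connected_graph (fst X1)"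
  shows "insertion_sum X1 X2 = insertion_sum Y1 Y2"
proof -
  have g: "graph_iso f1 g1 (fst X1) (fst Y1)" "graph_iso f2 g2 (fst X2) (fst Y2)"
    using iso by (simp_all add: spec_iso_def)
  have V: "verts (fst Y2) = f2 ` verts (fst X2)" using g by (auto simp: graph_iso_def bij_betw_def)
  show ?thesis
    unfolding insertion_sum_def
  proof (rule sum_gluings_iso[OF g wf])
    show "{v \<in> verts (fst Y2). vertex_type (fst Y2) v = residue_type Y1} =
        f2 ` {v \<in> verts (fst X2). vertex_type (fst X2) v = residue_type X1}"
      unfolding V spec_iso_residue_type[OF iso(1) wf(1) c]
      using graph_iso_vertex_type[OF g(2) wf(2)] by auto
    fix v b assume "v \<in> {v \<in> verts (fst X2). vertex_type (fst X2) v = residue_type X1}"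
      and b: "b \<in> gluings (fst X1) (fst X2) v"
    then have v: "v \<in> verts (fst X2)" by simp
    have "wf_graph (fst (insert_spec X1 X2 v b))"
      using insert_graph_wf[OF wf b] by (simp add: insert_spec_def)
    from spec_class_eqI[OF insert_spec_iso[OF g(1) iso(2) wf c v b] this]
    show "Poly_Mapping.single (spec_class (insert_spec X1 X2 v b)) 1 =
        Poly_Mapping.single (spec_class (insert_spec Y1 Y2 (f2 v)
          (transport_gluing g1 g2 (star (fst X2) v) b))) 1" by simp
  qed auto
qed

lemma action_sum_iso:
  assumes iso: "spec_iso f1 g1 X1 Y1" "spec_iso f2 g2 X2 Y2" "spec_iso f2 g2 S R"
    and wf: "wf_graph (fst X1)" "wf_graph (fst X2)" and c: "connected_graph (fst X1)"
    and S: "covering_subgraph (fst S) (fst X2)"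
  shows "action_sum X1 (X2, S) = action_sum Y1 (Y2, R)"
proof -
  have g: "graph_iso f1 g1 (fst X1) (fst Y1)" "graph_iso f2 g2 (fst X2) (fst Y2)"
    "graph_iso f2 g2 (fst S) (fst R)"
    using iso by (simp_all add: spec_iso_def)
  have wfS: "wf_graph (fst S)" and vS: "verts (fst S) = verts (fst X2)"
    and hS: "halves (fst S) = halves (fst X2)"
    and ht: "\<And>e. e \<in> halves (fst X2) \<Longrightarrow> htype (fst S) e = htype (fst X2) e"
    and st: "star (fst S) = star (fst X2)"
    using S by (auto simp: covering_subgraph_def star_def fun_eq_iff)
  have gl: "gluings (fst X1) (fst S) = gluings (fst X1) (fst X2)"
  proof
    fix v
    have "htype (fst S) e = htype (fst X2) e" if "e \<in> star (fst X2) v" for e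
      using that ht by (simp add: star_def)
    then show "gluings (fst X1) (fst S) v = gluings (fst X1) (fst X2) v"
      by (simp add: gluings_def st)
  qed
  have E: "essential_verts (fst S) \<subseteq> verts (fst X2)" by (auto simp: essential_verts_def vS)
  show ?thesis
    unfolding action_sum_def prod.case
  proof (rule sum_gluings_iso[OF g(1,2) wf])
    show "{v \<in> essential_verts (fst R). vertex_type (fst Y2) v = residue_type Y1} =
        f2 ` {v \<in> essential_verts (fst S). vertex_type (fst X2) v = residue_type X1}"
      unfolding graph_iso_essential_verts[OF g(3) wfS] spec_iso_residue_type[OF iso(1) wf(1) c]
      using graph_iso_vertex_type[OF g(2) wf(2)] E by (auto simp: subset_iff)
    fix v b assume "v \<in> {v \<in> essential_verts (fst S). vertex_type (fst X2) v = residue_type X1}"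
      and b: "b \<in> gluings (fst X1) (fst X2) v"
    then have v: "v \<in> verts (fst X2)" using E by auto
    have 1: "wf_graph (fst (insert_spec X1 X2 v b))"
      using insert_graph_wf[OF wf b] by (simp add: insert_spec_def)
    have 2: "wf_graph (fst (insert_spec X1 S v b))"
      using insert_graph_wf[OF wf(1) wfS, of b v] b gl by (simp add: insert_spec_def)
    have "pair_class (insert_spec X1 X2 v b, insert_spec X1 S v b) =
        pair_class (insert_spec Y1 Y2 (f2 v) (transport_gluing g1 g2 (star (fst X2) v) b),
          insert_spec Y1 R (f2 v) (transport_gluing g1 g2 (star (fst X2) v) b))"
    proof (rule pair_class_eqI[OF insert_spec_iso[OF g(1) iso(2) wf c v b] _ 1 2])
      show "spec_iso (map_sum f1 f2) (map_sum g1 g2) (insert_spec X1 S v b)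
          (insert_spec Y1 R (f2 v) (transport_gluing g1 g2 (star (fst X2) v) b))"
        using insert_spec_iso[OF g(1) iso(3) wf(1) wfS c, of v b] v b vS gl st by simp
    qed (simp_all add: insert_spec_def insert_graph_def vS hS)
    then show "Poly_Mapping.single (pair_class (insert_spec X1 X2 v b, insert_spec X1 S v b)) 1 =
        Poly_Mapping.single (pair_class
          (insert_spec Y1 Y2 (f2 v) (transport_gluing g1 g2 (star (fst X2) v) b),
           insert_spec Y1 R (f2 v) (transport_gluing g1 g2 (star (fst X2) v) b))) 1" by simp
  qed (use E in auto)
qed

lemma spec_iso_refl: "spec_iso id id X X"
  by (simp add: spec_iso_def graph_iso_def)

lemma some_in_spec_class:
  fixes X :: "(nat, nat, 't) spec_graph"
  shows "\<exists>f g. spec_iso f g X (SOME Y. Y \<in> spec_class X)"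
proof -
  have "X \<in> spec_class X" using spec_iso_refl[of X] unfolding spec_class_def by blast
  then have "(SOME Y. Y \<in> spec_class X) \<in> spec_class X" by (rule someI)
  then show ?thesis by (simp add: spec_class_def)
qed

lemma some_in_pair_class:
  fixes P :: "(nat, nat, 't) spec_graph \<times> (nat, nat, 't) spec_graph"
  shows
  "\<exists>f g. spec_iso f g (fst P) (fst (SOME Q. Q \<in> pair_class P)) \<and>
     spec_iso f g (snd P) (snd (SOME Q. Q \<in> pair_class P))"
proof -
  have "P \<in> pair_class P"
    using spec_iso_refl[of "fst P"] spec_iso_refl[of "snd P"] unfolding pair_class_def by blast
  then have "(SOME Q. Q \<in> pair_class P) \<in> pair_class P" by (rule someI)
  then show ?thesis by (simp add: pair_class_def)
qed

lemma scale_pm_one: "scale_pm 1 x = x"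
  unfolding scale_pm_def by (rule poly_mapping_eqI) (simp add: map.rep_eq when_def)

lemma bilinear_extension_single:
  "bilinear_extension F (Poly_Mapping.single a 1) (Poly_Mapping.single b 1) = F a b"
  by (simp add: bilinear_extension_def scale_pm_one)

lemma insertion_class:
  fixes X1 X2 :: "(nat, nat, 't) spec_graph"
  assumes "connected_specified T X1" "connected_specified T X2"
  shows "insertion (Poly_Mapping.single (spec_class X1) 1) (Poly_Mapping.single (spec_class X2) 1) =
    insertion_sum X1 X2"
proof -
  have "wf_graph (fst X1)" "wf_graph (fst X2)" "connected_graph (fst X1)"
    using assms by (auto simp: connected_specified_def specified_graph_def graph_of_theory_def)
  moreover obtain f1 g1 where "spec_iso f1 g1 X1 (SOME Y. Y \<in> spec_class X1)"
    using some_in_spec_class by metis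
  moreover obtain f2 g2 where "spec_iso f2 g2 X2 (SOME Y. Y \<in> spec_class X2)"
    using some_in_spec_class by metis
  ultimately show ?thesis
    unfolding insertion_def bilinear_extension_single
    by (intro insertion_sum_iso[symmetric])
qed

lemma action_class:
  fixes X1 :: "(nat, nat, 't) spec_graph"
    and P :: "(nat, nat, 't) spec_graph \<times> (nat, nat, 't) spec_graph"
  assumes "connected_specified T X1" "spec_pair T P"
  shows "action (Poly_Mapping.single (spec_class X1) 1) (Poly_Mapping.single (pair_class P) 1) =
    (action_sum X1 P :: 't pair_class \<Rightarrow>\<^sub>0 'k::field)"
proof -
  have "wf_graph (fst X1)" "wf_graph (fst (fst P))" "connected_graph (fst X1)"
    "covering_subgraph (fst (snd P)) (fst (fst P))"
    using assms by (auto simp: connected_specified_def specified_graph_def graph_of_theory_def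
        spec_pair_def specified_covering_subgraph_def)
  moreover obtain f1 g1 where "spec_iso f1 g1 X1 (SOME Y. Y \<in> spec_class X1)"
    using some_in_spec_class by metis
  moreover obtain f2 g2 where "spec_iso f2 g2 (fst P) (fst (SOME Q. Q \<in> pair_class P))"
      "spec_iso f2 g2 (snd P) (snd (SOME Q. Q \<in> pair_class P))"
    using some_in_pair_class by metis
  ultimately have "(action_sum X1 (fst P, snd P) :: 't pair_class \<Rightarrow>\<^sub>0 'k) = action_sum (SOME Y. Y \<in> spec_class X1)
      (fst (SOME Q. Q \<in> pair_class P), snd (SOME Q. Q \<in> pair_class P))"
    by (intro action_sum_iso)
  then show ?thesis
    unfolding action_def bilinear_extension_single by simp
qed


section \<open>Pre-Lie algebras and modules\<close>

locale left_pre_lie_algebra = vector_space scale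
  for scale :: "'k::field \<Rightarrow> 'a::ab_group_add \<Rightarrow> 'a" +
  fixes A :: "'a set" and circ :: "'a \<Rightarrow> 'a \<Rightarrow> 'a"
  assumes subspace_A: "subspace A"
    and circ_closed: "\<lbrakk>a \<in> A; b \<in> A\<rbrakk> \<Longrightarrow> circ a b \<in> A"
    and circ_add_left: "\<lbrakk>a \<in> A; a' \<in> A; b \<in> A\<rbrakk> \<Longrightarrow> circ (a + a') b = circ a b + circ a' b"
    and circ_add_right: "\<lbrakk>a \<in> A; b \<in> A; b' \<in> A\<rbrakk> \<Longrightarrow> circ a (b + b') = circ a b + circ a b'"
    and circ_scale_left: "\<lbrakk>a \<in> A; b \<in> A\<rbrakk> \<Longrightarrow> circ (scale r a) b = scale r (circ a b)"
    and circ_scale_right: "\<lbrakk>a \<in> A; b \<in> A\<rbrakk> \<Longrightarrow> circ a (scale r b) = scale r (circ a b)"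
    and left_pre_lie: "\<lbrakk>a \<in> A; b \<in> A; c \<in> A\<rbrakk> \<Longrightarrow>
      circ a (circ b c) - circ (circ a b) c = circ b (circ a c) - circ (circ b a) c"

locale left_pre_lie_module =
  alg: left_pre_lie_algebra scale A circ + mod: vector_space scaleM
  for scale :: "'k::field \<Rightarrow> 'a::ab_group_add \<Rightarrow> 'a" and A circ
    and scaleM :: "'k \<Rightarrow> 'm::ab_group_add \<Rightarrow> 'm" +
  fixes M :: "'m set" and act :: "'a \<Rightarrow> 'm \<Rightarrow> 'm"
  assumes subspace_M: "mod.subspace M"
    and act_closed: "\<lbrakk>a \<in> A; m \<in> M\<rbrakk> \<Longrightarrow> act a m \<in> M"
    and act_add_left: "\<lbrakk>a \<in> A; b \<in> A; m \<in> M\<rbrakk> \<Longrightarrow> act (a + b) m = act a m + act b m"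
    and act_add_right: "\<lbrakk>a \<in> A; m \<in> M; n \<in> M\<rbrakk> \<Longrightarrow> act a (m + n) = act a m + act a n"
    and act_scale_left: "\<lbrakk>a \<in> A; m \<in> M\<rbrakk> \<Longrightarrow> act (scale r a) m = scaleM r (act a m)"
    and act_scale_right: "\<lbrakk>a \<in> A; m \<in> M\<rbrakk> \<Longrightarrow> act a (scaleM r m) = scaleM r (act a m)"
    and module_pre_lie: "\<lbrakk>a \<in> A; b \<in> A; m \<in> M\<rbrakk> \<Longrightarrow>
      act a (act b m) - act (circ a b) m = act b (act a m) - act (circ b a) m"

end

theory Submission
  imports Defs
begin

text \<open>
  The pre-Lie identity says that the associator
  \<open>X1 \<rightarrow> (X2 \<rightarrow> P) - (X1 \<triangleright> X2) \<rightarrow> P\<close> is symmetric in \<open>X1\<close> and \<open>X2\<close>. In the first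
  term, once \<open>X2\<close> has been inserted at a vertex \<open>v\<close> of \<open>P\<close>, the graph \<open>X1\<close> is inserted
  either at a vertex of \<open>X2\<close> or at a vertex \<open>w \<noteq> v\<close> of \<open>P\<close>. The insertions of the first
  kind are those of the composites \<open>X1 \<triangleright> X2\<close> at \<open>v\<close> (\<open>insert_spec_assoc\<close>): a composite has the
  same residue as \<open>X2\<close>, and the gluings on both sides correspond bijectively. They cancel against
  the second term (\<open>insertion_associator\<close>). What remains is the sum over the insertions of
  \<open>X1\<close> and \<open>X2\<close> at two distinct vertices, which may be performed in either order
  (\<open>insert_spec_swap\<close>, \<open>disjoint_insertion_sum_commute\<close>).

  In a pair, insertions are allowed only at the essential vertices of the subgraph. The argument
  survives because an insertion at an essential vertex \<open>v\<close> makes all vertices of the inserted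
  graph essential and does not change whether any other vertex is essential
  (\<open>insert_essential_verts\<close>). The algebra and the module are therefore two instances of a single
  computation with a set \<open>A\<close> of admissible vertices.

  Closure under the operations rests on the map shrinking the inserted graph back to \<open>v\<close>. As the
  inserted graph is connected, this map preserves and reflects connectedness
  (\<open>insert_conn_iff\<close>), so that components, residues and contractions after the insertion are
  those before it. Being locally 1PI is checked as the absence of bridges: a bridge of the
  insertion would be a bridge of one of the two graphs (\<open>insert_bridgeless\<close>).
\<close>

section \<open>Bilinear extensions\<close>

lemma lookup_scale_pm: "Poly_Mapping.lookup (scale_pm c x) k = c * Poly_Mapping.lookup x k"
  by (simp add: scale_pm_def map.rep_eq when_def)

interpretation pm: vector_space "scale_pm :: 'k::field \<Rightarrow> ('b \<Rightarrow>\<^sub>0 'k) \<Rightarrow> ('b \<Rightarrow>\<^sub>0 'k)"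
  by unfold_locales
    (auto intro!: poly_mapping_eqI simp: lookup_scale_pm lookup_add algebra_simps)

interpretation pm_pair: vector_space_pair
  "scale_pm :: 'k::field \<Rightarrow> ('b \<Rightarrow>\<^sub>0 'k) \<Rightarrow> ('b \<Rightarrow>\<^sub>0 'k)"
  "scale_pm :: 'k::field \<Rightarrow> ('c \<Rightarrow>\<^sub>0 'k) \<Rightarrow> ('c \<Rightarrow>\<^sub>0 'k)"
  by unfold_locales

definition supported_on :: "'b set \<Rightarrow> ('b \<Rightarrow>\<^sub>0 'k::field) set" where
  "supported_on B = {x. Poly_Mapping.keys x \<subseteq> B}"

lemma subspace_supported_on: "pm.subspace (supported_on B :: ('b \<Rightarrow>\<^sub>0 'k::field) set)"
  unfolding pm.subspace_def supported_on_def
proof (intro conjI allI ballI; clarify)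
  fix x y :: "'b \<Rightarrow>\<^sub>0 'k" and k
  assume "Poly_Mapping.keys x \<subseteq> B" "Poly_Mapping.keys y \<subseteq> B" "k \<in> Poly_Mapping.keys (x + y)"
  then show "k \<in> B" using Poly_Mapping.keys_add[of x y] by blast
next
  fix c and x :: "'b \<Rightarrow>\<^sub>0 'k" and k
  assume "Poly_Mapping.keys x \<subseteq> B" "k \<in> Poly_Mapping.keys (scale_pm c x)"
  then show "k \<in> B" by (auto simp: in_keys_iff lookup_scale_pm)
qed simp

lemma supported_on_span:
  "(supported_on B :: ('a \<Rightarrow>\<^sub>0 'k::field) set) = pm.span ((\<lambda>b. Poly_Mapping.single b 1) ` B)"
proof (rule antisym)
  show "pm.span ((\<lambda>b. Poly_Mapping.single b 1) ` B) \<subseteq> (supported_on B :: ('a \<Rightarrow>\<^sub>0 'k) set)"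
    by (rule pm.span_minimal[OF _ subspace_supported_on])
      (auto simp: supported_on_def split: if_splits)
  show "(supported_on B :: ('a \<Rightarrow>\<^sub>0 'k) set) \<subseteq> pm.span ((\<lambda>b. Poly_Mapping.single b 1) ` B)"
  proof
    fix x :: "'a \<Rightarrow>\<^sub>0 'k" assume x: "x \<in> supported_on B"
    have "x = (\<Sum>b\<in>Poly_Mapping.keys x.
        scale_pm (Poly_Mapping.lookup x b) (Poly_Mapping.single b 1))"
    proof (rule poly_mapping_eqI)
      fix k
      have "Poly_Mapping.lookup (\<Sum>b\<in>Poly_Mapping.keys x.
          scale_pm (Poly_Mapping.lookup x b) (Poly_Mapping.single b 1)) k =
          (\<Sum>b\<in>Poly_Mapping.keys x. if b = k then Poly_Mapping.lookup x k else 0)"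
        unfolding lookup_sum by (intro sum.cong) (auto simp: lookup_scale_pm lookup_single when_def)
      also have "\<dots> = Poly_Mapping.lookup x k" by (simp add: in_keys_iff)
      finally show "Poly_Mapping.lookup x k = Poly_Mapping.lookup (\<Sum>b\<in>Poly_Mapping.keys x.
          scale_pm (Poly_Mapping.lookup x b) (Poly_Mapping.single b 1)) k" by simp
    qed
    also have "\<dots> \<in> pm.span ((\<lambda>b. Poly_Mapping.single b 1) ` B)"
      using x by (intro pm.span_sum pm.span_scale pm.span_base) (auto simp: supported_on_def)
    finally show "x \<in> pm.span ((\<lambda>b. Poly_Mapping.single b 1) ` B)" .
  qed
qed

text \<open>
  Enlarging the summation range by zero terms puts several arguments over a common range, which
  makes bilinearity visible.
\<close>

lemma bilinear_extension_superset:
  assumes "finite A" "Poly_Mapping.keys x \<subseteq> A" "finite B" "Poly_Mapping.keys y \<subseteq> B"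
  shows "bilinear_extension F x y =
    (\<Sum>a\<in>A. \<Sum>b\<in>B. scale_pm (Poly_Mapping.lookup x a * Poly_Mapping.lookup y b) (F a b))"
proof -
  have "(\<Sum>b\<in>Poly_Mapping.keys y. scale_pm (Poly_Mapping.lookup x a * Poly_Mapping.lookup y b) (F a b))
      = (\<Sum>b\<in>B. scale_pm (Poly_Mapping.lookup x a * Poly_Mapping.lookup y b) (F a b))" for a
    using assms(3,4) by (intro sum.mono_neutral_left) (auto simp: in_keys_iff)
  then show ?thesis
    unfolding bilinear_extension_def
    using assms by (intro sum.mono_neutral_cong_left) (simp_all add: in_keys_iff)
qed

lemma bilinear_extension_add_left:
  "bilinear_extension F (x + x') y = bilinear_extension F x y + bilinear_extension F x' y"
proof -
  let ?A = "Poly_Mapping.keys x \<union> Poly_Mapping.keys x'" and ?B = "Poly_Mapping.keys y"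
  have "bilinear_extension F z y = (\<Sum>a\<in>?A. \<Sum>b\<in>?B.
      scale_pm (Poly_Mapping.lookup z a * Poly_Mapping.lookup y b) (F a b))"
    if "Poly_Mapping.keys z \<subseteq> ?A" for z
    using that by (intro bilinear_extension_superset) auto
  then show ?thesis using Poly_Mapping.keys_add[of x x']
    by (simp add: lookup_add distrib_right pm.scale_left_distrib sum.distrib)
qed

lemma bilinear_extension_add_right:
  "bilinear_extension F x (y + y') = bilinear_extension F x y + bilinear_extension F x y'"
proof -
  let ?B = "Poly_Mapping.keys y \<union> Poly_Mapping.keys y'" and ?A = "Poly_Mapping.keys x"
  have "bilinear_extension F x z = (\<Sum>a\<in>?A. \<Sum>b\<in>?B.
      scale_pm (Poly_Mapping.lookup x a * Poly_Mapping.lookup z b) (F a b))"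
    if "Poly_Mapping.keys z \<subseteq> ?B" for z
    using that by (intro bilinear_extension_superset) auto
  then show ?thesis using Poly_Mapping.keys_add[of y y']
    by (simp add: lookup_add distrib_left pm.scale_left_distrib sum.distrib)
qed

lemma keys_scale_pm_subset: "Poly_Mapping.keys (scale_pm c x) \<subseteq> Poly_Mapping.keys x"
  by (auto simp: in_keys_iff lookup_scale_pm)

lemma bilinear_extension_scale_left:
  "bilinear_extension F (scale_pm c x) y = scale_pm c (bilinear_extension F x y)"
  by (subst bilinear_extension_superset[OF _ keys_scale_pm_subset _ subset_refl])
    (simp_all add: bilinear_extension_def lookup_scale_pm pm.scale_sum_right mult.assoc)

lemma bilinear_extension_scale_right:
  "bilinear_extension F x (scale_pm c y) = scale_pm c (bilinear_extension F x y)"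
  by (subst bilinear_extension_superset[OF _ subset_refl _ keys_scale_pm_subset])
    (simp_all add: bilinear_extension_def lookup_scale_pm pm.scale_sum_right mult.left_commute)

lemmas bilinear_extension_linear =
  bilinear_extension_add_left bilinear_extension_add_right
  bilinear_extension_scale_left bilinear_extension_scale_right

lemma bilinear_extension_sum_left:
  "bilinear_extension F (\<Sum>i\<in>I. f i) y = (\<Sum>i\<in>I. bilinear_extension F (f i) y)"
  by (induction I rule: infinite_finite_induct)
    (simp_all add: bilinear_extension_add_left, simp_all add: bilinear_extension_def)

lemma bilinear_extension_sum_right:
  "bilinear_extension F x (\<Sum>i\<in>I. f i) = (\<Sum>i\<in>I. bilinear_extension F x (f i))"
  by (induction I rule: infinite_finite_induct)
    (simp_all add: bilinear_extension_add_right, simp_all add: bilinear_extension_def)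

lemma bilinear_extension_closed:
  assumes "x \<in> supported_on A" "y \<in> supported_on B"
    and "\<And>a b. a \<in> A \<Longrightarrow> b \<in> B \<Longrightarrow> F a b \<in> supported_on C"
  shows "bilinear_extension F x y \<in> supported_on C"
  unfolding bilinear_extension_def using assms(1,2)
  by (intro pm.subspace_sum[OF subspace_supported_on] pm.subspace_scale[OF subspace_supported_on]
      assms(3)) (auto simp: supported_on_def)

text \<open>
  Both sides are linear in each of the three arguments, so they agree once they agree on basis
  vectors. The algebra is the case of an action on itself.
\<close>

lemma pre_lie_identity_from_basis:
  fixes F :: "'a \<Rightarrow> 'a \<Rightarrow> ('a \<Rightarrow>\<^sub>0 'k::field)" and G :: "'a \<Rightarrow> 'b \<Rightarrow> ('b \<Rightarrow>\<^sub>0 'k)"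
  defines "circ \<equiv> bilinear_extension F" and "act \<equiv> bilinear_extension G"
  assumes basis: "\<And>a b m. a \<in> A \<Longrightarrow> b \<in> A \<Longrightarrow> m \<in> M \<Longrightarrow>
      (\<lambda>x y z. act x (act y z) - act (circ x y) z = act y (act x z) - act (circ y x) z)
        (Poly_Mapping.single a 1) (Poly_Mapping.single b 1) (Poly_Mapping.single m 1)"
    and x: "x \<in> supported_on A" and y: "y \<in> supported_on A" and z: "z \<in> supported_on M"
  shows "act x (act y z) - act (circ x y) z = act y (act x z) - act (circ y x) z"
proof -
  note lin = Vector_Spaces.linear_iff pm.vector_space_axioms bilinear_extension_linear
    pm.scale_right_diff_distrib
  have lin_x: "Vector_Spaces.linear scale_pm scale_pm (\<lambda>x. act x (act y z) - act (circ x y) z)"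
    "Vector_Spaces.linear scale_pm scale_pm (\<lambda>x. act y (act x z) - act (circ y x) z)" for y z
    unfolding circ_def act_def by (simp_all add: lin)
  have lin_z: "Vector_Spaces.linear scale_pm scale_pm (\<lambda>z. act x (act y z) - act (circ x y) z)" for x y
    unfolding circ_def act_def by (simp add: lin)
  note ext = pm_pair.linear_eq_on_span[OF _ _ _ set_mp[OF equalityD1[OF supported_on_span]]]
  have 1: "act x (act y z) - act (circ x y) z = act y (act x z) - act (circ y x) z"
    if "x = Poly_Mapping.single a 1" "y = Poly_Mapping.single b 1" "a \<in> A" "b \<in> A" for x y a b
    by (rule ext[OF lin_z lin_z _ z]) (use basis that in auto)
  have 2: "act x (act y z) - act (circ x y) z = act y (act x z) - act (circ y x) z"
    if "x = Poly_Mapping.single a 1" "a \<in> A" for x a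
    by (rule ext[OF lin_x(2) lin_x(1) _ y]) (use 1 that in auto)
  show ?thesis
    by (rule ext[OF lin_x _ x]) (use 2 in auto)
qed

section \<open>Connectedness and bridges\<close>

lemma conn_refl: "u \<in> verts G \<Longrightarrow> (u, u) \<in> conn G"
  by (simp add: conn_def)

lemma conn_sym: "wf_graph G \<Longrightarrow> (u, w) \<in> conn G \<Longrightarrow> (w, u) \<in> conn G"
  using equiv_conn by (auto simp: equiv_def dest: symD)

lemma conn_trans: "(u, w) \<in> conn G \<Longrightarrow> (w, x) \<in> conn G \<Longrightarrow> (u, x) \<in> conn G"
  by (auto simp: conn_def)

lemma conn_edge: "wf_graph G \<Longrightarrow> e \<in> halves G \<Longrightarrow> (bdry G e, bdry G (flip G e)) \<in> conn G"
  by (auto simp: conn_def wf_graph_def)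

lemma conn_map:
  assumes uw: "(u, w) \<in> conn G" and p: "p ` verts G \<subseteq> verts H"
    and edge: "\<And>e. e \<in> halves G \<Longrightarrow> (p (bdry G e), p (bdry G (flip G e))) \<in> conn H"
  shows "(p u, p w) \<in> conn H"
proof -
  have "(u, w) \<in> ((\<lambda>e. (bdry G e, bdry G (flip G e))) ` halves G)\<^sup>*" "u \<in> verts G"
    using uw by (simp_all add: conn_def)
  then show ?thesis
  proof induction
    case base
    then show ?case using p by (intro conn_refl) auto
  next
    case (step y z)
    then show ?case using edge by (blast intro: conn_trans)
  qed
qed

lemma connected_graph_iff:
  assumes wf: "wf_graph G"
  shows "connected_graph G \<longleftrightarrow> verts G \<noteq> {} \<and> (\<forall>u\<in>verts G. \<forall>w\<in>verts G. (u, w) \<in> conn G)"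
proof
  assume c: "connected_graph G"
  then have "verts G \<noteq> {}" by (auto simp: connected_graph_def components_def')
  with connected_graph_conn[OF c wf]
  show "verts G \<noteq> {} \<and> (\<forall>u\<in>verts G. \<forall>w\<in>verts G. (u, w) \<in> conn G)" by blast
next
  assume *: "verts G \<noteq> {} \<and> (\<forall>u\<in>verts G. \<forall>w\<in>verts G. (u, w) \<in> conn G)"
  then have "conn G `` {u} = verts G" if "u \<in> verts G" for u
    using that conn_verts by fast
  then have "components G = {verts G}" using * unfolding components_def' by auto
  then show "connected_graph G" by (simp add: connected_graph_def)
qed

lemma wf_cut_edge:
  assumes wf: "wf_graph G" and e: "e \<in> halves G" shows "wf_graph (cut_edge G e)"
proof -
  have "flip (cut_edge G e) (flip (cut_edge G e) d) = d" if d: "d \<in> halves G" for d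
  proof (cases "d = e \<or> d = flip G e")
    case False
    have "flip G (flip G d) = d" "flip G (flip G e) = e" using wf d e by (simp_all add: wf_graph_def)
    with False have "flip G d \<noteq> flip G e" "flip G d \<noteq> e" by auto
    then show ?thesis using False \<open>flip G (flip G d) = d\<close> by (simp add: cut_edge_def)
  qed (auto simp: cut_edge_def)
  then show ?thesis using wf e by (auto simp: wf_graph_def cut_edge_def)
qed

text \<open>
  A path through a cut edge can be rerouted along a path joining the two ends of that edge.
\<close>

lemma conn_cut_edge_eq:
  assumes wf: "wf_graph G" and e: "(bdry G e, bdry G (flip G e)) \<in> conn (cut_edge G e)"
    and h: "e \<in> halves G" and uw: "(u, w) \<in> conn G"
  shows "(u, w) \<in> conn (cut_edge G e)"
proof -
  have "(id u, id w) \<in> conn (cut_edge G e)"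
  proof (rule conn_map[OF uw])
    fix d assume d: "d \<in> halves G"
    consider "d = e" | "d = flip G e" | "d \<noteq> e" "d \<noteq> flip G e" by blast
    then show "(id (bdry G d), id (bdry G (flip G d))) \<in> conn (cut_edge G e)"
    proof cases
      case 1
      then show ?thesis using e by simp
    next
      case 2
      then show ?thesis using conn_sym[OF wf_cut_edge[OF wf h] e] wf h by (simp add: wf_graph_def)
    next
      case 3
      then show ?thesis using conn_edge[OF wf_cut_edge[OF wf h], of d] d by (simp add: cut_edge_def)
    qed
  qed (simp add: cut_edge_def)
  then show ?thesis by simp
qed

text \<open>
  A subset closed under adjacency carries the same connections in the induced graph; this
  applies both to a component of a graph and to the same vertex set once an edge has been cut.
\<close>

lemma component_graph_conn:
  assumes C: "C \<subseteq> verts G"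
    and closed: "\<And>e. e \<in> halves G \<Longrightarrow> bdry G e \<in> C \<Longrightarrow> bdry G (flip G e) \<in> C"
    and u: "u \<in> C" and uw: "(u, w) \<in> conn G"
  shows "(u, w) \<in> conn (component_graph G C)"
proof -
  let ?H = "component_graph G C"
  have "(u, w) \<in> ((\<lambda>e. (bdry G e, bdry G (flip G e))) ` halves G)\<^sup>*"
    using uw by (simp add: conn_def)
  then have "w \<in> C \<and> (u, w) \<in> ((\<lambda>e. (bdry ?H e, bdry ?H (flip ?H e))) ` halves ?H)\<^sup>*"
  proof induction
    case (step y z)
    then obtain e where e: "e \<in> halves G" "y = bdry G e" "z = bdry G (flip G e)" by auto
    then have "(y, z) \<in> (\<lambda>e. (bdry ?H e, bdry ?H (flip ?H e))) ` halves ?H"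
      using step.IH by (intro image_eqI[of _ _ e]) (auto simp: component_graph_def)
    moreover have "z \<in> C" using step.IH closed e by simp
    ultimately show ?case using step.IH rtrancl_into_rtrancl[of u y _ z] by simp
  qed (use u in simp)
  moreover have "verts ?H = C" by (simp add: component_graph_def)
  ultimately show ?thesis using u unfolding conn_def by blast
qed

text \<open>
  Being locally 1PI means having no bridge. In this form the property can be checked edge by
  edge, without passing to the components.
\<close>

definition bridgeless :: "('v, 'h, 't) fgraph \<Rightarrow> bool" where
  "bridgeless G \<longleftrightarrow> (\<forall>e\<in>halves G. flip G e \<noteq> e \<longrightarrow>
     (bdry G e, bdry G (flip G e)) \<in> conn (cut_edge G e))"

lemma component_closed:
  assumes wf: "wf_graph G" and C: "C \<in> components G" and u: "u \<in> C"
  shows "(u, w) \<in> conn G \<longleftrightarrow> w \<in> C"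
proof -
  obtain x where x: "x \<in> verts G" "C = conn G `` {x}" using C by (auto simp: components_def')
  have xu: "(x, u) \<in> conn G" using u x by simp
  show ?thesis using conn_trans[OF xu, of w] conn_trans[OF conn_sym[OF wf xu], of w] x by auto
qed

lemma component_graph_wf:
  assumes wf: "wf_graph G" and C: "C \<in> components G"
  shows "wf_graph (component_graph G C)"
proof -
  have "bdry G (flip G e) \<in> C" if "e \<in> halves G" "bdry G e \<in> C" for e
    using component_closed[OF wf C that(2)] conn_edge[OF wf that(1)] by simp
  then show ?thesis using wf component_subset[OF C]
    by (auto simp: wf_graph_def component_graph_def intro: finite_subset)
qed

lemma component_graph_cut: "component_graph (cut_edge G e) C = cut_edge (component_graph G C) e"
  by (simp add: component_graph_def cut_edge_def)

text \<open>
  Cutting an edge affects only the component in which it lies, and this component stays connected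
  exactly when the two ends of the edge are still joined by a path.
\<close>

lemma locally_one_PI_iff_bridgeless:
  assumes wf: "wf_graph G"
  shows "locally_one_PI G \<longleftrightarrow> bridgeless G"
proof
  assume l: "locally_one_PI G"
  show "bridgeless G"
    unfolding bridgeless_def
  proof (intro ballI impI)
    fix e assume e: "e \<in> halves G" "flip G e \<noteq> e"
    let ?C = "conn G `` {bdry G e}"
    let ?H = "component_graph G ?C"
    have v: "bdry G e \<in> verts G" using wf e by (auto simp: wf_graph_def)
    then have C: "?C \<in> components G" by (auto simp: components_def')
    have in_C: "bdry G e \<in> ?C" "bdry G (flip G e) \<in> ?C"
      using conn_refl[OF v] conn_edge[OF wf e(1)] by auto
    have e_H: "e \<in> halves ?H" "flip ?H e \<noteq> e" using e in_C by (simp_all add: component_graph_def)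
    then have "connected_graph (cut_edge ?H e)"
      using l C unfolding locally_one_PI_def one_PI_def by blast
    then have "(bdry G e, bdry G (flip G e)) \<in> conn (cut_edge ?H e)"
      using in_C unfolding connected_graph_iff[OF wf_cut_edge[OF component_graph_wf[OF wf C] e_H(1)]]
      by (simp add: cut_edge_def component_graph_def)
    then have "(id (bdry G e), id (bdry G (flip G e))) \<in> conn (cut_edge G e)"
    proof (rule conn_map)
      fix d assume "d \<in> halves (cut_edge ?H e)"
      then have "d \<in> halves (cut_edge G e)" by (simp add: cut_edge_def component_graph_def)
      from conn_edge[OF wf_cut_edge[OF wf e(1)] this]
      show "(id (bdry (cut_edge ?H e) d), id (bdry (cut_edge ?H e) (flip (cut_edge ?H e) d)))
          \<in> conn (cut_edge G e)"
        by (simp add: cut_edge_def component_graph_def)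
    qed (use component_subset[OF C] in \<open>simp add: cut_edge_def component_graph_def\<close>)
    then show "(bdry G e, bdry G (flip G e)) \<in> conn (cut_edge G e)" by simp
  qed
next
  assume b: "bridgeless G"
  show "locally_one_PI G"
    unfolding locally_one_PI_def one_PI_def
  proof (intro ballI conjI impI)
    fix C assume C: "C \<in> components G"
    let ?H = "component_graph G C"
    have sub: "C \<subseteq> verts G" and ne: "C \<noteq> {}"
      using component_subset[OF C] C conn_refl[of _ G] by (auto simp: components_def')
    have closed: "bdry G (flip G d) \<in> C" if "d \<in> halves G" "bdry G d \<in> C" for d
      using component_closed[OF wf C that(2)] conn_edge[OF wf that(1)] by simp
    note wfH = component_graph_wf[OF wf C]
    have G: "(u, w) \<in> conn G" if "u \<in> C" "w \<in> C" for u w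
      using component_closed[OF wf C that(1)] that(2) by simp
    show "connected_graph ?H"
      unfolding connected_graph_iff[OF wfH]
      using ne component_graph_conn[OF sub closed _ G] by (simp add: component_graph_def)
    fix e assume e: "e \<in> halves ?H" "flip ?H e \<noteq> e"
    then have eG: "e \<in> halves G" "flip G e \<noteq> e" by (auto simp: component_graph_def)
    have closed': "bdry (cut_edge G e) (flip (cut_edge G e) d) \<in> C"
      if "d \<in> halves (cut_edge G e)" "bdry (cut_edge G e) d \<in> C" for d
      using closed that by (auto simp: cut_edge_def)
    have "(u, w) \<in> conn (cut_edge ?H e)" if "u \<in> C" "w \<in> C" for u w
      unfolding component_graph_cut[symmetric]
    proof (rule component_graph_conn[OF _ closed' that(1)])
      show "(u, w) \<in> conn (cut_edge G e)"
        using b eG by (intro conn_cut_edge_eq[OF wf _ _ G[OF that]]) (auto simp: bridgeless_def)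
    qed (use sub in \<open>simp_all add: cut_edge_def\<close>)
    then show "connected_graph (cut_edge ?H e)"
      unfolding connected_graph_iff[OF wf_cut_edge[OF wfH e(1)]]
      using ne by (simp add: component_graph_def cut_edge_def)
  qed
qed

lemma graph_iso_bridgeless:
  assumes iso: "graph_iso f g G H" and wf: "wf_graph G" and b: "bridgeless G"
  shows "bridgeless H"
  unfolding bridgeless_def
proof (intro ballI impI)
  have H: "halves H = g ` halves G" and inj: "inj_on g (halves G)"
    using iso by (auto simp: graph_iso_def bij_betw_def)
  fix e' assume e': "e' \<in> halves H" "flip H e' \<noteq> e'"
  then obtain e where e: "e \<in> halves G" "e' = g e" unfolding H by auto
  have fl: "flip H e' = g (flip G e)" "flip G e \<in> halves G"
    using e iso wf by (auto simp: graph_iso_def wf_graph_def)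
  have ne: "flip G e \<noteq> e" using e' e fl by auto
  have "(cut_edge H e') = H\<lparr>flip := (flip H)(g e := g e, g (flip G e) := g (flip G e))\<rparr>"
    using e(2) fl(1) by (simp add: cut_edge_def)
  moreover have "((flip H)(g e := g e, g (flip G e) := g (flip G e))) (g d) =
      g (((flip G)(e := e, flip G e := flip G e)) d)" if "d \<in> halves G" for d
    using that e(1) fl(2) inj iso by (simp add: inj_on_eq_iff graph_iso_def)
  ultimately have "graph_iso f g (cut_edge G e) (cut_edge H e')"
    using iso by (simp add: graph_iso_def cut_edge_def)
  from graph_iso_conn_imp[OF this wf_cut_edge[OF wf e(1)]]
  have "(f (bdry G e), f (bdry G (flip G e))) \<in> conn (cut_edge H e')"
    using b e ne by (simp add: bridgeless_def)
  then show "(bdry H e', bdry H (flip H e')) \<in> conn (cut_edge H e')"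
    using iso e fl by (simp add: graph_iso_def)
qed

section \<open>Contractions\<close>

lemma covering_subgraph_refl: "wf_graph G \<Longrightarrow> covering_subgraph G G"
  by (simp add: covering_subgraph_def)

text \<open>
  The surviving half-edges are stable under the involution of the big graph: if the subgraph cuts
  an edge at one end, it cuts it at the other.
\<close>

lemma wf_contract:
  assumes wf: "wf_graph G" and S: "covering_subgraph S G"
  shows "wf_graph (contract G S j)"
proof -
  have wfS: "wf_graph S" and v: "verts S = verts G" and h: "halves S = halves G"
    and fl: "\<And>e. e \<in> halves G \<Longrightarrow> flip S e = flip G e \<or> flip S e = e"
    using S by (auto simp: covering_subgraph_def)
  have "flip S (flip G e) = flip G e" if e: "e \<in> halves G" "flip S e = e" for e
  proof (rule ccontr)
    assume ne: "flip S (flip G e) \<noteq> flip G e"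
    have e': "flip G e \<in> halves G" "flip G (flip G e) = e" using wf e by (simp_all add: wf_graph_def)
    with fl ne have "flip S (flip G e) = e" by metis
    moreover have "flip S (flip S (flip G e)) = flip G e" using wfS h e' by (simp add: wf_graph_def)
    ultimately show False using ne e by simp
  qed
  then show ?thesis using wf v h
    by (auto simp: wf_graph_def contract_def components_def')
qed

text \<open>
  A surjection on vertices that preserves and reflects connectedness matches the components; the
  example to keep in mind collapses a connected piece to a point.
\<close>

lemma conn_reflecting_component:
  assumes p: "p ` verts G = verts H" and x: "x \<in> verts G"
    and c: "\<And>x y. x \<in> verts G \<Longrightarrow> y \<in> verts G \<Longrightarrow> (x, y) \<in> conn G \<longleftrightarrow> (p x, p y) \<in> conn H"
  shows "p ` (conn G `` {x}) = conn H `` {p x}"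
proof (intro equalityI subsetI)
  fix q assume q: "q \<in> conn H `` {p x}"
  then have "q \<in> verts H" using conn_verts by fast
  then obtain y where "y \<in> verts G" "q = p y" using p by auto
  then show "q \<in> p ` (conn G `` {x})" using q c[OF x] by auto
qed (use c[OF x] conn_verts[of x _ G] in auto)

lemma conn_reflecting_components:
  assumes wf: "wf_graph G" and p: "p ` verts G = verts H"
    and c: "\<And>x y. x \<in> verts G \<Longrightarrow> y \<in> verts G \<Longrightarrow> (x, y) \<in> conn G \<longleftrightarrow> (p x, p y) \<in> conn H"
  shows "bij_betw ((`) p) (components G) (components H)"
proof (rule bij_betw_imageI)
  show "(`) p ` components G = components H"
    unfolding components_def' p[symmetric] image_image
    using conn_reflecting_component[OF p _ c] by (auto intro!: image_cong)
  show "inj_on ((`) p) (components G)"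
  proof (rule inj_onI)
    fix C D assume CD: "C \<in> components G" "D \<in> components G" "p ` C = p ` D"
    obtain x y where x: "x \<in> verts G" "C = conn G `` {x}" and y: "y \<in> verts G" "D = conn G `` {y}"
      using CD by (auto simp: components_def')
    have "conn H `` {p x} = conn H `` {p y}"
      using CD(3) x y conn_reflecting_component[OF p x(1) c] conn_reflecting_component[OF p y(1) c]
      by simp
    moreover have "(p y, p y) \<in> conn H" using y p by (intro conn_refl) auto
    ultimately have "(x, y) \<in> conn G" using c x y by auto
    then show "C = D" using equiv_class_eq[OF equiv_conn[OF wf]] x y by blast
  qed
qed

text \<open>
  The vertices of a contraction are components, hence a map of vertices that merely matches the
  components induces an isomorphism of contractions. It is used for isomorphisms and for
  shrinking an inserted graph, and, with \<open>S = G\<close>, for residues.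
\<close>

lemma contract_iso:
  assumes wf: "wf_graph S" and p: "p ` verts S = verts S'"
    and c: "\<And>x y. x \<in> verts S \<Longrightarrow> y \<in> verts S \<Longrightarrow> (x, y) \<in> conn S \<longleftrightarrow> (p x, p y) \<in> conn S'"
    and g: "bij_betw g {e \<in> halves G. flip S e = e} {e \<in> halves G'. flip S' e = e}"
    and e: "\<And>e. e \<in> halves G \<Longrightarrow> flip S e = e \<Longrightarrow> bdry G e \<in> verts S \<and>
      bdry G' (g e) = p (bdry G e) \<and> flip G' (g e) = g (flip G e) \<and> htype G' (g e) = htype G e"
    and j: "\<And>C. C \<in> components S \<Longrightarrow> j' (p ` C) = j C"
  shows "graph_iso ((`) p) g (contract G S j) (contract G' S' j')"
  unfolding graph_iso_def contract_def
  using conn_reflecting_components[OF wf p c] g e j conn_reflecting_component[OF p _ c]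
  by simp

lemma graph_iso_contract:
  assumes iso: "graph_iso f g G H" "graph_iso f g S R" and wf: "wf_graph G"
    and S: "covering_subgraph S G" and j: "\<And>C. C \<in> components S \<Longrightarrow> j' (f ` C) = j C"
  shows "graph_iso ((`) f) g (contract G S j) (contract H R j')"
proof (rule contract_iso)
  have wfS: "wf_graph S" and v: "verts S = verts G" and h: "halves S = halves G"
    using S by (auto simp: covering_subgraph_def)
  show "wf_graph S" "f ` verts S = verts R"
    "\<And>x y. x \<in> verts S \<Longrightarrow> y \<in> verts S \<Longrightarrow> (x, y) \<in> conn S \<longleftrightarrow> (f x, f y) \<in> conn R"
    using wfS iso graph_iso_conn[OF iso(2) wfS] by (auto simp: graph_iso_def bij_betw_def)
  have hH: "halves H = g ` halves G" and inj: "inj_on g (halves G)"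
    using iso by (auto simp: graph_iso_def bij_betw_def)
  have fl: "flip R (g e) = g e \<longleftrightarrow> flip S e = e" if "e \<in> halves G" for e
    using that iso(2) inj wfS h by (simp add: graph_iso_def inj_on_eq_iff wf_graph_def)
  show "bij_betw g {e \<in> halves G. flip S e = e} {e \<in> halves H. flip R e = e}"
  proof (rule bij_betw_imageI)
    show "inj_on g {e \<in> halves G. flip S e = e}" using inj by (rule inj_on_subset) auto
    show "g ` {e \<in> halves G. flip S e = e} = {e \<in> halves H. flip R e = e}"
      unfolding hH using fl by auto
  qed
qed (use iso wf S j in \<open>auto simp: graph_iso_def wf_graph_def covering_subgraph_def\<close>)

section \<open>Specified graphs up to isomorphism\<close>

text \<open>
  The index chosen by the specification witnesses superficial divergence of each component.
\<close>

lemma specified_graph_iff: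
  "specified_graph T X \<longleftrightarrow> graph_of_theory T (fst X) \<and> bridgeless (fst X) \<and>
     (\<forall>C\<in>components (fst X). vertex_type (residue X) C \<in> vertex_types T)"
proof -
  have "vertex_type (residue (fst X, \<lambda>_. snd X C)) C = vertex_type (residue X) C" for C
    by (simp add: vertex_type_def half_types_at_def star_def residue_def contract_def)
  then have "superficially_divergent T (fst X)"
    if "\<forall>C\<in>components (fst X). vertex_type (residue X) C \<in> vertex_types T"
    using that unfolding superficially_divergent_def by metis
  then show ?thesis
    using locally_one_PI_iff_bridgeless[of "fst X"]
    by (auto simp: specified_graph_def graph_of_theory_def)
qed

lemma graph_iso_graph_of_theory:
  assumes iso: "graph_iso f g G H" and T: "graph_of_theory T G"
  shows "graph_of_theory T H"
proof -
  have wf: "wf_graph G" using T by (simp add: graph_of_theory_def)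
  have "halves H = g ` halves G" "verts H = f ` verts G"
    using iso by (auto simp: graph_iso_def bij_betw_def)
  then show ?thesis
    using T iso graph_iso_wf[OF iso wf] graph_iso_vertex_type[OF iso wf]
    by (auto simp: graph_of_theory_def graph_iso_def)
qed

lemma spec_iso_contract:
  assumes X: "spec_iso f g X Y" and S: "spec_iso f g S R" and wf: "wf_graph (fst X)"
    and cov: "covering_subgraph (fst S) (fst X)"
  shows "graph_iso ((`) f) g (contract (fst X) (fst S) (snd S)) (contract (fst Y) (fst R) (snd R))"
  using X S unfolding spec_iso_def by (intro graph_iso_contract[OF _ _ wf cov]) auto

lemma spec_iso_specified:
  assumes iso: "spec_iso f g X Y" and X: "specified_graph T X"
  shows "specified_graph T Y"
proof -
  have T: "graph_of_theory T (fst X)" and wf: "wf_graph (fst X)" and b: "bridgeless (fst X)"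
    and res: "\<forall>C\<in>components (fst X). vertex_type (residue X) C \<in> vertex_types T"
    using X by (auto simp: specified_graph_iff graph_of_theory_def)
  have g: "graph_iso f g (fst X) (fst Y)" using iso by (simp add: spec_iso_def)
  have "graph_iso ((`) f) g (residue X) (residue Y)"
    unfolding residue_def by (rule spec_iso_contract[OF iso iso wf covering_subgraph_refl[OF wf]])
  from graph_iso_vertex_type[OF this]
  have "vertex_type (residue Y) (f ` C) = vertex_type (residue X) C" if "C \<in> components (fst X)" for C
    using that wf_contract[OF wf covering_subgraph_refl[OF wf]]
    by (simp add: residue_def contract_def)
  then show ?thesis
    using graph_iso_graph_of_theory[OF g T] graph_iso_bridgeless[OF g wf b] res
    by (auto simp: specified_graph_iff graph_iso_components[OF g wf])
qed

lemma spec_iso_connected_specified: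
  assumes iso: "spec_iso f g X Y" and X: "connected_specified T X"
  shows "connected_specified T Y"
  using spec_iso_specified[OF iso] graph_iso_connected[of f g "fst X" "fst Y"] iso X
  by (auto simp: connected_specified_def spec_iso_def specified_graph_def graph_of_theory_def)

lemma connected_specifiedD:
  assumes "connected_specified T X"
  shows "wf_graph (fst X)" "connected_graph (fst X)" "specified_graph T X"
  using assms by (auto simp: connected_specified_def specified_graph_def graph_of_theory_def)

lemma graph_iso_covering:
  assumes iso: "graph_iso f g G H" "graph_iso f g S R" and S: "covering_subgraph S G"
  shows "covering_subgraph R H"
proof -
  have wfS: "wf_graph S" and v: "verts S = verts G" and h: "halves S = halves G"
    using S by (auto simp: covering_subgraph_def)
  have "halves H = g ` halves G" "verts H = f ` verts G" "halves R = g ` halves S"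
    "verts R = f ` verts S"
    using iso by (auto simp: graph_iso_def bij_betw_def)
  moreover have "flip R (g e) = flip H (g e) \<or> flip R (g e) = g e" if "e \<in> halves G" for e
  proof -
    have "flip R (g e) = g (flip S e)" "flip H (g e) = g (flip G e)" "flip S e = flip G e \<or> flip S e = e"
      using that iso S h by (simp_all add: graph_iso_def covering_subgraph_def)
    then show ?thesis by auto
  qed
  ultimately show ?thesis
    using iso S graph_iso_wf[OF iso(2) wfS] v h
    by (simp add: covering_subgraph_def graph_iso_def)
qed

text \<open>
  The specification of the contracted graph is transported through the unions of its vertices.
  As the contracted graph is connected, the only such union is the whole vertex set.
\<close>

lemma spec_iso_spec_pair:
  assumes iso: "spec_iso f g X Y" "spec_iso f g S R" and P: "spec_pair T (X, S)"
  shows "spec_pair T (Y, R)"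
proof -
  have X: "connected_specified T X" and S: "specified_graph T S"
    and cov: "covering_subgraph (fst S) (fst X)"
    and j: "\<And>C. C \<in> components (fst S) \<inter> components (fst X) \<Longrightarrow>
      (\<forall>e \<in> halves (fst X). bdry (fst X) e \<in> C \<longrightarrow> flip (fst S) e = flip (fst X) e) \<Longrightarrow>
      snd S C = snd X C"
    and quo: "connected_specified T (contract_spec X S)"
    using P by (auto simp: spec_pair_def specified_covering_subgraph_def)
  note wf = connected_specifiedD(1)[OF X]
  have wfS: "wf_graph (fst S)" and hS: "halves (fst S) = halves (fst X)"
    and vS: "verts (fst S) = verts (fst X)"
    using cov by (auto simp: covering_subgraph_def)
  have g: "graph_iso f g (fst X) (fst Y)" "graph_iso f g (fst S) (fst R)"
    using iso by (auto simp: spec_iso_def)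
  have inj: "inj_on f (verts (fst X))" "inj_on g (halves (fst X))"
    and h: "halves (fst Y) = g ` halves (fst X)"
    using g by (auto simp: graph_iso_def bij_betw_def)
  have "snd R C' = snd Y C'" if C': "C' \<in> components (fst R) \<inter> components (fst Y)"
    and fl: "\<forall>e \<in> halves (fst Y). bdry (fst Y) e \<in> C' \<longrightarrow> flip (fst R) e = flip (fst Y) e" for C'
  proof -
    obtain C D where C: "C \<in> components (fst S)" "C' = f ` C" and D: "D \<in> components (fst X)" "C' = f ` D"
      using C' unfolding graph_iso_components[OF g(1) wf] graph_iso_components[OF g(2) wfS] by auto
    have "C = D" using inj(1) C D component_subset[OF C(1)] component_subset[OF D(1)] vS
      by (simp add: inj_on_image_eq_iff)
    have "flip (fst S) e = flip (fst X) e" if e: "e \<in> halves (fst X)" "bdry (fst X) e \<in> C" for e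
    proof -
      have "bdry (fst Y) (g e) \<in> C'" "g e \<in> halves (fst Y)"
        using e g h C by (auto simp: graph_iso_def)
      then have "flip (fst R) (g e) = flip (fst Y) (g e)" using fl by simp
      then have "g (flip (fst S) e) = g (flip (fst X) e)" using g e hS by (simp add: graph_iso_def)
      moreover have "flip (fst S) e \<in> halves (fst X)" "flip (fst X) e \<in> halves (fst X)"
        using wf wfS e hS by (auto simp: wf_graph_def)
      ultimately show ?thesis using inj(2) by (simp add: inj_on_eq_iff)
    qed
    then have "snd S C = snd X C" using j C D \<open>C = D\<close> by simp
    then show ?thesis using iso C D \<open>C = D\<close> by (simp add: spec_iso_def)
  qed
  moreover have "spec_iso ((`) f) g (contract_spec X S) (contract_spec Y R)"
  proof -
    have "snd Y (\<Union> ((`) f ` D)) = snd X (\<Union> D)"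
      if D: "D \<in> components (contract (fst X) (fst S) (snd S))" for D
    proof -
      have q: "connected_graph (contract (fst X) (fst S) (snd S))"
        using connected_specifiedD(2)[OF quo] by (simp add: contract_spec_def)
      have "D = components (fst S)"
        using D unfolding connected_graph_components[OF q wf_contract[OF wf cov]]
        by (simp add: contract_def)
      then have U: "\<Union> D = verts (fst X)"
        using Union_quotient[OF equiv_conn[OF wfS]] vS by (simp add: components_def)
      have "verts (fst X) \<in> components (fst X)"
        using connected_graph_components[OF connected_specifiedD(2)[OF X] wf] by simp
      moreover have "\<Union> ((`) f ` D) = f ` \<Union> D" by auto
      ultimately show ?thesis using iso(1) U by (simp add: spec_iso_def)
    qed
    then show ?thesis
      using spec_iso_contract[OF iso wf cov] by (simp add: spec_iso_def contract_spec_def)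
  qed
  from spec_iso_connected_specified[OF this quo]
  have "connected_specified T (contract_spec Y R)" .
  moreover note Y = spec_iso_connected_specified[OF iso(1) X]
  ultimately show ?thesis
    using spec_iso_specified[OF iso(2) S] connected_specifiedD(3)[OF Y] graph_iso_covering[OF g cov]
    unfolding spec_pair_def specified_covering_subgraph_def prod.case by blast
qed

text \<open>
  Isomorphism classes consist of graphs labelled by natural numbers, while insertions are labelled
  by sum types. Relabelling provides the members of their classes.
\<close>

definition relabel :: "('v \<Rightarrow> 'w) \<Rightarrow> ('h \<Rightarrow> 'g) \<Rightarrow> ('v, 'h, 't) spec_graph \<Rightarrow> ('w, 'g, 't) spec_graph" where
  "relabel f g X = (let G = fst X; f' = inv_into (verts G) f; g' = inv_into (halves G) g in
     (\<lparr>verts = f ` verts G, halves = g ` halves G, bdry = f \<circ> bdry G \<circ> g', flip = g \<circ> flip G \<circ> g',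
       htype = htype G \<circ> g', vindex = vindex G \<circ> f'\<rparr>, \<lambda>C. snd X (f' ` C)))"

lemma relabel_iso:
  assumes "inj_on f (verts (fst X))" "inj_on g (halves (fst X))"
  shows "spec_iso f g X (relabel f g X)"
  using assms inv_into_image_cancel[OF assms(1) component_subset]
  by (auto simp: spec_iso_def graph_iso_def relabel_def Let_def inj_on_imp_bij_betw)

lemma pair_class_nonempty:
  assumes wf: "wf_graph (fst X)" and S: "verts (fst S) = verts (fst X)" "halves (fst S) = halves (fst X)"
  shows "\<exists>Q. Q \<in> pair_class (X, S)"
proof -
  have "finite (verts (fst X))" "finite (halves (fst X))" using wf by (auto simp: wf_graph_def)
  then obtain f :: "'a \<Rightarrow> nat" and g :: "'b \<Rightarrow> nat"
    where "inj_on f (verts (fst X))" "inj_on g (halves (fst X))"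
    using finite_imp_inj_to_nat_seg by metis
  then have "(relabel f g X, relabel f g S) \<in> pair_class (X, S)"
    using relabel_iso[of f X g] relabel_iso[of f S g] S unfolding pair_class_def by auto
  then show ?thesis by blast
qed

text \<open>
  This lets sums over classes of graphs be written as sums over classes of pairs, so that the
  algebra and the module can be treated together.
\<close>

lemma spec_class_eq_image: "spec_class X = fst ` pair_class (X, X)"
proof (intro equalityI subsetI)
  fix Y assume "Y \<in> spec_class X"
  then have "(Y, Y) \<in> pair_class (X, X)" by (auto simp: spec_class_def pair_class_def)
  then show "Y \<in> fst ` pair_class (X, X)" by force
next
  fix Y assume "Y \<in> fst ` pair_class (X, X)"
  then show "Y \<in> spec_class X" by (fastforce simp: spec_class_def pair_class_def)
qed

section \<open>Insertion\<close>

abbreviation shrink :: "'w \<Rightarrow> 'v + 'w \<Rightarrow> 'w" where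
  "shrink v \<equiv> case_sum (\<lambda>_. v) id"

lemma covering_star: "covering_subgraph S G \<Longrightarrow> star S = star G"
  by (auto simp: covering_subgraph_def star_def fun_eq_iff)

lemma covering_gluings: "covering_subgraph S G \<Longrightarrow> gluings H S v = gluings H G v"
  by (auto simp: gluings_def covering_star) (auto simp: covering_subgraph_def star_def)

lemma gluing_apply:
  assumes "b \<in> gluings G1 G2 v" "e \<in> halves G2" "bdry G2 e = v"
  shows "b e \<in> external G1" "b e \<in> halves G1" "flip G1 (b e) = b e" "htype G1 (b e) = htype G2 e"
  using assms by (auto simp: gluings_def star_def external_def)

lemma insert_verts: "verts (insert_graph G1 G2 v b) = verts G1 <+> (verts G2 - {v})"
  by (simp add: insert_graph_def)

lemma gluing_image: "b \<in> gluings G1 G2 v \<Longrightarrow> external G1 = b ` star G2 v"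
  by (simp add: gluings_def bij_betw_def)

text \<open>
  The inserted graph is connected, so paths may be lifted along the shrinking map as well as
  projected.
\<close>

lemma insert_conn_iff:
  assumes wf: "wf_graph G1" "wf_graph G2" and b: "b \<in> gluings G1 G2 v" and v: "v \<in> verts G2"
    and c: "connected_graph G1"
    and x: "x \<in> verts (insert_graph G1 G2 v b)" and y: "y \<in> verts (insert_graph G1 G2 v b)"
  shows "(x, y) \<in> conn (insert_graph G1 G2 v b) \<longleftrightarrow> (shrink v x, shrink v y) \<in> conn G2"
proof
  assume "(shrink v x, shrink v y) \<in> conn G2"
  then show "(x, y) \<in> conn (insert_graph G1 G2 v b)"
    by (intro insert_conn_over[OF wf b c _ x refl y refl]) (simp add: conn_def)
qed (rule insert_conn_project[OF wf b v])

lemma shrink_verts: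
  assumes "verts G1 \<noteq> {}" "v \<in> verts G2"
  shows "shrink v ` verts (insert_graph G1 G2 v b) = verts G2"
proof -
  have "shrink v ` Inl ` verts G1 = {v}" using assms(1) by (auto simp: image_image)
  then have "shrink v ` (verts G1 <+> (verts G2 - {v})) = insert v (verts G2 - {v})"
    by (simp add: Plus_def image_Un image_image)
  then show ?thesis using assms(2) by (auto simp: insert_graph_def)
qed

lemma connected_verts: "connected_graph G \<Longrightarrow> verts G \<noteq> {}"
  by (auto simp: connected_graph_def components_def')

lemma insert_connected:
  assumes wf: "wf_graph G1" "wf_graph G2" and b: "b \<in> gluings G1 G2 v" and v: "v \<in> verts G2"
    and c: "connected_graph G1" "connected_graph G2"
  shows "connected_graph (insert_graph G1 G2 v b)"
proof -
  have "verts (insert_graph G1 G2 v b) \<noteq> {}"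
    using connected_verts[OF c(1)] by (auto simp: insert_graph_def)
  moreover have "shrink v x \<in> verts G2" if "x \<in> verts (insert_graph G1 G2 v b)" for x
    using that shrink_verts[OF connected_verts[OF c(1)] v] by blast
  ultimately show ?thesis
    using c(2) insert_conn_iff[OF wf b v c(1)]
    unfolding connected_graph_iff[OF insert_graph_wf[OF wf b]] connected_graph_iff[OF wf(2)]
    by simp
qed

lemma insert_external: "external (insert_graph G1 G2 v b) = Inr ` external G2"
  by (auto simp: external_def insert_graph_def)

lemma insert_star_Inr: "w \<noteq> v \<Longrightarrow> star (insert_graph G1 G2 v b) (Inr w) = Inr ` star G2 w"
  by (auto simp: star_def insert_graph_def split: if_splits)

text \<open>
  The half-edges at a vertex of the inserted graph: an internal half-edge stays, and an external
  one is represented by the half-edge that it has been glued to.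
\<close>

definition glued_half :: "('v, 'h, 't) fgraph \<Rightarrow> 'g set \<Rightarrow> ('g \<Rightarrow> 'h) \<Rightarrow> 'h \<Rightarrow> 'h + 'g" where
  "glued_half G1 A b d = (if d \<in> external G1 then Inr (inv_into A b d) else Inl d)"

lemma glued_half_gluing:
  assumes "b \<in> gluings G1 G2 v" "e \<in> star G2 v"
  shows "glued_half G1 (star G2 v) b (b e) = Inr e"
  using assms by (auto simp: glued_half_def gluings_def bij_betw_def)

lemma glued_half_star:
  assumes b: "b \<in> gluings G1 G2 v"
  shows "bij_betw (glued_half G1 (star G2 v) b) (star G1 w) (star (insert_graph G1 G2 v b) (Inl w))"
proof (rule bij_betw_imageI)
  have bij: "bij_betw b (star G2 v) (external G1)" using b by (simp add: gluings_def)
  show "inj_on (glued_half G1 (star G2 v) b) (star G1 w)"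
  proof (rule inj_onI)
    fix d d' assume "glued_half G1 (star G2 v) b d = glued_half G1 (star G2 v) b d'"
    then show "d = d'" using bij
      by (auto simp: glued_half_def bij_betw_def split: if_splits dest: inv_into_injective)
  qed
  show "glued_half G1 (star G2 v) b ` star G1 w = star (insert_graph G1 G2 v b) (Inl w)"
  proof (intro equalityI subsetI)
    fix x assume "x \<in> glued_half G1 (star G2 v) b ` star G1 w"
    then obtain d where d: "d \<in> star G1 w" "x = glued_half G1 (star G2 v) b d" by auto
    show "x \<in> star (insert_graph G1 G2 v b) (Inl w)"
    proof (cases "d \<in> external G1")
      case True
      then obtain e where e: "e \<in> star G2 v" "d = b e" using gluing_image[OF b] by blast
      then show ?thesis using d glued_half_gluing[OF b e(1)] by (auto simp: star_def insert_graph_def)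
    next
      case False
      then show ?thesis using d by (auto simp: glued_half_def star_def insert_graph_def)
    qed
  next
    fix x assume x: "x \<in> star (insert_graph G1 G2 v b) (Inl w)"
    show "x \<in> glued_half G1 (star G2 v) b ` star G1 w"
    proof (cases x)
      case (Inl d)
      then show ?thesis using x
        by (intro image_eqI[of _ _ d]) (auto simp: glued_half_def star_def insert_graph_def)
    next
      case (Inr e)
      then have e: "e \<in> star G2 v" "bdry G1 (b e) = w"
        using x by (auto simp: star_def insert_graph_def split: if_splits)
      then have "b e \<in> star G1 w" using b by (auto simp: star_def dest: gluing_apply)
      then show ?thesis using glued_half_gluing[OF b e(1)] Inr by (intro image_eqI[of _ _ "b e"]) simp_all
    qed
  qed
qed

lemma glued_half_htype:
  assumes b: "b \<in> gluings G1 G2 v"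
  shows "htype (insert_graph G1 G2 v b) (glued_half G1 (star G2 v) b d) = htype G1 d"
proof (cases "d \<in> external G1")
  case True
  then obtain e where e: "e \<in> star G2 v" "d = b e"
    using gluing_image[OF b] by blast
  then show ?thesis using glued_half_gluing[OF b e(1)] b by (simp add: insert_graph_def gluings_def)
qed (simp add: glued_half_def insert_graph_def)

lemma insert_vertex_type_Inl:
  assumes b: "b \<in> gluings G1 G2 v"
  shows "vertex_type (insert_graph G1 G2 v b) (Inl w) = vertex_type G1 w"
proof -
  have "half_types_at (insert_graph G1 G2 v b) (Inl w) = half_types_at G1 w"
    using glued_half_star[OF b, of w] glued_half_htype[OF b] unfolding half_types_at_def bij_betw_def
    by (metis image_mset_iso)
  then show ?thesis by (simp add: vertex_type_def insert_graph_def)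
qed

lemma insert_vertex_type_Inr:
  assumes "w \<noteq> v"
  shows "vertex_type (insert_graph G1 G2 v b) (Inr w) = vertex_type G2 w"
proof -
  have "half_types_at (insert_graph G1 G2 v b) (Inr w) = half_types_at G2 w"
    unfolding half_types_at_def insert_star_Inr[OF assms]
    by (rule image_mset_iso) (simp_all add: insert_graph_def)
  then show ?thesis by (simp add: vertex_type_def insert_graph_def)
qed

lemma insert_graph_of_theory:
  assumes T: "graph_of_theory T G1" "graph_of_theory T G2" and b: "b \<in> gluings G1 G2 v"
  shows "graph_of_theory T (insert_graph G1 G2 v b)"
proof -
  have "vertex_type (insert_graph G1 G2 v b) x \<in> vertex_types T"
    if "x \<in> verts (insert_graph G1 G2 v b)" for x
  proof (cases x)
    case (Inl w)
    then show ?thesis using that T(1)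
      by (auto simp: insert_verts graph_of_theory_def insert_vertex_type_Inl[OF b])
  next
    case (Inr w)
    then have "w \<noteq> v" "w \<in> verts G2" using that by (auto simp: insert_verts)
    then show ?thesis using Inr T(2) by (simp add: graph_of_theory_def insert_vertex_type_Inr)
  qed
  moreover have "htype (insert_graph G1 G2 v b) e \<in> half_edge_types T"
    if "e \<in> halves (insert_graph G1 G2 v b)" for e
    using that T by (auto simp: insert_graph_def graph_of_theory_def)
  ultimately show ?thesis using T insert_graph_wf[OF _ _ b] by (simp add: graph_of_theory_def)
qed

text \<open>
  An edge of the inserted graph is bypassed by a path inside that graph. An edge of the
  surrounding graph is bypassed there, and a path lifts through the connected inserted graph.
\<close>

lemma insert_bridgeless:
  assumes wf: "wf_graph G1" "wf_graph G2" and b: "b \<in> gluings G1 G2 v" and v: "v \<in> verts G2"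
    and c: "connected_graph G1" and br: "bridgeless G1" "bridgeless G2"
  shows "bridgeless (insert_graph G1 G2 v b)"
  unfolding bridgeless_def
proof (intro ballI impI)
  let ?I = "insert_graph G1 G2 v b"
  fix x assume x: "x \<in> halves ?I" "flip ?I x \<noteq> x"
  show "(bdry ?I x, bdry ?I (flip ?I x)) \<in> conn (cut_edge ?I x)"
  proof (cases x)
    case (Inl e)
    then have e: "e \<in> halves G1" "flip G1 e \<noteq> e" using x by (auto simp: insert_graph_def)
    then have "(bdry G1 e, bdry G1 (flip G1 e)) \<in> conn (cut_edge G1 e)"
      using br(1) by (simp add: bridgeless_def)
    then have "(Inl (bdry G1 e), Inl (bdry G1 (flip G1 e))) \<in> conn (cut_edge ?I x)"
    proof (rule conn_map)
      show "Inl ` verts (cut_edge G1 e) \<subseteq> verts (cut_edge ?I x)"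
        by (auto simp: cut_edge_def insert_graph_def)
      fix d assume "d \<in> halves (cut_edge G1 e)"
      then have d: "d \<in> halves G1" by (simp add: cut_edge_def)
      show "(Inl (bdry (cut_edge G1 e) d), Inl (bdry (cut_edge G1 e) (flip (cut_edge G1 e) d)))
          \<in> conn (cut_edge ?I x)"
      proof (cases "flip (cut_edge G1 e) d = d")
        case True
        then show ?thesis using d wf(1)
          by (intro conn_refl[of "Inl (bdry G1 d)", THEN back_subst[of "\<lambda>q. q \<in> conn _"]])
            (auto simp: cut_edge_def insert_graph_def wf_graph_def)
      next
        case False
        then have *: "d \<noteq> e" "d \<noteq> flip G1 e" "flip G1 d \<noteq> d"
          by (auto simp: cut_edge_def split: if_splits)
        then have "Inl d \<in> halves ?I" using d by (auto simp: insert_graph_def external_def)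
        then have "Inl d \<in> halves (cut_edge ?I x)" by (simp add: cut_edge_def)
        from conn_edge[OF wf_cut_edge[OF insert_graph_wf[OF wf b] x(1)] this]
        show ?thesis using * Inl by (simp add: cut_edge_def insert_graph_def)
      qed
    qed
    then show ?thesis using Inl by (simp add: insert_graph_def)
  next
    case (Inr e)
    then have e: "e \<in> halves G2" "flip G2 e \<noteq> e" using x by (auto simp: insert_graph_def)
    have fl: "flip (cut_edge ?I x) = map_sum (flip G1) (flip (cut_edge G2 e))"
    proof
      fix y show "flip (cut_edge ?I x) y = map_sum (flip G1) (flip (cut_edge G2 e)) y"
        using Inr by (cases y) (auto simp: cut_edge_def insert_graph_def)
    qed
    \<comment> \<open>Cutting an edge of the surrounding graph commutes with the insertion.\<close>
    have cut: "cut_edge ?I x = insert_graph G1 (cut_edge G2 e) v b"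
      using fl by (simp add: cut_edge_def insert_graph_def cong: if_cong)
    have b': "b \<in> gluings G1 (cut_edge G2 e) v"
      using b by (simp add: gluings_def star_def cut_edge_def)
    have ends: "bdry ?I x \<in> verts ?I" "bdry ?I (flip ?I x) \<in> verts ?I"
      using insert_graph_wf[OF wf b] x by (simp_all add: wf_graph_def)
    have "(bdry G2 e, bdry G2 (flip G2 e)) \<in> conn (cut_edge G2 e)"
      using br(2) e by (simp add: bridgeless_def)
    then have "(shrink v (bdry ?I x), shrink v (bdry ?I (flip ?I x))) \<in> conn (cut_edge G2 e)"
      using Inr by (auto simp: insert_graph_def)
    then show ?thesis
      unfolding cut using ends v
      by (subst insert_conn_iff[OF wf(1) wf_cut_edge[OF wf(2) e(1)] b' _ c])
        (simp_all add: cut_edge_def insert_graph_def)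
  qed
qed

text \<open>
  The internal edges of the inserted graph belong to the inserted subgraph as well and vanish in
  the contraction; shrinking the inserted graph to \<open>v\<close> then identifies the contraction with
  the one before the insertion. The map on half-edges is \<open>undefined\<close> on the vanished ones.
\<close>

lemma insert_contract_iso:
  assumes wf: "wf_graph G1" "wf_graph G2" and b: "b \<in> gluings G1 G2 v" and v: "v \<in> verts G2"
    and c: "connected_graph G1" and S: "covering_subgraph S G2"
  shows "graph_iso ((`) (shrink v)) (case_sum undefined id)
    (contract (insert_graph G1 G2 v b) (insert_graph G1 S v b) (\<lambda>C. j (shrink v ` C)))
    (contract G2 S j)"
proof (rule contract_iso)
  have wfS: "wf_graph S" and vS: "verts S = verts G2" and hS: "halves S = halves G2"
    using S by (auto simp: covering_subgraph_def)
  have b': "b \<in> gluings G1 S v" using b by (simp add: covering_gluings[OF S])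
  note ne = connected_verts[OF c]
  show wfI: "wf_graph (insert_graph G1 S v b)" by (rule insert_graph_wf[OF wf(1) wfS b'])
  show "shrink v ` verts (insert_graph G1 S v b) = verts S"
    using shrink_verts[OF ne, of v S b] v vS by simp
  show "(x, y) \<in> conn (insert_graph G1 S v b) \<longleftrightarrow> (shrink v x, shrink v y) \<in> conn S"
    if "x \<in> verts (insert_graph G1 S v b)" "y \<in> verts (insert_graph G1 S v b)" for x y
    using insert_conn_iff[OF wf(1) wfS b' _ c that] v vS by simp
  have fixed: "{x \<in> halves (insert_graph G1 G2 v b). flip (insert_graph G1 S v b) x = x} =
      Inr ` {e \<in> halves G2. flip S e = e}"
    by (auto simp: insert_graph_def external_def)
  show "bij_betw (case_sum undefined id)
      {x \<in> halves (insert_graph G1 G2 v b). flip (insert_graph G1 S v b) x = x}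
      {e \<in> halves G2. flip S e = e}"
    unfolding fixed by (rule bij_betw_imageI) (auto simp: inj_on_def image_image)
  fix x assume x: "x \<in> halves (insert_graph G1 G2 v b)" "flip (insert_graph G1 S v b) x = x"
  then obtain e where e: "x = Inr e" "e \<in> halves G2" "flip S e = e" using fixed by blast
  have "bdry (insert_graph G1 G2 v b) x \<in> verts (insert_graph G1 G2 v b)"
    using x insert_graph_wf[OF wf b] by (simp add: wf_graph_def)
  then show "bdry (insert_graph G1 G2 v b) x \<in> verts (insert_graph G1 S v b) \<and>
      bdry G2 (case_sum undefined id x) = shrink v (bdry (insert_graph G1 G2 v b) x) \<and>
      flip G2 (case_sum undefined id x) = case_sum undefined id (flip (insert_graph G1 G2 v b) x) \<and>
      htype G2 (case_sum undefined id x) = htype (insert_graph G1 G2 v b) x"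
    using e vS by (auto simp: insert_graph_def)
qed simp

text \<open>
  By \<open>insert_contract_iso\<close> the residue is that of the surrounding graph, so the specification
  remains admissible.
\<close>

lemma insert_specified:
  assumes X1: "connected_specified T X1" and X2: "specified_graph T X2"
    and v: "v \<in> verts (fst X2)" and b: "b \<in> gluings (fst X1) (fst X2) v"
  shows "specified_graph T (insert_spec X1 X2 v b)"
proof -
  have T: "graph_of_theory T (fst X1)" "graph_of_theory T (fst X2)"
    and br: "bridgeless (fst X1)" "bridgeless (fst X2)"
    and res: "\<forall>C\<in>components (fst X2). vertex_type (residue X2) C \<in> vertex_types T"
    and c: "connected_graph (fst X1)"
    using X1 X2 by (auto simp: specified_graph_iff connected_specified_def)
  have wf: "wf_graph (fst X1)" "wf_graph (fst X2)" using T by (simp_all add: graph_of_theory_def)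
  note wfI = insert_graph_wf[OF wf b]
  have iso: "graph_iso ((`) (shrink v)) (case_sum undefined id)
      (residue (insert_spec X1 X2 v b)) (residue X2)"
    using insert_contract_iso[OF wf b v c covering_subgraph_refl[OF wf(2)], of "snd X2"]
    by (simp add: residue_def insert_spec_def)
  have "vertex_type (residue (insert_spec X1 X2 v b)) C \<in> vertex_types T"
    if C: "C \<in> components (insert_graph (fst X1) (fst X2) v b)" for C
  proof -
    have "vertex_type (residue X2) (shrink v ` C) = vertex_type (residue (insert_spec X1 X2 v b)) C"
      using C wf_contract[OF wfI covering_subgraph_refl[OF wfI]]
      by (intro graph_iso_vertex_type[OF iso]) (simp_all add: residue_def contract_def insert_spec_def)
    moreover have "vertex_type (residue X2) (shrink v ` C) \<in> vertex_types T"
      using res insert_components[OF wf b v c C] by blast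
    ultimately show ?thesis by simp
  qed
  then show ?thesis
    using insert_graph_of_theory[OF T b] insert_bridgeless[OF wf b v c br]
    unfolding specified_graph_iff by (simp add: insert_spec_def)
qed

lemma insert_connected_specified:
  assumes X1: "connected_specified T X1" and X2: "connected_specified T X2"
    and v: "v \<in> verts (fst X2)" and b: "b \<in> gluings (fst X1) (fst X2) v"
  shows "connected_specified T (insert_spec X1 X2 v b)"
  using insert_specified[OF X1 connected_specifiedD(3)[OF X2] v b]
    insert_connected[OF connected_specifiedD(1)[OF X1] connected_specifiedD(1)[OF X2] b v
      connected_specifiedD(2)[OF X1] connected_specifiedD(2)[OF X2]]
  by (simp add: connected_specified_def insert_spec_def)

lemma insert_covering:
  assumes wf: "wf_graph G1" and b: "b \<in> gluings G1 G2 v" and S: "covering_subgraph S G2"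
  shows "covering_subgraph (insert_graph G1 S v b) (insert_graph G1 G2 v b)"
proof -
  have "wf_graph S" using S by (simp add: covering_subgraph_def)
  from insert_graph_wf[OF wf this] have "wf_graph (insert_graph G1 S v b)"
    using b by (simp add: covering_gluings[OF S])
  then show ?thesis using S by (auto simp: covering_subgraph_def insert_graph_def)
qed

text \<open>
  The condition on common components is inherited because a component of the insertion is the
  full preimage of its image under shrinking: an edge of the surrounding graph that ends in
  the image has a counterpart ending in the component itself.
\<close>

lemma insert_spec_pair:
  assumes X1: "connected_specified T X1" and P: "spec_pair T (X2, S)"
    and v: "v \<in> verts (fst X2)" and b: "b \<in> gluings (fst X1) (fst X2) v"
  shows "spec_pair T (insert_spec X1 X2 v b, insert_spec X1 S v b)"
proof -
  let ?I = "insert_graph (fst X1) (fst X2) v b" and ?J = "insert_graph (fst X1) (fst S) v b"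
  have X2: "connected_specified T X2" and S: "specified_graph T S"
    and cov: "covering_subgraph (fst S) (fst X2)"
    and j: "\<And>C. C \<in> components (fst S) \<inter> components (fst X2) \<Longrightarrow>
      (\<forall>e \<in> halves (fst X2). bdry (fst X2) e \<in> C \<longrightarrow> flip (fst S) e = flip (fst X2) e) \<Longrightarrow>
      snd S C = snd X2 C"
    and quo: "connected_specified T (contract_spec X2 S)"
    using P by (auto simp: spec_pair_def specified_covering_subgraph_def)
  note wf = connected_specifiedD(1)[OF X1] connected_specifiedD(1)[OF X2]
    and c = connected_specifiedD(2)[OF X1]
  have wfS: "wf_graph (fst S)" and vS: "verts (fst S) = verts (fst X2)"
    and hS: "halves (fst S) = halves (fst X2)"
    using cov by (auto simp: covering_subgraph_def)
  have bS: "b \<in> gluings (fst X1) (fst S) v" using b by (simp add: covering_gluings[OF cov])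
  have vS': "v \<in> verts (fst S)" using v vS by simp
  note wfI = insert_graph_wf[OF wf b]
  note covI = insert_covering[OF wf(1) b cov]
  note I = insert_connected_specified[OF X1 X2 v b]
  have "snd (insert_spec X1 S v b) C = snd (insert_spec X1 X2 v b) C"
    if C: "C \<in> components ?J \<inter> components ?I"
      and fl: "\<forall>x \<in> halves ?I. bdry ?I x \<in> C \<longrightarrow> flip ?J x = flip ?I x" for C
  proof -
    have "shrink v ` C \<in> components (fst S)" "shrink v ` C \<in> components (fst X2)"
      using C insert_components[OF wf b v c] insert_components[OF wf(1) wfS bS vS' c] by auto
    moreover have "flip (fst S) e = flip (fst X2) e"
      if e: "e \<in> halves (fst X2)" "bdry (fst X2) e \<in> shrink v ` C" for e
    proof -
      have h: "Inr e \<in> halves ?I" and p: "shrink v (bdry ?I (Inr e)) = bdry (fst X2) e"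
        using e by (auto simp: insert_graph_def)
      from e p obtain x where x: "x \<in> C" "shrink v x = shrink v (bdry ?I (Inr e))" by auto
      have xI: "x \<in> verts ?I" using x C component_subset by blast
      have eI: "bdry ?I (Inr e) \<in> verts ?I" using h wfI by (simp add: wf_graph_def)
      have "shrink v x \<in> verts (fst X2)"
        using xI shrink_verts[OF connected_verts[OF c] v] by blast
      then have "(x, bdry ?I (Inr e)) \<in> conn ?I"
        unfolding insert_conn_iff[OF wf b v c xI eI] x(2)[symmetric] by (rule conn_refl)
      then have "bdry ?I (Inr e) \<in> C" using component_closed[OF wfI _ x(1)] C by simp
      then have "flip ?J (Inr e) = flip ?I (Inr e)" using fl h by blast
      then show ?thesis by (simp add: insert_graph_def)
    qed
    ultimately show ?thesis using j by (simp add: insert_spec_def)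
  qed
  then have "specified_covering_subgraph T (insert_spec X1 S v b) (insert_spec X1 X2 v b)"
    using insert_specified[OF X1 S vS' bS] connected_specifiedD(3)[OF I] covI
    unfolding specified_covering_subgraph_def by (simp add: insert_spec_def)
  moreover have "connected_specified T
      (contract_spec (insert_spec X1 X2 v b) (insert_spec X1 S v b))" (is "connected_specified T ?Q")
  proof -
    have "spec_iso ((`) (shrink v)) (case_sum undefined id) ?Q (contract_spec X2 S)"
      using insert_contract_iso[OF wf b v c cov, of "snd S"]
      by (simp add: spec_iso_def contract_spec_def insert_spec_def image_Union image_image)
    moreover have "wf_graph (fst ?Q)"
      using wf_contract[OF wfI covI] by (simp add: contract_spec_def insert_spec_def)
    ultimately show ?thesis using spec_iso_connected_specified[OF spec_iso_sym quo] by blast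
  qed
  ultimately show ?thesis using I by (simp add: spec_pair_def)
qed

lemma essential_verts_iff:
  assumes wf: "wf_graph G"
  shows "v \<in> essential_verts G \<longleftrightarrow> (\<exists>e\<in>halves G. flip G e \<noteq> e \<and> (v, bdry G e) \<in> conn G)"
proof
  assume "v \<in> essential_verts G"
  then show "\<exists>e\<in>halves G. flip G e \<noteq> e \<and> (v, bdry G e) \<in> conn G"
    using component_closed[OF wf] by (auto simp: essential_verts_def)
next
  assume "\<exists>e\<in>halves G. flip G e \<noteq> e \<and> (v, bdry G e) \<in> conn G"
  then obtain e where e: "e \<in> halves G" "flip G e \<noteq> e" "(v, bdry G e) \<in> conn G" by blast
  then have v: "v \<in> verts G" using conn_verts by fast
  then have "conn G `` {v} \<in> components G" by (auto simp: components_def')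
  then show "v \<in> essential_verts G" using e v conn_refl[OF v] unfolding essential_verts_def by blast
qed

text \<open>
  Insertion at an essential vertex creates no new essential component: the only component that
  gains internal edges already had one.
\<close>

lemma insert_essential_verts:
  assumes wf: "wf_graph G1" "wf_graph G2" and b: "b \<in> gluings G1 G2 v"
    and c: "connected_graph G1" and v: "v \<in> essential_verts G2"
  shows "essential_verts (insert_graph G1 G2 v b) =
    Inl ` verts G1 \<union> Inr ` (essential_verts G2 - {v})"
proof -
  let ?I = "insert_graph G1 G2 v b"
  have vG: "v \<in> verts G2" using v by (simp add: essential_verts_def)
  note wfI = insert_graph_wf[OF wf b]
  have bI: "bdry ?I x \<in> verts ?I" if "x \<in> halves ?I" for x using that wfI by (simp add: wf_graph_def)
  have ess: "x \<in> essential_verts ?I \<longleftrightarrow> shrink v x \<in> essential_verts G2" if x: "x \<in> verts ?I" for x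
  proof
    assume "x \<in> essential_verts ?I"
    then obtain h where h: "h \<in> halves ?I" "flip ?I h \<noteq> h" "(x, bdry ?I h) \<in> conn ?I"
      using essential_verts_iff[OF wfI] by blast
    then have p: "(shrink v x, shrink v (bdry ?I h)) \<in> conn G2"
      using insert_conn_iff[OF wf b vG c x bI] by blast
    show "shrink v x \<in> essential_verts G2"
    proof (cases h)
      case (Inl d)
      then have "(shrink v x, v) \<in> conn G2" using p by (simp add: insert_graph_def)
      then show ?thesis using v unfolding essential_verts_iff[OF wf(2)] by (blast intro: conn_trans)
    next
      case (Inr e)
      then have "e \<in> halves G2" "flip G2 e \<noteq> e" "(shrink v x, bdry G2 e) \<in> conn G2"
        using h p by (auto simp: insert_graph_def split: if_splits)
      then show ?thesis unfolding essential_verts_iff[OF wf(2)] by blast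
    qed
  next
    assume "shrink v x \<in> essential_verts G2"
    then obtain e where e: "e \<in> halves G2" "flip G2 e \<noteq> e" "(shrink v x, bdry G2 e) \<in> conn G2"
      unfolding essential_verts_iff[OF wf(2)] by blast
    then have h: "Inr e \<in> halves ?I" "flip ?I (Inr e) \<noteq> Inr e"
      and "shrink v (bdry ?I (Inr e)) = bdry G2 e"
      by (auto simp: insert_graph_def)
    then have "(x, bdry ?I (Inr e)) \<in> conn ?I"
      using e insert_conn_iff[OF wf b vG c x bI[OF h(1)]] by simp
    then show "x \<in> essential_verts ?I" using h unfolding essential_verts_iff[OF wfI] by blast
  qed
  have sub: "essential_verts ?I \<subseteq> verts ?I" "essential_verts G2 \<subseteq> verts G2"
    by (auto simp: essential_verts_def)
  have V: "verts ?I = Inl ` verts G1 \<union> Inr ` (verts G2 - {v})"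
    by (auto simp: insert_graph_def)
  show ?thesis
  proof (rule set_eqI)
    fix x show "x \<in> essential_verts ?I \<longleftrightarrow> x \<in> Inl ` verts G1 \<union> Inr ` (essential_verts G2 - {v})"
      using ess[of x] sub V v by (cases x) auto
  qed
qed

section \<open>Gluings in an iterated insertion\<close>

lemma gluings_eqI:
  assumes "b \<in> gluings G1 G2 v" "b' \<in> gluings G1 G2 v" "\<And>e. e \<in> star G2 v \<Longrightarrow> b e = b' e"
  shows "b = b'"
  using assms by (auto simp: gluings_def intro: PiE_ext)

text \<open>
  The gluings depend only on the typed sets of half-edges that are glued. This makes
  the gluings at a vertex comparable before and after another insertion.
\<close>

lemma transport_gluing_bij_stars:
  assumes g1: "bij_betw g1 (external G1) (external H1)"
    and t1: "\<And>d. d \<in> external G1 \<Longrightarrow> htype H1 (g1 d) = htype G1 d"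
    and g2: "bij_betw g2 (star G2 v) (star H2 v')"
    and t2: "\<And>e. e \<in> star G2 v \<Longrightarrow> htype H2 (g2 e) = htype G2 e"
  shows "bij_betw (transport_gluing g1 g2 (star G2 v)) (gluings G1 G2 v) (gluings H1 H2 v')"
proof (rule bij_betw_imageI)
  let ?t = "transport_gluing g1 g2 (star G2 v)"
  have inj: "inj_on g2 (star G2 v)" "inj_on g1 (external G1)" and st: "star H2 v' = g2 ` star G2 v"
    and ex: "external H1 = g1 ` external G1"
    using g1 g2 by (auto simp: bij_betw_def)
  have app: "?t b (g2 e) = g1 (b e)" if "e \<in> star G2 v" for e b
    by (rule transport_gluing_apply[OF inj(1) that])
  have mem: "?t b \<in> gluings H1 H2 v'" if b: "b \<in> gluings G1 G2 v" for b
  proof -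
    have bb: "bij_betw b (star G2 v) (external G1)"
      "\<And>e. e \<in> star G2 v \<Longrightarrow> htype G1 (b e) = htype G2 e" using b by (auto simp: gluings_def)
    have be: "b e \<in> external G1" if "e \<in> star G2 v" for e using bij_betw_apply[OF bb(1) that] .
    have "bij_betw (g1 \<circ> b \<circ> inv_into (star G2 v) g2) (star H2 v') (external H1)"
      using bij_betw_trans[OF bij_betw_inv_into[OF g2] bij_betw_trans[OF bb(1) g1]]
      by (simp add: comp_assoc)
    then have "bij_betw (?t b) (star H2 v') (external H1)"
      by (rule bij_betw_cong[THEN iffD1, rotated]) (simp add: transport_gluing_def st)
    moreover from bij_betw_apply[OF this] have "?t b \<in> star H2 v' \<rightarrow>\<^sub>E external H1"
      by (auto simp: PiE_def transport_gluing_def extensional_def st)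
    moreover have "htype H1 (?t b x) = htype H2 x" if "x \<in> star H2 v'" for x
      using that bb(2) be by (auto simp: st app t1 t2)
    ultimately show ?thesis by (simp add: gluings_def)
  qed
  show "inj_on ?t (gluings G1 G2 v)"
  proof (rule inj_onI)
    fix b b' assume b: "b \<in> gluings G1 G2 v" "b' \<in> gluings G1 G2 v" "?t b = ?t b'"
    show "b = b'"
    proof (rule gluings_eqI[OF b(1,2)])
      fix e assume e: "e \<in> star G2 v"
      have "g1 (b e) = g1 (b' e)" using app[OF e, of b] app[OF e, of b'] b(3) by simp
      moreover have "b e \<in> external G1" "b' e \<in> external G1"
        using e gluing_image[OF b(1)] gluing_image[OF b(2)] by auto
      ultimately show "b e = b' e" using inj(2) by (simp add: inj_on_eq_iff)
    qed
  qed
  show "?t ` gluings G1 G2 v = gluings H1 H2 v'"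
  proof (intro equalityI subsetI)
    fix c assume c: "c \<in> gluings H1 H2 v'"
    then have cc: "bij_betw c (star H2 v') (external H1)"
      "\<And>x. x \<in> star H2 v' \<Longrightarrow> htype H1 (c x) = htype H2 x" by (auto simp: gluings_def)
    define b where "b = restrict (\<lambda>e. inv_into (external G1) g1 (c (g2 e))) (star G2 v)"
    have ce: "c (g2 e) \<in> g1 ` external G1" if "e \<in> star G2 v" for e
      using bij_betw_apply[OF cc(1), of "g2 e"] that by (simp add: st ex)
    have gb: "g1 (b e) = c (g2 e)" and be: "b e \<in> external G1" if "e \<in> star G2 v" for e
      using that f_inv_into_f[OF ce[OF that]] inv_into_into[OF ce[OF that]] by (simp_all add: b_def)
    have "bij_betw (inv_into (external G1) g1 \<circ> c \<circ> g2) (star G2 v) (external G1)"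
      using bij_betw_trans[OF g2 bij_betw_trans[OF cc(1) bij_betw_inv_into[OF g1]]]
      by (simp add: comp_assoc)
    then have "bij_betw b (star G2 v) (external G1)"
      by (rule bij_betw_cong[THEN iffD1, rotated]) (simp add: b_def)
    moreover have "htype G1 (b e) = htype G2 e" if e: "e \<in> star G2 v" for e
    proof -
      have "htype G1 (b e) = htype H1 (c (g2 e))" using t1[OF be[OF e]] gb[OF e] by simp
      also have "\<dots> = htype G2 e" using cc(2)[of "g2 e"] t2[OF e] e st by simp
      finally show ?thesis .
    qed
    ultimately have b: "b \<in> gluings G1 G2 v"
      using be by (auto simp: gluings_def PiE_def b_def extensional_def)
    have "?t b = c"
    proof (rule gluings_eqI[OF mem[OF b] c])
      fix x assume "x \<in> star H2 v'"
      then show "?t b x = c x" using gb app by (auto simp: st)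
    qed
    then show "c \<in> ?t ` gluings G1 G2 v" using b by blast
  qed (use mem in auto)
qed

text \<open>
  The three comparisons needed for two successive insertions: at a vertex that was there before,
  at a vertex of the graph inserted first, and of a composite graph, whose external edges are
  those of its outer part.
\<close>

lemma insert_gluings_old_vertex:
  assumes "w \<noteq> v"
  shows "bij_betw (transport_gluing id Inr (star G3 w)) (gluings G1 G3 w)
    (gluings G1 (insert_graph G2 G3 v b) (Inr w))"
  using assms
  by (intro transport_gluing_bij_stars)
    (simp_all add: insert_star_Inr bij_betw_def inj_on_def, simp add: insert_graph_def)

lemma insert_gluings_new_vertex:
  assumes b: "b \<in> gluings G2 G3 v"
  shows "bij_betw (transport_gluing id (glued_half G2 (star G3 v) b) (star G2 w)) (gluings G1 G2 w)
    (gluings G1 (insert_graph G2 G3 v b) (Inl w))"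
  by (intro transport_gluing_bij_stars glued_half_star[OF b]) (simp_all add: glued_half_htype[OF b])

lemma insert_gluings_composite:
  "bij_betw (transport_gluing Inr id (star G3 v)) (gluings G2 G3 v)
    (gluings (insert_graph G1 G2 w c) G3 v)"
  by (intro transport_gluing_bij_stars)
    (simp_all add: insert_external bij_betw_def inj_on_def, simp add: insert_graph_def)

section \<open>Associativity and commutation of insertions\<close>

fun sum_assoc :: "'a + ('b + 'c) \<Rightarrow> ('a + 'b) + 'c" where
  "sum_assoc (Inl x) = Inl (Inl x)"
| "sum_assoc (Inr (Inl y)) = Inl (Inr y)"
| "sum_assoc (Inr (Inr z)) = Inr z"

fun sum_swap :: "'a + ('b + 'c) \<Rightarrow> 'b + ('a + 'c)" where
  "sum_swap (Inl x) = Inr (Inl x)"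
| "sum_swap (Inr (Inl y)) = Inl y"
| "sum_swap (Inr (Inr z)) = Inr (Inr z)"

lemma bij_betw_sum_assoc: "bij_betw sum_assoc (A <+> (B <+> C)) ((A <+> B) <+> C)"
proof (rule bij_betw_imageI)
  show "inj_on sum_assoc (A <+> (B <+> C))" by (auto simp: inj_on_def)
  show "sum_assoc ` (A <+> (B <+> C)) = (A <+> B) <+> C"
    by (simp add: Plus_def image_Un image_image Un_assoc)
qed

lemma bij_betw_sum_swap: "bij_betw sum_swap (A <+> (B <+> C)) (B <+> (A <+> C))"
proof (rule bij_betw_imageI)
  show "inj_on sum_swap (A <+> (B <+> C))" by (auto simp: inj_on_def)
  show "sum_swap ` (A <+> (B <+> C)) = B <+> (A <+> C)"
    by (simp add: Plus_def image_Un image_image Un_ac)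
qed

text \<open>
  Inserting into a vertex of the graph that was inserted last is inserting a composite graph.
  The half-edges of the middle graph that were glued to the outer one are represented on the outer
  side in one case and on the middle side in the other; \<open>glued_half\<close> translates between the two.
\<close>

lemma insert_graph_assoc:
  assumes b: "b \<in> gluings G2 G3 v" and c: "c \<in> gluings G1 G2 w"
  shows "graph_iso sum_assoc sum_assoc
    (insert_graph G1 (insert_graph G2 G3 v b) (Inl w)
      (transport_gluing id (glued_half G2 (star G3 v) b) (star G2 w) c))
    (insert_graph (insert_graph G1 G2 w c) G3 v (transport_gluing Inr id (star G3 v) b))"
    (is "graph_iso _ _ (insert_graph _ ?I _ ?c) (insert_graph ?J _ _ ?b)")
proof -
  let ?L = "insert_graph G1 ?I (Inl w) ?c" and ?R = "insert_graph ?J G3 v ?b"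
  have inj: "inj_on (glued_half G2 (star G3 v) b) (star G2 w)"
    using glued_half_star[OF b] by (simp add: bij_betw_def)
  have c_glued: "?c (glued_half G2 (star G3 v) b d) = c d" if "d \<in> halves G2" "bdry G2 d = w" for d
    using transport_gluing_apply[OF inj, of d id c] that by (simp add: star_def)
  have c_Inl: "?c (Inl d) = c d" if "d \<in> halves G2 - external G2" "bdry G2 d = w" for d
    using c_glued[of d] that by (simp add: glued_half_def)
  have c_Inr: "?c (Inr e) = c (b e)" if "e \<in> halves G3" "bdry G3 e = v" "bdry G2 (b e) = w" for e
    using c_glued[of "b e"] glued_half_gluing[OF b, of e] gluing_apply[OF b that(1,2)] that
    by (simp add: star_def)
  have b_eq: "?b e = Inr (b e)" if "e \<in> halves G3" "bdry G3 e = v" for e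
    using transport_gluing_apply[of id "star G3 v" e Inr b] that by (simp add: star_def)
  have "verts ?L = verts G1 <+> ((verts G2 - {w}) <+> (verts G3 - {v}))"
    by (auto simp: insert_graph_def)
  moreover have "verts ?R = (verts G1 <+> (verts G2 - {w})) <+> (verts G3 - {v})"
    by (simp add: insert_graph_def)
  ultimately have V: "bij_betw sum_assoc (verts ?L) (verts ?R)" by (simp only: bij_betw_sum_assoc)
  have hL: "halves ?L = (halves G1 - external G1) <+> ((halves G2 - external G2) <+> halves G3)"
    by (simp add: insert_graph_def)
  have "halves ?J - external ?J = (halves G1 - external G1) <+> (halves G2 - external G2)"
    unfolding insert_external by (auto simp: insert_graph_def)
  then have "halves ?R = ((halves G1 - external G1) <+> (halves G2 - external G2)) <+> halves G3"
    by (simp add: insert_graph_def)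
  then have H: "bij_betw sum_assoc (halves ?L) (halves ?R)" by (simp only: hL bij_betw_sum_assoc)
  have "bdry ?R (sum_assoc x) = sum_assoc (bdry ?L x) \<and> flip ?R (sum_assoc x) = sum_assoc (flip ?L x) \<and>
      htype ?R (sum_assoc x) = htype ?L x" if x: "x \<in> halves ?L" for x
  proof (cases x rule: sum_assoc.cases)
    case (1 d)
    then show ?thesis by (simp add: insert_graph_def)
  next
    case (2 d)
    then have "d \<in> halves G2 - external G2" using x unfolding hL by auto
    then show ?thesis using 2 c_Inl[of d] by (simp add: insert_graph_def)
  next
    case (3 e)
    then have e: "e \<in> halves G3" using x unfolding hL by auto
    show ?thesis using 3 c_Inr[OF e] b_eq[OF e] by (simp add: insert_graph_def)
  qed
  moreover have "vindex ?R (sum_assoc x) = vindex ?L x" for x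
    by (cases x rule: sum_assoc.cases) (simp_all add: insert_graph_def)
  ultimately show ?thesis using V H by (simp add: graph_iso_def)
qed

text \<open>
  At distinct vertices neither insertion changes the half-edges seen by the other one.
\<close>

lemma insert_graph_swap:
  assumes vw: "v \<noteq> w"
  shows "graph_iso sum_swap sum_swap
    (insert_graph G1 (insert_graph G2 G3 v b) (Inr w) (transport_gluing id Inr (star G3 w) c))
    (insert_graph G2 (insert_graph G1 G3 w c) (Inr v) (transport_gluing id Inr (star G3 v) b))"
    (is "graph_iso _ _ ?L ?R")
proof -
  have tr: "transport_gluing id Inr (star G3 u) a (Inr e) = a e"
    if "e \<in> halves G3" "bdry G3 e = u" for u e and a :: "_ \<Rightarrow> 'z"
    using transport_gluing_apply[of Inr "star G3 u" e id a] that by (simp add: star_def inj_on_def)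
  have "verts ?L = verts G1 <+> (verts G2 <+> (verts G3 - {v, w}))"
    "verts ?R = verts G2 <+> (verts G1 <+> (verts G3 - {v, w}))"
    by (auto simp: insert_graph_def)
  then have V: "bij_betw sum_swap (verts ?L) (verts ?R)" by (simp only: bij_betw_sum_swap)
  have hL: "halves ?L = (halves G1 - external G1) <+> ((halves G2 - external G2) <+> halves G3)"
    and hR: "halves ?R = (halves G2 - external G2) <+> ((halves G1 - external G1) <+> halves G3)"
    by (simp_all add: insert_graph_def)
  have H: "bij_betw sum_swap (halves ?L) (halves ?R)" by (simp only: hL hR bij_betw_sum_swap)
  have "bdry ?R (sum_swap x) = sum_swap (bdry ?L x) \<and> flip ?R (sum_swap x) = sum_swap (flip ?L x) \<and>
      htype ?R (sum_swap x) = htype ?L x" if x: "x \<in> halves ?L" for x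
  proof (cases x rule: sum_swap.cases)
    case (3 e)
    then have e: "e \<in> halves G3" using x unfolding hL by auto
    show ?thesis using 3 vw by (simp add: insert_graph_def tr[OF e])
  qed (simp_all add: insert_graph_def)
  moreover have "vindex ?R (sum_swap x) = vindex ?L x" for x
    by (cases x rule: sum_swap.cases) (simp_all add: insert_graph_def)
  ultimately show ?thesis using V H by (simp add: graph_iso_def)
qed

lemma shrink_sum_assoc: "shrink v (sum_assoc x) = shrink v (shrink (Inl w) x)"
  by (cases x rule: sum_assoc.cases) simp_all

lemma shrink_sum_swap: "shrink w (shrink (Inr v) (sum_swap x)) = shrink v (shrink (Inr w) x)"
  by (cases x rule: sum_swap.cases) simp_all

lemma insert_spec_assoc:
  assumes "b \<in> gluings (fst X2) (fst X3) v" "c \<in> gluings (fst X1) (fst X2) w"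
  shows "spec_iso sum_assoc sum_assoc
    (insert_spec X1 (insert_spec X2 X3 v b) (Inl w)
      (transport_gluing id (glued_half (fst X2) (star (fst X3) v) b) (star (fst X2) w) c))
    (insert_spec (insert_spec X1 X2 w c) X3 v (transport_gluing Inr id (star (fst X3) v) b))"
  using insert_graph_assoc[OF assms]
  by (simp add: spec_iso_def insert_spec_def image_image shrink_sum_assoc[of v _ w])

lemma insert_spec_swap:
  assumes vw: "v \<noteq> w"
  shows "spec_iso sum_swap sum_swap
    (insert_spec X1 (insert_spec X2 X3 v b) (Inr w) (transport_gluing id Inr (star (fst X3) w) c))
    (insert_spec X2 (insert_spec X1 X3 w c) (Inr v) (transport_gluing id Inr (star (fst X3) v) b))"
  by (simp add: spec_iso_def insert_spec_def image_image shrink_sum_swap insert_graph_swap[OF vw])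

section \<open>The associator of the insertion sums\<close>

text \<open>
  The common form of the two operations. For the module, \<open>A\<close> consists of the essential
  vertices; for the algebra, the pair is \<open>(X, X)\<close> and \<open>A\<close> consists of all vertices. The function
  \<open>\<Phi>\<close> sends the class of a pair to the basis vector that it contributes.
\<close>

definition insert_pair ::
  "('v, 'h, 't) spec_graph \<Rightarrow> ('w, 'g, 't) spec_graph \<times> ('w, 'g, 't) spec_graph \<Rightarrow> 'w \<Rightarrow> ('g \<Rightarrow> 'h) \<Rightarrow>
     ('v + 'w, 'h + 'g, 't) spec_graph \<times> ('v + 'w, 'h + 'g, 't) spec_graph" where
  "insert_pair X1 P v b = (insert_spec X1 (fst P) v b, insert_spec X1 (snd P) v b)"

definition insertion_sites :: "('v, 'h, 't) spec_graph \<Rightarrow> ('w, 'g, 't) fgraph \<Rightarrow> 'w set \<Rightarrow> 'w set" where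
  "insertion_sites X1 G A = {v \<in> A. vertex_type G v = residue_type X1}"

definition insertion_sum_over ::
  "('t pair_class \<Rightarrow> 'm::ab_group_add) \<Rightarrow> ('v, 'h, 't) spec_graph \<Rightarrow>
     ('w, 'g, 't) spec_graph \<times> ('w, 'g, 't) spec_graph \<Rightarrow> 'w set \<Rightarrow> 'm" where
  "insertion_sum_over \<Phi> X1 P A = (\<Sum>v\<in>insertion_sites X1 (fst (fst P)) A.
     \<Sum>b\<in>gluings (fst X1) (fst (fst P)) v. \<Phi> (pair_class (insert_pair X1 P v b)))"

text \<open>
  The vertices at which the second insertion may take place: those of the graph inserted first,
  and the remaining ones of \<open>A\<close>. Both all vertices and essential vertices evolve in this way.
\<close>

definition sites_after :: "('v, 'h, 't) fgraph \<Rightarrow> 'w set \<Rightarrow> 'w \<Rightarrow> ('v + 'w) set" where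
  "sites_after G A v = Inl ` verts G \<union> Inr ` (A - {v})"

text \<open>
  A composite graph has the external edges and the specification of its outer part, hence it fits
  into the same vertices.
\<close>

lemma insert_residue_type:
  assumes X: "wf_graph (fst X1)" "connected_graph (fst X1)" "wf_graph (fst X2)" "connected_graph (fst X2)"
    and v: "v \<in> verts (fst X2)" and b: "b \<in> gluings (fst X1) (fst X2) v"
  shows "residue_type (insert_spec X1 X2 v b) = residue_type X2"
proof -
  let ?I = "insert_graph (fst X1) (fst X2) v b"
  have "image_mset (htype ?I) (mset_set (external ?I)) =
      image_mset (htype (fst X2)) (mset_set (external (fst X2)))"
    unfolding insert_external by (rule image_mset_iso) (simp_all add: insert_graph_def)
  moreover have "snd (insert_spec X1 X2 v b) (verts ?I) = snd X2 (verts (fst X2))"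
    using shrink_verts[OF connected_verts[OF X(2)] v, of b] by (simp add: insert_spec_def)
  moreover have "wf_graph ?I" "connected_graph ?I"
    using insert_graph_wf[OF X(1,3) b] insert_connected[OF X(1,3) b v X(2,4)] by simp_all
  ultimately show ?thesis
    using residue_type_alt[OF X(4,3)] residue_type_alt[of "insert_spec X1 X2 v b"]
    by (simp add: insert_spec_def)
qed

text \<open>
  An insertion into the graph inserted first is rewritten as the insertion of a composite graph;
  the other insertions take place at a second vertex of the surrounding graph.
\<close>

lemma iterated_insertion_split:
  fixes \<Phi> :: "'t pair_class \<Rightarrow> 'm::ab_group_add"
  assumes wf: "wf_graph (fst X1)" "wf_graph (fst X2)" "wf_graph (fst X3)"
    and S: "covering_subgraph (fst S) (fst X3)" and A: "finite A"
    and v: "v \<in> A" and b: "b \<in> gluings (fst X2) (fst X3) v"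
  shows "insertion_sum_over \<Phi> X1 (insert_pair X2 (X3, S) v b) (sites_after (fst X2) A v) =
    (\<Sum>w\<in>insertion_sites X1 (fst X2) (verts (fst X2)). \<Sum>c\<in>gluings (fst X1) (fst X2) w.
       \<Phi> (pair_class (insert_pair (insert_spec X1 X2 w c) (X3, S) v
         (transport_gluing Inr id (star (fst X3) v) b)))) +
    (\<Sum>w\<in>insertion_sites X1 (fst X3) (A - {v}). \<Sum>c\<in>gluings (fst X1) (fst X3) w.
       \<Phi> (pair_class (insert_pair X1 (insert_pair X2 (X3, S) v b) (Inr w)
         (transport_gluing id Inr (star (fst X3) w) c))))"
proof -
  let ?I = "insert_graph (fst X2) (fst X3) v b"
  let ?F = "\<lambda>x a. \<Phi> (pair_class (insert_pair X1 (insert_pair X2 (X3, S) v b) x a))"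
  let ?V = "insertion_sites X1 (fst X2) (verts (fst X2))"
  let ?W = "insertion_sites X1 (fst X3) (A - {v})"
  have vis: "w \<noteq> v" if "w \<in> ?W" for w using that by (simp add: insertion_sites_def)
  have sites: "insertion_sites X1 ?I (sites_after (fst X2) A v) = Inl ` ?V \<union> Inr ` ?W"
    by (auto simp: insertion_sites_def sites_after_def insert_vertex_type_Inl[OF b] insert_vertex_type_Inr)
  have fin: "finite ?V" "finite ?W" using wf A by (auto simp: insertion_sites_def wf_graph_def)
  have stS: "star (fst S) = star (fst X3)" and wfS: "wf_graph (fst S)"
    and vS: "verts (fst S) = verts (fst X3)" and hS: "halves (fst S) = halves (fst X3)"
    using S by (auto simp: covering_star covering_subgraph_def)
  have bS: "b \<in> gluings (fst X2) (fst S) v" using b by (simp add: covering_gluings[OF S])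
  have new: "(\<Sum>a\<in>gluings (fst X1) ?I (Inl w). ?F (Inl w) a) =
      (\<Sum>c\<in>gluings (fst X1) (fst X2) w. \<Phi> (pair_class (insert_pair (insert_spec X1 X2 w c) (X3, S) v
         (transport_gluing Inr id (star (fst X3) v) b))))" for w
  proof -
    let ?t = "transport_gluing id (glued_half (fst X2) (star (fst X3) v) b) (star (fst X2) w)"
    have "?F (Inl w) (?t c) = \<Phi> (pair_class (insert_pair (insert_spec X1 X2 w c) (X3, S) v
         (transport_gluing Inr id (star (fst X3) v) b)))" if c: "c \<in> gluings (fst X1) (fst X2) w" for c
    proof -
      have "?t c \<in> gluings (fst X1) ?I (Inl w)"
        using bij_betw_apply[OF insert_gluings_new_vertex[OF b] c] .
      moreover have "?t c \<in> gluings (fst X1) (insert_graph (fst X2) (fst S) v b) (Inl w)"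
        using bij_betw_apply[OF insert_gluings_new_vertex[OF bS] c] stS by simp
      moreover have "wf_graph ?I" "wf_graph (insert_graph (fst X2) (fst S) v b)"
        using insert_graph_wf[OF wf(2,3) b] insert_graph_wf[OF wf(2) wfS bS] by simp_all
      ultimately have wfI: "wf_graph (insert_graph (fst X1) ?I (Inl w) (?t c))"
        "wf_graph (insert_graph (fst X1) (insert_graph (fst X2) (fst S) v b) (Inl w) (?t c))"
        by (simp_all add: insert_graph_wf[OF wf(1)])
      have "pair_class (insert_spec X1 (insert_spec X2 X3 v b) (Inl w) (?t c),
            insert_spec X1 (insert_spec X2 S v b) (Inl w) (?t c)) =
          pair_class (insert_spec (insert_spec X1 X2 w c) X3 v (transport_gluing Inr id (star (fst X3) v) b),
            insert_spec (insert_spec X1 X2 w c) S v (transport_gluing Inr id (star (fst X3) v) b))"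
      proof (rule pair_class_eqI[OF insert_spec_assoc[OF b c]
            insert_spec_assoc[OF bS c, unfolded stS]])
        show "wf_graph (fst (insert_spec X1 (insert_spec X2 X3 v b) (Inl w) (?t c)))"
          "wf_graph (fst (insert_spec X1 (insert_spec X2 S v b) (Inl w) (?t c)))"
          using wfI by (simp_all add: insert_spec_def)
      qed (simp_all add: insert_spec_def insert_graph_def vS hS)
      then show ?thesis by (simp add: insert_pair_def)
    qed
    then show ?thesis
      by (subst sum.reindex_bij_betw[OF insert_gluings_new_vertex[OF b], symmetric]) simp
  qed
  have old: "(\<Sum>a\<in>gluings (fst X1) ?I (Inr w). ?F (Inr w) a) =
      (\<Sum>c\<in>gluings (fst X1) (fst X3) w. ?F (Inr w) (transport_gluing id Inr (star (fst X3) w) c))"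
    if "w \<in> ?W" for w
    by (rule sum.reindex_bij_betw[OF insert_gluings_old_vertex[OF vis[OF that]], symmetric])
  have fI: "fst (fst (insert_pair X2 (X3, S) v b)) = ?I" by (simp add: insert_pair_def insert_spec_def)
  have "insertion_sum_over \<Phi> X1 (insert_pair X2 (X3, S) v b) (sites_after (fst X2) A v) =
      (\<Sum>x\<in>Inl ` ?V \<union> Inr ` ?W. \<Sum>a\<in>gluings (fst X1) ?I x. ?F x a)"
    unfolding insertion_sum_over_def fI sites ..
  also have "\<dots> = (\<Sum>x\<in>Inl ` ?V. \<Sum>a\<in>gluings (fst X1) ?I x. ?F x a) +
      (\<Sum>x\<in>Inr ` ?W. \<Sum>a\<in>gluings (fst X1) ?I x. ?F x a)"
    using fin by (intro sum.union_disjoint) auto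
  also have "\<dots> = (\<Sum>w\<in>?V. \<Sum>a\<in>gluings (fst X1) ?I (Inl w). ?F (Inl w) a) +
      (\<Sum>w\<in>?W. \<Sum>a\<in>gluings (fst X1) ?I (Inr w). ?F (Inr w) a)"
    by (simp add: sum.reindex)
  finally show ?thesis by (simp add: new old)
qed

text \<open>
  The simultaneous insertions of two graphs at distinct vertices of a third one.
\<close>

definition disjoint_insertion_sum ::
  "('t pair_class \<Rightarrow> 'm::ab_group_add) \<Rightarrow> ('u, 'f, 't) spec_graph \<Rightarrow> ('v, 'h, 't) spec_graph \<Rightarrow>
     ('w, 'g, 't) spec_graph \<times> ('w, 'g, 't) spec_graph \<Rightarrow> 'w set \<Rightarrow> 'm" where
  "disjoint_insertion_sum \<Phi> X1 X2 P A = (let G = fst (fst P) in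
     \<Sum>v\<in>insertion_sites X2 G A. \<Sum>w\<in>insertion_sites X1 G (A - {v}).
       \<Sum>b\<in>gluings (fst X2) G v. \<Sum>c\<in>gluings (fst X1) G w.
         \<Phi> (pair_class (insert_pair X1 (insert_pair X2 P v b) (Inr w)
           (transport_gluing id Inr (star G w) c))))"

lemma disjoint_insertion_sum_commute:
  fixes \<Phi> :: "'t pair_class \<Rightarrow> 'm::ab_group_add"
  assumes wf: "wf_graph (fst X1)" "wf_graph (fst X2)" "wf_graph (fst X3)"
    and S: "covering_subgraph (fst S) (fst X3)" and A: "finite A"
  shows "disjoint_insertion_sum \<Phi> X1 X2 (X3, S) A = disjoint_insertion_sum \<Phi> X2 X1 (X3, S) A"
proof -
  let ?t = "\<lambda>w c. transport_gluing id Inr (star (fst X3) w) c"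
  let ?F = "\<lambda>v w b c. \<Phi> (pair_class (insert_pair X1 (insert_pair X2 (X3, S) v b) (Inr w) (?t w c)))"
  let ?F' = "\<lambda>v w b c. \<Phi> (pair_class (insert_pair X2 (insert_pair X1 (X3, S) w c) (Inr v) (?t v b)))"
  let ?V = "insertion_sites X2 (fst X3) A" and ?W = "insertion_sites X1 (fst X3) A"
  have stS: "star (fst S) = star (fst X3)" and wfS: "wf_graph (fst S)"
    and vS: "verts (fst S) = verts (fst X3)" and hS: "halves (fst S) = halves (fst X3)"
    using S by (auto simp: covering_star covering_subgraph_def)
  have eq: "?F v w b c = ?F' v w b c"
    if vw: "v \<noteq> w" and b: "b \<in> gluings (fst X2) (fst X3) v" and c: "c \<in> gluings (fst X1) (fst X3) w"
    for v w b c
  proof -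
    have bS: "b \<in> gluings (fst X2) (fst S) v" and cS: "c \<in> gluings (fst X1) (fst S) w"
      using b c by (simp_all add: covering_gluings[OF S])
    have "?t w c \<in> gluings (fst X1) (insert_graph (fst X2) (fst X3) v b) (Inr w)"
      "?t w c \<in> gluings (fst X1) (insert_graph (fst X2) (fst S) v b) (Inr w)"
      using bij_betw_apply[OF insert_gluings_old_vertex[OF vw[symmetric]] c]
        bij_betw_apply[OF insert_gluings_old_vertex[OF vw[symmetric]] cS, unfolded stS] by blast+
    then have wfI: "wf_graph (fst (insert_spec X1 (insert_spec X2 X3 v b) (Inr w) (?t w c)))"
      "wf_graph (fst (insert_spec X1 (insert_spec X2 S v b) (Inr w) (?t w c)))"
      by (simp_all add: insert_spec_def insert_graph_wf wf wfS b bS)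
    have "pair_class (insert_spec X1 (insert_spec X2 X3 v b) (Inr w) (?t w c),
          insert_spec X1 (insert_spec X2 S v b) (Inr w) (?t w c)) =
        pair_class (insert_spec X2 (insert_spec X1 X3 w c) (Inr v) (?t v b),
          insert_spec X2 (insert_spec X1 S w c) (Inr v) (?t v b))"
      by (rule pair_class_eqI[OF insert_spec_swap[OF vw] insert_spec_swap[OF vw, of _ _ S, unfolded stS] wfI])
        (simp_all add: insert_spec_def insert_graph_def vS hS)
    then show ?thesis by (simp add: insert_pair_def)
  qed
  have fin: "finite ?V" "finite ?W" using A by (simp_all add: insertion_sites_def)
  have minus: "insertion_sites X (fst X3) (A - {v}) = {w \<in> insertion_sites X (fst X3) A. w \<noteq> v}"
    for v and X :: "('x, 'y, 't) spec_graph"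
    by (auto simp: insertion_sites_def)
  have "disjoint_insertion_sum \<Phi> X1 X2 (X3, S) A = (\<Sum>v\<in>?V. \<Sum>w\<in>{w\<in>?W. w \<noteq> v}.
      \<Sum>b\<in>gluings (fst X2) (fst X3) v. \<Sum>c\<in>gluings (fst X1) (fst X3) w. ?F v w b c)"
    by (simp only: disjoint_insertion_sum_def Let_def fst_conv minus)
  also have "\<dots> = (\<Sum>w\<in>?W. \<Sum>v\<in>{v\<in>?V. w \<noteq> v}.
      \<Sum>b\<in>gluings (fst X2) (fst X3) v. \<Sum>c\<in>gluings (fst X1) (fst X3) w. ?F v w b c)"
    by (rule sum.swap_restrict[OF fin])
  also have "\<dots> = (\<Sum>w\<in>?W. \<Sum>v\<in>{v\<in>?V. v \<noteq> w}.
      \<Sum>c\<in>gluings (fst X1) (fst X3) w. \<Sum>b\<in>gluings (fst X2) (fst X3) v. ?F' v w b c)"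
  proof (intro sum.cong refl)
    fix w v assume "v \<in> {v \<in> ?V. v \<noteq> w}"
    then have "v \<noteq> w" by simp
    then have "(\<Sum>b\<in>gluings (fst X2) (fst X3) v. \<Sum>c\<in>gluings (fst X1) (fst X3) w. ?F v w b c) =
        (\<Sum>b\<in>gluings (fst X2) (fst X3) v. \<Sum>c\<in>gluings (fst X1) (fst X3) w. ?F' v w b c)"
      by (intro sum.cong refl eq)
    then show "(\<Sum>b\<in>gluings (fst X2) (fst X3) v. \<Sum>c\<in>gluings (fst X1) (fst X3) w. ?F v w b c) =
        (\<Sum>c\<in>gluings (fst X1) (fst X3) w. \<Sum>b\<in>gluings (fst X2) (fst X3) v. ?F' v w b c)"
      by (simp only: sum.swap[of _ "gluings (fst X1) (fst X3) w"])
  qed auto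
  also have "\<dots> = disjoint_insertion_sum \<Phi> X2 X1 (X3, S) A"
    by (simp only: disjoint_insertion_sum_def Let_def fst_conv minus)
  finally show ?thesis .
qed

text \<open>
  The insertions of the first graph into the second one are exactly those produced by inserting
  their composites, and only the simultaneous insertions are left. This is the reason for the
  pre-Lie identity.
\<close>

lemma insertion_associator:
  fixes \<Phi> :: "'t pair_class \<Rightarrow> 'm::ab_group_add"
  assumes X1: "wf_graph (fst X1)" "connected_graph (fst X1)"
    and X2: "wf_graph (fst X2)" "connected_graph (fst X2)"
    and X3: "wf_graph (fst X3)" and S: "covering_subgraph (fst S) (fst X3)" and A: "finite A"
  shows "(\<Sum>v\<in>insertion_sites X2 (fst X3) A. \<Sum>b\<in>gluings (fst X2) (fst X3) v.
      insertion_sum_over \<Phi> X1 (insert_pair X2 (X3, S) v b) (sites_after (fst X2) A v)) -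
    (\<Sum>w\<in>insertion_sites X1 (fst X2) (verts (fst X2)). \<Sum>c\<in>gluings (fst X1) (fst X2) w.
      insertion_sum_over \<Phi> (insert_spec X1 X2 w c) (X3, S) A) =
    disjoint_insertion_sum \<Phi> X1 X2 (X3, S) A"
proof -
  let ?V = "insertion_sites X2 (fst X3) A" and ?W = "insertion_sites X1 (fst X2) (verts (fst X2))"
  let ?b = "gluings (fst X2) (fst X3)" and ?c = "gluings (fst X1) (fst X2)"
  let ?F = "\<lambda>w c v b. \<Phi> (pair_class (insert_pair (insert_spec X1 X2 w c) (X3, S) v b))"
  let ?t = "\<lambda>v. transport_gluing Inr id (star (fst X3) v)"
  have composite: "insertion_sum_over \<Phi> (insert_spec X1 X2 w c) (X3, S) A =
      (\<Sum>v\<in>?V. \<Sum>b\<in>?b v. ?F w c v (?t v b))" if w: "w \<in> ?W" and c: "c \<in> ?c w" for w c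
  proof -
    have "residue_type (insert_spec X1 X2 w c) = residue_type X2"
      using w by (intro insert_residue_type[OF X1 X2 _ c]) (simp add: insertion_sites_def)
    then have sites: "insertion_sites (insert_spec X1 X2 w c) (fst X3) A = ?V"
      by (simp add: insertion_sites_def)
    have g: "fst (insert_spec X1 X2 w c) = insert_graph (fst X1) (fst X2) w c"
      by (simp add: insert_spec_def)
    show ?thesis
      unfolding insertion_sum_over_def fst_conv sites g
      by (intro sum.cong refl sum.reindex_bij_betw[OF insert_gluings_composite, symmetric])
  qed
  have "(\<Sum>w\<in>?W. \<Sum>c\<in>?c w. insertion_sum_over \<Phi> (insert_spec X1 X2 w c) (X3, S) A) =
      (\<Sum>w\<in>?W. \<Sum>c\<in>?c w. \<Sum>v\<in>?V. \<Sum>b\<in>?b v. ?F w c v (?t v b))"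
    by (simp add: composite)
  also have "\<dots> = (\<Sum>v\<in>?V. \<Sum>b\<in>?b v. \<Sum>w\<in>?W. \<Sum>c\<in>?c w. ?F w c v (?t v b))"
    by (simp only: sum.swap[of _ "?V"] sum.swap[of _ "?b v" for v])
  finally have comp: "(\<Sum>w\<in>?W. \<Sum>c\<in>?c w. insertion_sum_over \<Phi> (insert_spec X1 X2 w c) (X3, S) A) =
      (\<Sum>v\<in>?V. \<Sum>b\<in>?b v. \<Sum>w\<in>?W. \<Sum>c\<in>?c w. ?F w c v (?t v b))" .
  let ?D = "\<lambda>v b w. \<Sum>c\<in>gluings (fst X1) (fst X3) w.
      \<Phi> (pair_class (insert_pair X1 (insert_pair X2 (X3, S) v b) (Inr w)
        (transport_gluing id Inr (star (fst X3) w) c)))"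
  have "(\<Sum>v\<in>?V. \<Sum>b\<in>?b v.
      insertion_sum_over \<Phi> X1 (insert_pair X2 (X3, S) v b) (sites_after (fst X2) A v)) =
      (\<Sum>v\<in>?V. \<Sum>b\<in>?b v. (\<Sum>w\<in>?W. \<Sum>c\<in>?c w. ?F w c v (?t v b)) +
        (\<Sum>w\<in>insertion_sites X1 (fst X3) (A - {v}). ?D v b w))"
    by (intro sum.cong refl iterated_insertion_split[OF X1(1) X2(1) X3 S A])
      (auto simp: insertion_sites_def)
  also have "\<dots> = (\<Sum>v\<in>?V. \<Sum>b\<in>?b v. \<Sum>w\<in>?W. \<Sum>c\<in>?c w. ?F w c v (?t v b)) +
      (\<Sum>v\<in>?V. \<Sum>b\<in>?b v. \<Sum>w\<in>insertion_sites X1 (fst X3) (A - {v}). ?D v b w)"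
    by (simp only: sum.distrib)
  also have "(\<Sum>v\<in>?V. \<Sum>b\<in>?b v. \<Sum>w\<in>insertion_sites X1 (fst X3) (A - {v}). ?D v b w) =
      disjoint_insertion_sum \<Phi> X1 X2 (X3, S) A"
    unfolding disjoint_insertion_sum_def Let_def fst_conv by (intro sum.cong refl sum.swap)
  finally show ?thesis unfolding comp by (simp only: add_diff_cancel_left')
qed

section \<open>The operations on classes\<close>

lemma insertion_sum_eq_over:
  "insertion_sum X1 X2 = insertion_sum_over (\<lambda>d. Poly_Mapping.single (fst ` d) 1) X1 (X2, X2)
    (verts (fst X2))"
  by (simp add: insertion_sum_def insertion_sum_over_def insertion_sites_def insert_pair_def
      spec_class_eq_image)

lemma action_sum_eq_over:
  "action_sum X1 (X2, S) = insertion_sum_over (\<lambda>d. Poly_Mapping.single d 1) X1 (X2, S)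
    (essential_verts (fst S))"
  by (simp add: action_sum_def insertion_sum_over_def insertion_sites_def insert_pair_def)

lemma spec_class_representative:
  assumes "wf_graph (fst X)"
  shows "\<exists>f g. spec_iso f g X (SOME Y. Y \<in> spec_class X)"
proof -
  have "\<exists>Y. Y \<in> spec_class X"
    using pair_class_nonempty[OF assms, of X] by (auto simp: spec_class_eq_image)
  then have "(SOME Y. Y \<in> spec_class X) \<in> spec_class X" by (rule someI_ex)
  then show ?thesis unfolding spec_class_def by blast
qed

text \<open>
  The operations are given by chosen representatives, and isomorphic representatives give the same
  sums. The label types are arbitrary here because the formula is applied to insertions.
\<close>

lemma action_single:
  assumes X1: "wf_graph (fst X1)" "connected_graph (fst X1)" and X2: "wf_graph (fst X2)"
    and S: "covering_subgraph (fst S) (fst X2)"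
  shows "action (Poly_Mapping.single (spec_class X1) 1) (Poly_Mapping.single (pair_class (X2, S)) 1) =
    (action_sum X1 (X2, S) :: 't pair_class \<Rightarrow>\<^sub>0 'k::field)"
proof -
  from spec_class_representative[OF X1(1)]
  obtain f1 g1 where 1: "spec_iso f1 g1 X1 (SOME Y. Y \<in> spec_class X1)" by blast
  have "\<exists>Q. Q \<in> pair_class (X2, S)"
    using S by (intro pair_class_nonempty[OF X2]) (simp_all add: covering_subgraph_def)
  then have "(SOME Q. Q \<in> pair_class (X2, S)) \<in> pair_class (X2, S)" by (rule someI_ex)
  then obtain f2 g2 where 2: "spec_iso f2 g2 X2 (fst (SOME Q. Q \<in> pair_class (X2, S)))"
    "spec_iso f2 g2 S (snd (SOME Q. Q \<in> pair_class (X2, S)))"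
    unfolding pair_class_def by auto
  show ?thesis
    unfolding action_def bilinear_extension_single
    by (rule action_sum_iso[OF 1 2 X1(1) X2 X1(2) S, symmetric, unfolded prod.collapse])
qed

lemma insertion_single:
  assumes X1: "wf_graph (fst X1)" "connected_graph (fst X1)" and X2: "wf_graph (fst X2)"
  shows "insertion (Poly_Mapping.single (spec_class X1) 1) (Poly_Mapping.single (spec_class X2) 1) =
    (insertion_sum X1 X2 :: 't spec_class \<Rightarrow>\<^sub>0 'k::field)"
proof -
  from spec_class_representative[OF X1(1)] obtain f1 g1 where 1: "spec_iso f1 g1 X1 (SOME Y. Y \<in> spec_class X1)" by blast
  from spec_class_representative[OF X2] obtain f2 g2 where 2: "spec_iso f2 g2 X2 (SOME Y. Y \<in> spec_class X2)" by blast
  show ?thesis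
    unfolding insertion_def bilinear_extension_single
    by (rule insertion_sum_iso[OF 1 2 X1(1) X2 X1(2), symmetric])
qed


section \<open>The pre-Lie module\<close>

definition spec_classes :: "'t qft \<Rightarrow> 't spec_class set" where
  "spec_classes T = {spec_class X | X :: (nat, nat, 't) spec_graph. connected_specified T X}"

definition pair_classes :: "'t qft \<Rightarrow> 't pair_class set" where
  "pair_classes T =
    {pair_class P | P :: (nat, nat, 't) spec_graph \<times> (nat, nat, 't) spec_graph. spec_pair T P}"

lemma V_space_eq: "V_space T = supported_on (spec_classes T)"
  by (simp add: V_space_def supported_on_def spec_classes_def)

lemma F_space_eq: "F_space T = supported_on (pair_classes T)"
  by (simp add: F_space_def supported_on_def pair_classes_def)

lemma spec_pairD:
  assumes "spec_pair T (X, S)"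
  shows "connected_specified T X" "covering_subgraph (fst S) (fst X)"
  using assms by (auto simp: spec_pair_def specified_covering_subgraph_def)

lemma spec_class_in_classes:
  assumes X: "connected_specified T X"
  shows "spec_class X \<in> spec_classes T"
proof -
  note wf = connected_specifiedD(1)[OF X]
  obtain f g where iso: "spec_iso f g X (SOME Y. Y \<in> spec_class X)"
    using spec_class_representative[OF wf] by blast
  show ?thesis
    using spec_class_eqI[OF iso wf] spec_iso_connected_specified[OF iso X]
    unfolding spec_classes_def by blast
qed

lemma pair_class_in_classes:
  assumes P: "spec_pair T (X, S)"
  shows "pair_class (X, S) \<in> pair_classes T"
proof -
  note wf = connected_specifiedD(1)[OF spec_pairD(1)[OF P]]
  have S: "wf_graph (fst S)" "verts (fst S) = verts (fst X)" "halves (fst S) = halves (fst X)"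
    using spec_pairD(2)[OF P] by (auto simp: covering_subgraph_def)
  obtain Y R where "(Y, R) \<in> pair_class (X, S)" using pair_class_nonempty[OF wf S(2,3)] by force
  then obtain f g where iso: "spec_iso f g X Y" "spec_iso f g S R" by (auto simp: pair_class_def)
  show ?thesis
    using pair_class_eqI[OF iso wf S] spec_iso_spec_pair[OF iso P] unfolding pair_classes_def by blast
qed

lemma single_supported: "b \<in> B \<Longrightarrow> Poly_Mapping.single b 1 \<in> supported_on B"
  by (simp add: supported_on_def)

lemma insertion_sum_supported:
  assumes X: "connected_specified T X1" "connected_specified T X2"
  shows "insertion_sum X1 X2 \<in> supported_on (spec_classes T)"
  unfolding insertion_sum_def
  by (intro pm.subspace_sum[OF subspace_supported_on] single_supported spec_class_in_classes
      insert_connected_specified[OF X]) auto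

lemma essential_verts_covering:
  "covering_subgraph S G \<Longrightarrow> wf_graph G \<Longrightarrow> essential_verts S \<subseteq> verts G \<and> finite (essential_verts S)"
  by (auto simp: covering_subgraph_def essential_verts_def wf_graph_def)

lemma action_sum_supported:
  assumes X1: "connected_specified T X1" and P: "spec_pair T (X2, S)"
  shows "action_sum X1 (X2, S) \<in> supported_on (pair_classes T)"
  unfolding action_sum_def prod.case
  using essential_verts_covering[OF spec_pairD(2)[OF P] connected_specifiedD(1)[OF spec_pairD(1)[OF P]]]
  by (intro pm.subspace_sum[OF subspace_supported_on] single_supported pair_class_in_classes
      insert_spec_pair[OF X1 P]) auto

lemma insertion_associator_single:
  fixes X1 :: "('u, 'f, 't) spec_graph"
  assumes X: "connected_specified T X1" "connected_specified T X2" "connected_specified T X3"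
  shows "insertion (Poly_Mapping.single (spec_class X1) 1)
      (insertion (Poly_Mapping.single (spec_class X2) 1) (Poly_Mapping.single (spec_class X3) 1)) -
    insertion (insertion (Poly_Mapping.single (spec_class X1) 1) (Poly_Mapping.single (spec_class X2) 1))
      (Poly_Mapping.single (spec_class X3) 1) =
    (disjoint_insertion_sum (\<lambda>d. Poly_Mapping.single (fst ` d) 1) X1 X2 (X3, X3) (verts (fst X3))
      :: 't spec_class \<Rightarrow>\<^sub>0 'k::field)"
    (is "?L1 - ?L2 = _")
proof -
  let ?\<Phi> = "\<lambda>d. Poly_Mapping.single (fst ` d) 1 :: 't spec_class \<Rightarrow>\<^sub>0 'k"
  note X1 = connected_specifiedD(1,2)[OF X(1)] and X2 = connected_specifiedD(1,2)[OF X(2)]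
    and X3 = connected_specifiedD(1,2)[OF X(3)]
  let ?V = "verts (fst X3)"
  have "?L1 = (\<Sum>v\<in>insertion_sites X2 (fst X3) ?V. \<Sum>b\<in>gluings (fst X2) (fst X3) v.
      insertion_sum X1 (insert_spec X2 X3 v b))"
    unfolding insertion_single[OF X2 X3(1)] insertion_sum_def[of X2]
    unfolding insertion_def bilinear_extension_sum_right
    unfolding insertion_def[symmetric] insertion_sites_def
    by (intro sum.cong refl insertion_single X1)
      (simp add: insert_spec_def insert_graph_wf X2 X3)
  also have "\<dots> = (\<Sum>v\<in>insertion_sites X2 (fst X3) ?V. \<Sum>b\<in>gluings (fst X2) (fst X3) v.
      insertion_sum_over ?\<Phi> X1 (insert_pair X2 (X3, X3) v b) (sites_after (fst X2) ?V v))"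
    unfolding insertion_sum_eq_over
    by (intro sum.cong refl arg_cong[where f = "insertion_sum_over _ _ _"])
      (simp_all add: insert_pair_def sites_after_def insert_spec_def insert_verts Plus_def)
  finally have L1: "?L1 = \<dots>" .
  have "?L2 = (\<Sum>w\<in>insertion_sites X1 (fst X2) (verts (fst X2)). \<Sum>c\<in>gluings (fst X1) (fst X2) w.
      insertion_sum (insert_spec X1 X2 w c) X3)"
    unfolding insertion_single[OF X1 X2(1)] insertion_sum_def[of X1]
    unfolding insertion_def bilinear_extension_sum_left
    unfolding insertion_def[symmetric] insertion_sites_def
    using connected_specifiedD(1,2)[OF insert_connected_specified[OF X(1,2)]]
    by (intro sum.cong refl insertion_single X3(1)) simp_all
  then have L2: "?L2 = (\<Sum>w\<in>insertion_sites X1 (fst X2) (verts (fst X2)).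
      \<Sum>c\<in>gluings (fst X1) (fst X2) w. insertion_sum_over ?\<Phi> (insert_spec X1 X2 w c) (X3, X3) ?V)"
    by (simp only: insertion_sum_eq_over)
  have "finite ?V" using X3(1) by (simp add: wf_graph_def)
  from insertion_associator[OF X1 X2 X3(1), where S = X3 and A = ?V and \<Phi> = ?\<Phi>, OF covering_subgraph_refl[OF X3(1)] this]
  show ?thesis unfolding L1 L2 .
qed

lemma action_associator_single:
  fixes X1 :: "('u, 'f, 't) spec_graph"
  assumes X: "connected_specified T X1" "connected_specified T X2" and P: "spec_pair T (X3, S)"
  shows "action (Poly_Mapping.single (spec_class X1) 1)
      (action (Poly_Mapping.single (spec_class X2) 1) (Poly_Mapping.single (pair_class (X3, S)) 1)) -
    action (insertion (Poly_Mapping.single (spec_class X1) 1) (Poly_Mapping.single (spec_class X2) 1))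
      (Poly_Mapping.single (pair_class (X3, S)) 1) =
    (disjoint_insertion_sum (\<lambda>d. Poly_Mapping.single d 1) X1 X2 (X3, S) (essential_verts (fst S))
      :: 't pair_class \<Rightarrow>\<^sub>0 'k::field)"
    (is "?L1 - ?L2 = _")
proof -
  let ?\<Phi> = "\<lambda>d. Poly_Mapping.single d 1 :: 't pair_class \<Rightarrow>\<^sub>0 'k"
  note X1 = connected_specifiedD(1,2)[OF X(1)] and X2 = connected_specifiedD(1,2)[OF X(2)]
    and X3 = connected_specifiedD(1,2)[OF spec_pairD(1)[OF P]] and S = spec_pairD(2)[OF P]
  have wfS: "wf_graph (fst S)" using S by (simp add: covering_subgraph_def)
  let ?E = "essential_verts (fst S)"
  have E: "?E \<subseteq> verts (fst X3)" "finite ?E" using essential_verts_covering[OF S X3(1)] by auto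
  have "?L1 = (\<Sum>v\<in>insertion_sites X2 (fst X3) ?E. \<Sum>b\<in>gluings (fst X2) (fst X3) v.
      action_sum X1 (insert_spec X2 X3 v b, insert_spec X2 S v b))"
    unfolding action_single[OF X2 X3(1) S] action_sum_def[of X2] prod.case
    unfolding action_def bilinear_extension_sum_right
    unfolding action_def[symmetric] insertion_sites_def
    by (intro sum.cong refl action_single X1)
      (simp_all add: insert_spec_def insert_graph_wf insert_covering X2 X3 S)
  also have "\<dots> = (\<Sum>v\<in>insertion_sites X2 (fst X3) ?E. \<Sum>b\<in>gluings (fst X2) (fst X3) v.
      insertion_sum_over ?\<Phi> X1 (insert_pair X2 (X3, S) v b) (sites_after (fst X2) ?E v))"
  proof (intro sum.cong refl)
    fix v b assume v: "v \<in> insertion_sites X2 (fst X3) ?E" and b: "b \<in> gluings (fst X2) (fst X3) v"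
    have "essential_verts (fst (insert_spec X2 S v b)) = sites_after (fst X2) ?E v"
      using insert_essential_verts[OF X2(1) wfS _ X2(2), of b v] v b
      by (simp add: covering_gluings[OF S] insertion_sites_def insert_spec_def sites_after_def)
    then show "action_sum X1 (insert_spec X2 X3 v b, insert_spec X2 S v b) =
        insertion_sum_over ?\<Phi> X1 (insert_pair X2 (X3, S) v b) (sites_after (fst X2) ?E v)"
      by (simp add: action_sum_eq_over insert_pair_def)
  qed
  finally have L1: "?L1 = \<dots>" .
  have "?L2 = (\<Sum>w\<in>insertion_sites X1 (fst X2) (verts (fst X2)). \<Sum>c\<in>gluings (fst X1) (fst X2) w.
      action_sum (insert_spec X1 X2 w c) (X3, S))"
    unfolding insertion_single[OF X1 X2(1)] insertion_sum_def[of X1]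
    unfolding action_def bilinear_extension_sum_left
    unfolding action_def[symmetric] insertion_sites_def
    using connected_specifiedD(1,2)[OF insert_connected_specified[OF X]]
    by (intro sum.cong refl action_single X3(1) S) simp_all
  then have L2: "?L2 = (\<Sum>w\<in>insertion_sites X1 (fst X2) (verts (fst X2)).
      \<Sum>c\<in>gluings (fst X1) (fst X2) w. insertion_sum_over ?\<Phi> (insert_spec X1 X2 w c) (X3, S) ?E)"
    by (simp only: action_sum_eq_over)
  from insertion_associator[OF X1 X2 X3(1) S E(2), where \<Phi> = ?\<Phi>]
  show ?thesis unfolding L1 L2 .
qed

lemma action_pre_lie:
  fixes x y :: "'t spec_class \<Rightarrow>\<^sub>0 'k::field"
  assumes "x \<in> V_space T" "y \<in> V_space T" "z \<in> F_space T"
  shows "action x (action y z) - action (insertion x y) z =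
    action y (action x z) - action (insertion y x) z"
  unfolding action_def insertion_def
proof (rule pre_lie_identity_from_basis[OF _ assms[unfolded V_space_eq F_space_eq]],
    unfold action_def[symmetric] insertion_def[symmetric])
  fix a b m assume "a \<in> spec_classes T" "b \<in> spec_classes T" "m \<in> pair_classes T"
  then obtain X1 X2 :: "(nat, nat, 't) spec_graph" and P :: "(nat, nat, 't) spec_graph \<times> (nat, nat, 't) spec_graph"
    where X: "connected_specified T X1" "a = spec_class X1" "connected_specified T X2" "b = spec_class X2"
      and P: "spec_pair T P" "m = pair_class P"
    unfolding spec_classes_def pair_classes_def by blast
  obtain X3 S where XS: "P = (X3, S)" by (cases P)
  note P' = P(1)[unfolded XS]
  note wf = connected_specifiedD(1)
  note com = disjoint_insertion_sum_commute[OF wf[OF X(1)] wf[OF X(3)] wf[OF spec_pairD(1)[OF P']]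
      spec_pairD(2)[OF P'] conjunct2[OF essential_verts_covering[OF spec_pairD(2)[OF P'] wf[OF spec_pairD(1)[OF P']]]]]
  show "(\<lambda>x y z. action x (action y z) - action (insertion x y) z =
      action y (action x z) - action (insertion y x) z)
    (Poly_Mapping.single a 1) (Poly_Mapping.single b 1)
    (Poly_Mapping.single m 1 :: 't pair_class \<Rightarrow>\<^sub>0 'k)"
    unfolding X(2,4) P(2) XS action_associator_single[OF X(1,3) P'] action_associator_single[OF X(3,1) P']
    by (rule com)
qed

lemma insertion_pre_lie:
  fixes x y z :: "'t spec_class \<Rightarrow>\<^sub>0 'k::field"
  assumes "x \<in> V_space T" "y \<in> V_space T" "z \<in> V_space T"
  shows "insertion x (insertion y z) - insertion (insertion x y) z =
    insertion y (insertion x z) - insertion (insertion y x) z"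
  unfolding insertion_def
proof (rule pre_lie_identity_from_basis[OF _ assms[unfolded V_space_eq]],
    unfold insertion_def[symmetric])
  fix a b c assume "a \<in> spec_classes T" "b \<in> spec_classes T" "c \<in> spec_classes T"
  then obtain X1 X2 X3 :: "(nat, nat, 't) spec_graph"
    where X: "connected_specified T X1" "a = spec_class X1" "connected_specified T X2" "b = spec_class X2"
      "connected_specified T X3" "c = spec_class X3"
    unfolding spec_classes_def by blast
  note wf = connected_specifiedD(1)
  have "finite (verts (fst X3))" using wf[OF X(5)] by (simp add: wf_graph_def)
  note com = disjoint_insertion_sum_commute[OF wf[OF X(1)] wf[OF X(3)] wf[OF X(5)]
      covering_subgraph_refl[OF wf[OF X(5)]] this]
  show "(\<lambda>x y z. insertion x (insertion y z) - insertion (insertion x y) z =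
      insertion y (insertion x z) - insertion (insertion y x) z)
    (Poly_Mapping.single a 1) (Poly_Mapping.single b 1)
    (Poly_Mapping.single c 1 :: 't spec_class \<Rightarrow>\<^sub>0 'k)"
    unfolding X(2,4,6) insertion_associator_single[OF X(1,3,5)] insertion_associator_single[OF X(3,1,5)]
    by (rule com)
qed

lemma insertion_closed:
  fixes x y :: "'t spec_class \<Rightarrow>\<^sub>0 'k::field"
  assumes "x \<in> V_space T" "y \<in> V_space T"
  shows "insertion x y \<in> V_space T"
  unfolding insertion_def V_space_eq
proof (rule bilinear_extension_closed[OF assms[unfolded V_space_eq]])
  fix a b assume "a \<in> spec_classes T" "b \<in> spec_classes T"
  then obtain X1 X2 :: "(nat, nat, 't) spec_graph" where X: "connected_specified T X1" "a = spec_class X1"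
    "connected_specified T X2" "b = spec_class X2"
    unfolding spec_classes_def by blast
  show "(insertion_sum (SOME X1. X1 \<in> a) (SOME X2. X2 \<in> b) :: 't spec_class \<Rightarrow>\<^sub>0 'k)
      \<in> supported_on (spec_classes T)"
    unfolding X(2,4) insertion_class[OF X(1,3), unfolded insertion_def bilinear_extension_single]
    by (rule insertion_sum_supported[OF X(1,3)])
qed

lemma action_closed:
  fixes x :: "'t spec_class \<Rightarrow>\<^sub>0 'k::field"
  assumes "x \<in> V_space T" "y \<in> F_space T"
  shows "action x y \<in> F_space T"
  unfolding action_def F_space_eq
proof (rule bilinear_extension_closed[OF assms[unfolded V_space_eq F_space_eq]])
  fix a m assume "a \<in> spec_classes T" "m \<in> pair_classes T"
  then obtain X1 :: "(nat, nat, 't) spec_graph" and P :: "(nat, nat, 't) spec_graph \<times> (nat, nat, 't) spec_graph"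
    where X: "connected_specified T X1" "a = spec_class X1" and P: "spec_pair T P" "m = pair_class P"
    unfolding spec_classes_def pair_classes_def by blast
  obtain X2 S where XS: "P = (X2, S)" by (cases P)
  show "(action_sum (SOME X. X \<in> a) (SOME P. P \<in> m) :: 't pair_class \<Rightarrow>\<^sub>0 'k)
      \<in> supported_on (pair_classes T)"
    unfolding X(2) P(2) action_class[OF X(1) P(1), unfolded action_def bilinear_extension_single]
    unfolding XS by (rule action_sum_supported[OF X(1) P(1)[unfolded XS]])
qed

lemma insertion_linear:
  "insertion (x + x') y = insertion x y + insertion x' y"
  "insertion x (y + y') = insertion x y + insertion x y'"
  "insertion (scale_pm r x) y = scale_pm r (insertion x y)"
  "insertion x (scale_pm r y) = scale_pm r (insertion x y)"
  unfolding insertion_def by (rule bilinear_extension_linear)+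

lemma action_linear:
  "action (x + x') z = action x z + action x' z"
  "action x (z + z') = action x z + action x z'"
  "action (scale_pm r x) z = scale_pm r (action x z)"
  "action x (scale_pm r z) = scale_pm r (action x z)"
  unfolding action_def by (rule bilinear_extension_linear)+

theorem theorem4:
  fixes T :: "'t qft"
  assumes "physical_theory T"
  shows "left_pre_lie_module
    scale_pm (V_space T :: ('t spec_class \<Rightarrow>\<^sub>0 'k::field) set) insertion
    scale_pm (F_space T :: ('t pair_class \<Rightarrow>\<^sub>0 'k) set) action"
proof -
  interpret alg: left_pre_lie_algebra scale_pm "V_space T :: ('t spec_class \<Rightarrow>\<^sub>0 'k) set" insertion
  proof
    show "pm.subspace (V_space T :: ('t spec_class \<Rightarrow>\<^sub>0 'k) set)"
      unfolding V_space_eq by (rule subspace_supported_on)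
  qed (rule insertion_closed insertion_linear insertion_pre_lie; assumption)+
  show ?thesis
  proof
    show "pm.subspace (F_space T :: ('t pair_class \<Rightarrow>\<^sub>0 'k) set)"
      unfolding F_space_eq by (rule subspace_supported_on)
  qed (rule action_closed action_linear action_pre_lie; assumption)+
qed

end
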